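(* Let $\varepsilon,\delta\in(0,1)$. Consider a general expiration stream of $n$ items, each item being an element of a universe $[U]=\{1,\dots,U\}$. There is a randomized sketch (a Count-Min sketch whose counters are general-expiration approximate counters) storing $\mathcal{O}((1/\varepsilon^2)\log(1/\delta)\log\log(1/\delta))$ words such that, with probability at least $1-\delta$, for a query $q\in[U]$ its estimate $\hat S(q)$ satisfies $|\hat S(q)-f_q|\le\varepsilon n$, where $f_q$ is the number of currently active items equal to $q$.
   Context: General expiration streaming model: items arrive in a sequence, each with a value in $[U]$, an insertion time $S(x)$ (non-decreasing along the stream) and an arbitrary expiration time $E(x)>S(x)$ (possibly $\infty$); item $x$ is active at time $t$ iff $S(x)\le t<E(x)$. Space is measured in words (each storing a time, a universe element, or a counter in $[\mathrm{poly}(n)]$). *)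

theory Defs
  imports "HOL-Probability.Probability"
begin

text \<open>A lifetime is a pair of an insertion time \<open>S\<close> and an expiration time \<open>E\<close> (possibly infinite);
  an item is a universe element together with its lifetime.\<close>

type_synonym lifetime = "real \<times> ereal"
type_synonym item = "nat \<times> lifetime"

definition valid_lifetimes :: "lifetime list \<Rightarrow> bool" where
  "valid_lifetimes ls \<longleftrightarrow> sorted (map fst ls) \<and> (\<forall>(s, e)\<in>set ls. ereal s < e)"

definition general_expiration_stream :: "nat \<Rightarrow> item list \<Rightarrow> bool" where
  "general_expiration_stream U xs \<longleftrightarrow> fst ` set xs \<subseteq> {1..U} \<and> valid_lifetimes (map snd xs)"

definition inserted_by :: "real \<Rightarrow> lifetime list \<Rightarrow> bool" where
  "inserted_by t ls \<longleftrightarrow> (\<forall>(s, e)\<in>set ls. s \<le> t)"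

definition active :: "real \<Rightarrow> lifetime \<Rightarrow> bool" where
  "active t = (\<lambda>(s, e). s \<le> t \<and> ereal t < e)"

definition active_count :: "real \<Rightarrow> lifetime list \<Rightarrow> nat" where
  "active_count t ls = length (filter (active t) ls)"

definition frequency :: "real \<Rightarrow> item list \<Rightarrow> nat \<Rightarrow> nat" where
  "frequency t xs q = active_count t (map snd (filter (\<lambda>x. fst x = q) xs))"

datatype word = TimeWord ereal | ElemWord nat | CounterWord nat

text \<open>A time word may only hold a time that occurred in the stream: an arbitrary real number could
  encode the whole input in a single word. The parameter \<open>k\<close> is the exponent of the polynomial
  bound on counters; the base is \<open>n + 2\<close> so that every polynomial in \<open>n\<close> is below some power.\<close>

fun storable :: "nat \<Rightarrow> nat \<Rightarrow> item list \<Rightarrow> word \<Rightarrow> bool" where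
  "storable k U xs (TimeWord \<tau>) \<longleftrightarrow> (\<exists>(x, s, e)\<in>set xs. \<tau> = ereal s \<or> \<tau> = e)"
| "storable k U xs (ElemWord u) \<longleftrightarrow> u \<in> {1..U}"
| "storable k U xs (CounterWord c) \<longleftrightarrow> c \<le> (length xs + 2) ^ k"

text \<open>Randomized streaming algorithms with items \<open>'x\<close>, queries \<open>'q\<close> and states \<open>'s\<close>. Every update
  draws fresh coins; whatever has to be remembered is part of the state.\<close>

record ('x, 'q, 's) sketch =
  init :: "'s pmf"
  update :: "'x \<Rightarrow> 's \<Rightarrow> 's pmf"
  estimate :: "'q \<Rightarrow> 's \<Rightarrow> real"

definition run :: "('x, 'q, 's) sketch \<Rightarrow> 'x list \<Rightarrow> 's pmf" where
  "run A xs = foldl (\<lambda>p x. bind_pmf p (update A x)) (init A) xs"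

text \<open>A counter never sees universe elements; it is queried with the current time.\<close>

type_synonym counter = "(lifetime, real, word list) sketch"

definition approximate_counter :: "real \<Rightarrow> real \<Rightarrow> counter \<Rightarrow> bool" where
  "approximate_counter \<epsilon> \<delta> K \<longleftrightarrow>
     (\<forall>ls t. valid_lifetimes ls \<and> inserted_by t ls \<longrightarrow>
        measure_pmf.prob (run K ls)
          {s. \<bar>estimate K t s - real (active_count t ls)\<bar> \<le> \<epsilon> * real (length ls)} \<ge> 1 - \<delta>)"

definition pairwise_independent_hashing ::
    "nat \<Rightarrow> nat \<Rightarrow> 'g pmf \<Rightarrow> ('g \<Rightarrow> nat \<Rightarrow> nat) \<Rightarrow> bool" where
  "pairwise_independent_hashing U w G h \<longleftrightarrow>
     (\<forall>x\<in>{1..U}. map_pmf (\<lambda>g. h g x) G = pmf_of_set {..<w}) \<and>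
     (\<forall>x\<in>{1..U}. \<forall>y\<in>{1..U}. x \<noteq> y \<longrightarrow>
        prob_space.indep_var (measure_pmf G)
          (count_space UNIV) (\<lambda>g. h g x) (count_space UNIV) (\<lambda>g. h g y))"

text \<open>Independent draws from a list of distributions.\<close>

primrec draw_all :: "'a pmf list \<Rightarrow> 'a list pmf" where
  "draw_all [] = return_pmf []"
| "draw_all (p # ps) = map_pmf (\<lambda>(y, ys). y # ys) (pair_pmf p (draw_all ps))"

text \<open>A row of a Count-Min sketch consists of the words describing its hash function and of its
  \<open>w\<close> counter states. An arriving item is fed, in each row, to the counter its value hashes to.\<close>

type_synonym cm_state = "(word list \<times> word list list) list"
type_synonym cm_sketch = "(item, real \<times> nat, cm_state) sketch"

definition count_min ::
    "nat \<Rightarrow> nat \<Rightarrow> word list pmf \<Rightarrow> (word list \<Rightarrow> nat \<Rightarrow> nat) \<Rightarrow> counter \<Rightarrow> cm_sketch" where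
  "count_min d w G h K =
    \<lparr> init = draw_all (replicate d (pair_pmf G (draw_all (replicate w (init K))))),
      update = (\<lambda>(x, l) st. draw_all (map (\<lambda>(g, cells).
        map_pmf (\<lambda>c. (g, cells[h g x := c])) (update K l (cells ! h g x))) st)),
      estimate = (\<lambda>(t, q) st. Min ((\<lambda>(g, cells). estimate K t (cells ! h g q)) ` set st)) \<rparr>"

definition expiration_count_min :: "nat \<Rightarrow> real \<Rightarrow> real \<Rightarrow> cm_sketch \<Rightarrow> bool" where
  "expiration_count_min U \<epsilon> \<delta> A \<longleftrightarrow>
     (\<exists>d w G h K. 0 < d \<and> 0 < w \<and> pairwise_independent_hashing U w G h \<and>
        approximate_counter \<epsilon> \<delta> K \<and> A = count_min d w G h K)"

definition cm_words :: "cm_state \<Rightarrow> word list" where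
  "cm_words st = concat (map (\<lambda>(g, cells). g @ concat cells) st)"

text \<open>For \<open>\<delta>\<close> close to 1 the factors \<open>log(1/\<delta>)\<close> and \<open>log log(1/\<delta>)\<close> drop below 1 (the latter even
  below 0); as usual inside an O-bound, they are then read as 1.\<close>

definition word_bound :: "real \<Rightarrow> real \<Rightarrow> real" where
  "word_bound \<epsilon> \<delta> = (1 / \<epsilon>\<^sup>2) * max 1 (ln (1 / \<delta>)) * max 1 (ln (ln (1 / \<delta>)))"

end

theory Submission
  imports Defs
begin

text \<open>Since a query never precedes an insertion, a counter only has to estimate how many expiration
  times exceed the query time, so it is a quantile sketch. Such a sketch of
  \<open>O((1/\<epsilon>) log log (1/\<delta>))\<close> words is built in three layers, with weights growing with the stream. Reservoir
  sampling over blocks feeds a short hierarchy of compactors; a full compactor sorts its content and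
  passes on every fourth element, starting at a random offset. The resulting weighted points enter a
  deterministic summary of Greenwald-Khanna type. It keeps a bounded number of markers per dyadic age
  class, and only \<open>O(log log (1/\<delta>))\<close> age classes matter, because the points entering it already weigh
  an \<open>\<Omega>(\<epsilon> / log (1/\<delta>))\<close> fraction of the stream. All random errors are centred, and one
  exponential supermartingale over the states of the sketch controls them at once.

  In the Count-Min sketch a row overestimates by more than \<open>\<epsilon> n\<close> with probability at most 1/2, and
  the rows are independent; underestimation requires one of the counters to fail. The hash functions
  are random affine maps over the field with two elements.\<close>

section \<open>Rank summaries with two-sided masses\<close>

text \<open>The two kinds of error are kept apart by one-sidedness. Deleting markers only lowers the
  estimated weight on either side of \<open>t\<close>, and \<open>est_total\<close> bounds what both
  sides lose together. So upper tails suffice: an upper tail on one side is, through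
  \<open>est_total\<close>, a lower tail on the other. For upper tails a deletion never hurts the
  supermartingale, however the deterministic summary reacts to its random input.

  A compactor keeps a quarter because the variance per item at a level is proportional to the weight
  of its points over the size of its buffer. With weights changing by the factor 4 and sizes by the
  factor 2 from level to level, total size and total variance are both geometric sums; keeping a
  half would require a ratio of sizes strictly between 1 and 2.

  The minimum over the rows is spoilt by a single underestimating counter, so each may fail only
  with probability \<open>\<delta> / (4 * d)\<close>. The number \<open>d\<close> of rows already
  costs the factor log (1/\<delta>), hence the failure probability may enter the size of a counter
  only doubly logarithmically.\<close>

datatype marker = Marker (place: ereal) (birth: nat) (lmass: nat) (rmass: nat)

definition lsum :: "nat \<Rightarrow> marker list \<Rightarrow> nat" where
  "lsum k Z = sum_list (map lmass (take k Z))"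

definition rsum :: "nat \<Rightarrow> marker list \<Rightarrow> nat" where
  "rsum k Z = sum_list (map rmass (drop k Z))"

definition mass_since :: "(marker \<Rightarrow> nat) \<Rightarrow> nat \<Rightarrow> marker list \<Rightarrow> nat" where
  "mass_since f m Z = sum_list (map f (filter (\<lambda>z. m \<le> birth z) Z))"

definition mass_at :: "bool \<Rightarrow> real \<Rightarrow> marker list \<Rightarrow> nat" where
  "mass_at D t Z = (if D then sum_list (map rmass (filter (\<lambda>z. ereal t < place z) Z))
                    else sum_list (map lmass (filter (\<lambda>z. place z \<le> ereal t) Z)))"

section \<open>Dyadic age classes\<close>

text \<open>The start of the last complete dyadic block of length \<open>2 ^ a\<close>; truncated
  subtraction gives 0 while there is none. Aligning the blocks to multiples of \<open>2 ^ a\<close>,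
  instead of subtracting a fixed age from \<open>T\<close>, is what makes
  \<open>thresholds_Suc\<close> true.\<close>

definition threshold :: "nat \<Rightarrow> nat \<Rightarrow> nat" where
  "threshold a T = (T div 2 ^ a - 1) * 2 ^ a"

definition thresholds :: "nat \<Rightarrow> nat set" where
  "thresholds T = insert T (range (\<lambda>a. threshold a T))"

lemma threshold_le: "threshold a T \<le> T"
proof -
  have "threshold a T \<le> (T div 2 ^ a) * 2 ^ a"
    unfolding threshold_def by (intro mult_right_mono) auto
  also have "\<dots> \<le> T" by simp
  finally show ?thesis .
qed

lemma thresholds_le: "m \<in> thresholds T \<Longrightarrow> m \<le> T"
  using threshold_le unfolding thresholds_def by auto

lemma threshold_antimono_Suc: "threshold (Suc a) T \<le> threshold a T"
proof -
  define d where "d = T div 2 ^ a"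
  have e: "T div 2 ^ Suc a = d div 2" unfolding d_def
    by (metis div_mult2_eq power_Suc2)
  have "(d div 2 - 1) * 2 \<le> d - 1" by presburger
  then have "(d div 2 - 1) * 2 * 2 ^ a \<le> (d - 1) * 2 ^ a" by (intro mult_right_mono) auto
  then show ?thesis unfolding threshold_def e d_def[symmetric] by (simp add: mult.assoc)
qed

lemma threshold_antimono: "a \<le> b \<Longrightarrow> threshold b T \<le> threshold a T"
  by (rule lift_Suc_antimono_le[of "\<lambda>a. threshold a T"]) (auto intro: threshold_antimono_Suc)

lemma age_below: "T < threshold a T + 2 * 2 ^ a"
proof -
  have "T = T div 2 ^ a * 2 ^ a + T mod 2 ^ a" by (simp only: div_mult_mod_eq)
  moreover have "T mod 2 ^ a < 2 ^ a" by simp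
  ultimately have "T < T div 2 ^ a * 2 ^ a + 2 ^ a" by linarith
  also have "\<dots> \<le> threshold a T + 2 * 2 ^ a"
    unfolding threshold_def by (simp add: diff_mult_distrib)
  finally show ?thesis .
qed

lemma age_above: "0 < threshold a T \<Longrightarrow> threshold a T + 2 ^ a \<le> T"
proof -
  assume "0 < threshold a T"
  then have "T div 2 ^ a \<ge> 1" unfolding threshold_def by (cases "T div 2 ^ a") auto
  then have "threshold a T + 2 ^ a = (T div 2 ^ a) * 2 ^ a"
    unfolding threshold_def by (simp add: diff_mult_distrib)
  then show ?thesis by simp
qed

lemma threshold_zero: "T < 2 * 2 ^ a \<Longrightarrow> threshold a T = 0"
  using age_above[of a T] unfolding threshold_def
  by (metis One_nat_def diff_is_0_eq less_Suc_eq_le less_mult_imp_div_less mult_is_0 numeral_2_eq_2)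

text \<open>The set never regains an old clock value. A mass bound that is given up at some
  \<open>m\<close> outside the set is therefore never asked for again, and deletions have to respect
  only logarithmically many values.\<close>

lemma thresholds_Suc: "thresholds (Suc T) \<subseteq> insert (Suc T) (thresholds T)"
proof
  fix m assume "m \<in> thresholds (Suc T)"
  then consider "m = Suc T" | a where "m = threshold a (Suc T)" unfolding thresholds_def by auto
  then show "m \<in> insert (Suc T) (thresholds T)"
  proof cases
    case 1 then show ?thesis by simp
  next
    case 2
    show ?thesis
    proof (cases "2 ^ a dvd Suc T")
      case False
      then have "Suc T div 2 ^ a = T div 2 ^ a" by (simp add: div_Suc dvd_eq_mod_eq_0)
      then have "m = threshold a T" using 2 unfolding threshold_def by simp
      then show ?thesis unfolding thresholds_def by auto
    next
      \<comment> \<open>A block of length \<open>2 ^ a\<close> has just been completed, and the new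
        threshold is its start. One tick earlier the clock was in the second half of this block,
        whose first half was the last complete block of half the length. For \<open>a = 0\<close>
        the new threshold is \<open>T\<close>, which is why \<open>thresholds T\<close> contains
        \<open>T\<close>.\<close>
      case True
      show ?thesis
      proof (cases a)
        case 0
        then show ?thesis using 2 unfolding threshold_def thresholds_def by auto
      next
        case (Suc b)
        from True obtain c where c: "Suc T = 2 ^ a * c" by (auto elim: dvdE)
        then obtain c' where c': "c = Suc c'" by (cases c) auto
        have e: "T = (2 * c' + 1) * 2 ^ b + (2 ^ b - 1)"
          using c c' Suc by (simp add: algebra_simps)
        have d: "T div 2 ^ b = 2 * c' + 1"
          by (subst e, subst div_mult_self3) auto
        have "m = c' * 2 ^ a" using 2 c c' unfolding threshold_def by simp
        also have "\<dots> = threshold b T" unfolding threshold_def d Suc by simp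
        finally show ?thesis unfolding thresholds_def by auto
      qed
    qed
  qed
qed

lemma thresholds_mono: "T \<le> T' \<Longrightarrow> thresholds T' \<subseteq> thresholds T \<union> {T<..T'}"
proof (induction T' rule: dec_induct)
  case (step n)
  then show ?case using thresholds_Suc[of n] by fastforce
qed simp

text \<open>Every inserted point carries its weight twice, as \<open>lmass\<close> and as \<open>rmass\<close>. When markers are
  deleted, \<open>lmass\<close> moves to the right and \<open>rmass\<close> to the left, so \<open>mass_at\<close> only ever underestimates
  the weight on its side of \<open>t\<close>. A marker retains in \<open>birth\<close> (the clock at its insertion) an upper
  bound, up to the factor \<open>2 ^ J\<close>, on the uncertainty of its own rank.\<close>

definition valid :: "nat \<Rightarrow> (nat \<Rightarrow> nat) \<Rightarrow> nat \<Rightarrow> nat \<Rightarrow> marker list \<Rightarrow> bool" where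
  "valid J wt T N Z \<longleftrightarrow> sorted (map place Z) \<and>
     (\<forall>k\<le>length Z. 2 ^ J * N \<le> T + 2 ^ J * (lsum k Z + rsum k Z)) \<and>
     (\<forall>i<length Z. 2 ^ J * N \<le> birth (Z ! i) + 2 ^ J * (lsum (Suc i) Z + rsum i Z)) \<and>
     (\<forall>m\<in>thresholds T. mass_since lmass m Z + m \<le> N \<and> mass_since rmass m Z + m \<le> N) \<and>
     (\<forall>z\<in>set Z. birth z \<le> T \<and> wt (birth z) \<le> lmass z)"

lemma valid_Nil: "valid J wt 0 0 []"
  by (auto simp: valid_def lsum_def rsum_def mass_since_def dest: thresholds_le)

section \<open>Inserting markers and advancing the clock\<close>

lemma mass_since_append [simp]: "mass_since f m (X @ Y) = mass_since f m X + mass_since f m Y"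
  by (simp add: mass_since_def)

lemma mass_since_Cons: "mass_since f m (x # Y) = (if m \<le> birth x then f x else 0) + mass_since f m Y"
  by (simp add: mass_since_def)

lemma mass_since_Nil [simp]: "mass_since f m [] = 0"
  by (simp add: mass_since_def)

lemma insort_key_split:
  assumes "sorted (map f Z)"
  shows "\<exists>P Q. Z = P @ Q \<and> insort_key f x Z = P @ x # Q \<and> (\<forall>z\<in>set P. f z \<le> f x) \<and> (\<forall>z\<in>set Q. f x \<le> f z)"
  using assms
proof (induction Z)
  case Nil
  then show ?case by auto
next
  case (Cons a Z)
  show ?case
  proof (cases "f x \<le> f a")
    case True
    then have "a # Z = [] @ (a # Z) \<and> insort_key f x (a # Z) = [] @ x # (a # Z) \<and> (\<forall>z\<in>set []. f z \<le> f x) \<and> (\<forall>z\<in>set (a # Z). f x \<le> f z)"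
      using Cons.prems by (auto intro: order_trans)
    then show ?thesis by blast
  next
    case False
    from Cons obtain P Q where "Z = P @ Q" "insort_key f x Z = P @ x # Q" "\<forall>z\<in>set P. f z \<le> f x" "\<forall>z\<in>set Q. f x \<le> f z" by auto
    then have "a # Z = (a # P) @ Q \<and> insort_key f x (a # Z) = (a # P) @ x # Q \<and> (\<forall>z\<in>set (a # P). f z \<le> f x) \<and> (\<forall>z\<in>set Q. f x \<le> f z)"
      using False by auto
    then show ?thesis by blast
  qed
qed

text \<open>At every cut and at every other marker, \<open>W\<close> enters exactly one of the two
  sums. The new marker inherits the gap of the cut where it lands, with its own weight to spare, so
  the clock \<open>T\<close> bounds its uncertainty.\<close>

lemma valid_insort:
  assumes v: "valid J wt T N Z" and w: "wt T \<le> W"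
  shows "valid J wt T (N + W) (insort_key place (Marker x T W W) Z)"
proof -
  let ?x = "Marker x T W W"
  have s: "sorted (map place Z)" using v by (simp add: valid_def)
  obtain P Q where Z: "Z = P @ Q" and Z': "insort_key place ?x Z = P @ ?x # Q"
    using insort_key_split[OF s, of ?x] by blast
  have V1: "2 ^ J * N \<le> T + 2 ^ J * (lsum k Z + rsum k Z)" if "k \<le> length Z" for k
    using v that by (simp add: valid_def)
  have V2: "2 ^ J * N \<le> birth (Z ! i) + 2 ^ J * (lsum (Suc i) Z + rsum i Z)" if "i < length Z" for i
    using v that by (simp add: valid_def)
  have low: "lsum k (P @ ?x # Q) = lsum k Z \<and> rsum k (P @ ?x # Q) = rsum k Z + W" if "k \<le> length P" for k
    using that by (simp add: Z lsum_def rsum_def)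
  have high: "lsum (Suc k) (P @ ?x # Q) = lsum k Z + W \<and> rsum (Suc k) (P @ ?x # Q) = rsum k Z" if "length P \<le> k" for k
    using that by (simp add: Z lsum_def rsum_def Suc_diff_le)
  have 1: "2 ^ J * (N + W) \<le> T + 2 ^ J * (lsum k (P @ ?x # Q) + rsum k (P @ ?x # Q))"
    if k: "k \<le> length (P @ ?x # Q)" for k
  proof (cases "k \<le> length P")
    case True
    then show ?thesis using low[OF True] V1[of k] Z by (simp add: algebra_simps)
  next
    case False
    then obtain k' where "k = Suc k'" "length P \<le> k'" by (cases k) auto
    then show ?thesis using high[of k'] V1[of k'] Z k by (simp add: algebra_simps)
  qed
  have 2: "2 ^ J * (N + W) \<le> birth ((P @ ?x # Q) ! i) + 2 ^ J * (lsum (Suc i) (P @ ?x # Q) + rsum i (P @ ?x # Q))"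
    if i: "i < length (P @ ?x # Q)" for i
  proof -
    consider "i < length P" | "i = length P" | i' where "i = Suc i'" "length P \<le> i'"
      using less_linear[of i "length P"] by (metis Suc_le_eq less_imp_Suc_add add_Suc_right le_add1)
    then show ?thesis
    proof cases
      case 1
      then show ?thesis using low[of "Suc i"] low[of i] V2[of i] Z by (simp add: algebra_simps nth_append)
    next
      case 2
      then show ?thesis using low[of i] high[of i] V1[of i] Z by (simp add: algebra_simps nth_append)
    next
      case 3
      then show ?thesis using high[of i] high[of i'] V2[of i'] Z i by (simp add: algebra_simps nth_append Suc_diff_le)
    qed
  qed
  have 3: "mass_since lmass m (P @ ?x # Q) + m \<le> N + W \<and> mass_since rmass m (P @ ?x # Q) + m \<le> N + W"
    if "m \<in> thresholds T" for m
    using v that by (fastforce simp: valid_def Z mass_since_Cons)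
  show ?thesis
    unfolding valid_def
  proof (intro conjI)
    show "sorted (map place (insort_key place ?x Z))" using s by (simp add: sorted_insort_key)
    show "\<forall>z\<in>set (insort_key place ?x Z). birth z \<le> T \<and> wt (birth z) \<le> lmass z"
      using v w by (auto simp: valid_def set_insort_key)
  qed (use 1 2 3 Z' in auto)
qed

text \<open>The clock stands still while a batch is inserted. Thresholds that come into play when it
  advances are later than all births, so no mass is born since then.\<close>

lemma valid_advance:
  assumes v: "valid J wt T N Z" and T': "T \<le> T'" "T' \<le> N"
  shows "valid J wt T' N Z"
proof -
  have 0: "mass_since f m Z = 0" if "m > T" for f m
    using v that unfolding mass_since_def valid_def by (subst filter_False) auto
  have 1: "mass_since lmass m Z + m \<le> N \<and> mass_since rmass m Z + m \<le> N" if "m \<in> thresholds T'" for m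
  proof (cases "m \<in> thresholds T")
    case True then show ?thesis using v by (simp add: valid_def)
  next
    case False
    then have "m > T" "m \<le> T'" using thresholds_mono[OF T'(1)] that by auto
    then show ?thesis using 0 T'(2) by simp
  qed
  show ?thesis using v T'(1) 1 unfolding valid_def by (auto intro: order_trans le_trans simp: add_mono)
qed

section \<open>Deleting a run of markers\<close>

definition give_rmass :: "nat \<Rightarrow> marker list \<Rightarrow> marker list" where
  "give_rmass m P = (if P = [] then [] else butlast P @
     [Marker (place (last P)) (birth (last P)) (lmass (last P)) (rmass (last P) + m)])"

definition give_lmass :: "nat \<Rightarrow> marker list \<Rightarrow> marker list" where
  "give_lmass m Q = (case Q of [] \<Rightarrow> [] | z # Q' \<Rightarrow>
     Marker (place z) (birth z) (lmass z + m) (rmass z) # Q')"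

text \<open>At an end of the list, mass without a receiver is dropped; the hypothesis
  \<open>gap\<close> of \<open>valid_excise\<close> accounts for this loss.\<close>

definition excise :: "marker list \<Rightarrow> marker list \<Rightarrow> marker list \<Rightarrow> marker list" where
  "excise P M Q = give_rmass (sum_list (map rmass M)) P @ give_lmass (sum_list (map lmass M)) Q"

lemma length_give [simp]: "length (give_rmass m P) = length P" "length (give_lmass m Q) = length Q"
  by (auto simp: give_rmass_def give_lmass_def split: list.splits)

lemma map_give_rmass [simp]: "map place (give_rmass m P) = map place P"
    "map birth (give_rmass m P) = map birth P" "map lmass (give_rmass m P) = map lmass P"
  by (cases P rule: rev_cases; simp add: give_rmass_def)+

lemma map_give_lmass [simp]: "map place (give_lmass m P) = map place P"
    "map birth (give_lmass m P) = map birth P" "map rmass (give_lmass m P) = map rmass P"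
  by (cases P; simp add: give_lmass_def)+

lemma nth_give [simp]:
  "i < length P \<Longrightarrow> place (give_rmass m P ! i) = place (P ! i)"
  "i < length P \<Longrightarrow> birth (give_rmass m P ! i) = birth (P ! i)"
  "i < length P \<Longrightarrow> birth (give_lmass m P ! i) = birth (P ! i)"
  by (metis map_give_rmass map_give_lmass length_give nth_map)+

lemma lsum_give_rmass [simp]: "lsum k (give_rmass m P) = lsum k P"
  unfolding lsum_def by (metis map_give_rmass(3) take_map)

lemma rsum_give_lmass [simp]: "rsum k (give_lmass m P) = rsum k P"
  unfolding rsum_def by (metis map_give_lmass(3) drop_map)

lemma rsum_give_rmass: "k < length P \<Longrightarrow> rsum k (give_rmass m P) = rsum k P + m"
  by (cases P rule: rev_cases) (auto simp: rsum_def give_rmass_def)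

lemma lsum_give_lmass: "0 < k \<Longrightarrow> Q \<noteq> [] \<Longrightarrow> lsum k (give_lmass m Q) = lsum k Q + m"
  by (cases Q; cases k) (auto simp: lsum_def give_lmass_def)

lemma lsum_append: "lsum k (X @ Y) = lsum k X + lsum (k - length X) Y"
  by (simp add: lsum_def)

lemma rsum_append: "rsum k (X @ Y) = rsum k X + rsum (k - length X) Y"
  by (simp add: rsum_def)

lemma lsum_full: "length X \<le> k \<Longrightarrow> lsum k X = sum_list (map lmass X)"
  by (simp add: lsum_def)

lemma rsum_full: "length X \<le> k \<Longrightarrow> rsum k X = 0"
  by (simp add: rsum_def)

lemma lsum_0 [simp]: "lsum 0 X = 0"
  by (simp add: lsum_def)

lemma rsum_0 [simp]: "rsum 0 X = sum_list (map rmass X)"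
  by (simp add: rsum_def)

lemma excise_below:
  assumes "k < length P"
  shows "lsum (Suc k) (excise P M Q) = lsum (Suc k) (P @ M @ Q)"
    "lsum k (excise P M Q) = lsum k (P @ M @ Q)"
    "rsum k (excise P M Q) = rsum k (P @ M @ Q)"
  using assms by (simp_all add: excise_def lsum_append rsum_append rsum_give_rmass Suc_diff_le)

lemma excise_above:
  assumes "0 < k" "k \<le> length Q"
  shows "lsum (length P + k) (excise P M Q) = lsum (length P + length M + k) (P @ M @ Q)"
  using assms by (cases Q) (auto simp: excise_def lsum_append lsum_give_lmass lsum_full)

lemma excise_above_rsum:
  shows "rsum (length P + k) (excise P M Q) = rsum (length P + length M + k) (P @ M @ Q)"
  by (auto simp: excise_def rsum_append rsum_full)

lemma mass_since_give_rmass: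
  "P \<noteq> [] \<Longrightarrow> mass_since rmass m (give_rmass a P) = mass_since rmass m P + (if m \<le> birth (last P) then a else 0)"
  "mass_since lmass m (give_rmass a P) = mass_since lmass m P"
  by (cases P rule: rev_cases; simp add: give_rmass_def mass_since_Cons)
     (cases P rule: rev_cases; simp add: give_rmass_def mass_since_Cons)

lemma mass_since_give_lmass:
  "Q \<noteq> [] \<Longrightarrow> mass_since lmass m (give_lmass a Q) = mass_since lmass m Q + (if m \<le> birth (hd Q) then a else 0)"
  "mass_since rmass m (give_lmass a Q) = mass_since rmass m Q"
  by (cases Q; simp add: give_lmass_def mass_since_Cons)
     (cases Q; simp add: give_lmass_def mass_since_Cons)

lemma mass_since_all: "\<forall>z\<in>set M. m \<le> birth z \<Longrightarrow> mass_since f m M = sum_list (map f M)"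
  unfolding mass_since_def by (simp add: filter_True)

text \<open>The surviving cuts and markers keep their two sums, as the masses of \<open>M\<close>
  stay on the same side of them; only the cut where \<open>M\<close> was is new, and
  \<open>gap\<close> covers it. By \<open>old\<close>, the mass born since a threshold cannot grow:
  either all of the moved mass was counted before, or its receivers are too old to count.\<close>

lemma valid_excise:
  assumes v: "valid J wt T N (P @ M @ Q)"
    and gap: "2 ^ J * N \<le> T + 2 ^ J * (sum_list (map lmass P) + sum_list (map rmass Q))"
    and old: "\<And>m. m \<in> thresholds T \<Longrightarrow> (\<forall>z\<in>set M. m \<le> birth z) \<or>
       (P \<noteq> [] \<longrightarrow> birth (last P) < m) \<and> (Q \<noteq> [] \<longrightarrow> birth (hd Q) < m)"
  shows "valid J wt T N (excise P M Q)"
proof -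
  let ?Z = "P @ M @ Q" and ?Z' = "excise P M Q"
  have len: "length ?Z' = length P + length Q" by (simp add: excise_def)
  have V1: "2 ^ J * N \<le> T + 2 ^ J * (lsum k ?Z + rsum k ?Z)" if "k \<le> length ?Z" for k
    using v that by (simp add: valid_def)
  have V2: "2 ^ J * N \<le> birth (?Z ! i) + 2 ^ J * (lsum (Suc i) ?Z + rsum i ?Z)" if "i < length ?Z" for i
    using v that by (simp add: valid_def)
  have 1: "2 ^ J * N \<le> T + 2 ^ J * (lsum k ?Z' + rsum k ?Z')" if k: "k \<le> length ?Z'" for k
  proof -
    consider "k < length P" | "k = length P" | j where "0 < j" "k = length P + j"
      using less_linear[of k "length P"] by (metis less_imp_add_positive)
    then show ?thesis
    proof cases
      case 1
      then show ?thesis using excise_below[OF 1, of M Q] V1[of k] by simp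
    next
      case 2
      then have "lsum k ?Z' = sum_list (map lmass P)" "rsum k ?Z' = sum_list (map rmass Q)"
        by (simp_all add: excise_def lsum_append rsum_append lsum_full rsum_full)
      then show ?thesis using gap by simp
    next
      case 3
      then have "j \<le> length Q" using k len by simp
      then show ?thesis
        using V1[of "length P + length M + j"] 3 excise_above[of j Q P M] excise_above_rsum[of P j M Q]
        by simp
    qed
  qed
  have 2: "2 ^ J * N \<le> birth (?Z' ! i) + 2 ^ J * (lsum (Suc i) ?Z' + rsum i ?Z')" if i: "i < length ?Z'" for i
  proof (cases "i < length P")
    case True
    then show ?thesis using excise_below[OF True, of M Q] V2[of i] by (simp add: excise_def nth_append)
  next
    case False
    then obtain j where j: "i = length P + j" by (metis le_add_diff_inverse not_less)
    then have jl: "j < length Q" using i len by simp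
    have "birth (?Z' ! i) = birth (?Z ! (length P + length M + j))"
      using j jl by (simp add: excise_def nth_append)
    then show ?thesis
      using V2[of "length P + length M + j"] j jl excise_above[of "Suc j" Q P M] excise_above_rsum[of P j M Q]
      by simp
  qed
  have 3: "mass_since lmass m ?Z' + m \<le> N \<and> mass_since rmass m ?Z' + m \<le> N" if m: "m \<in> thresholds T" for m
  proof -
    have "mass_since f m ?Z' \<le> mass_since f m ?Z" if f: "f = lmass \<or> f = rmass" for f
    proof (cases "\<forall>z\<in>set M. m \<le> birth z")
      case True
      then have "mass_since f m M = sum_list (map f M)" by (rule mass_since_all)
      then show ?thesis using f
        by (cases "P = []"; cases "Q = []")
           (auto simp: excise_def mass_since_give_rmass mass_since_give_lmass, simp_all add: give_lmass_def give_rmass_def)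
    next
      case False
      then have "(P \<noteq> [] \<longrightarrow> \<not> m \<le> birth (last P)) \<and> (Q \<noteq> [] \<longrightarrow> \<not> m \<le> birth (hd Q))"
        using old[OF m] by auto
      then show ?thesis using f
        by (cases "P = []"; cases "Q = []")
           (auto simp: excise_def mass_since_give_rmass mass_since_give_lmass, simp_all add: give_lmass_def give_rmass_def)
    qed
    from this[of lmass] this[of rmass]
    have "mass_since lmass m ?Z' \<le> mass_since lmass m ?Z" "mass_since rmass m ?Z' \<le> mass_since rmass m ?Z"
      by simp_all
    moreover have "mass_since lmass m ?Z + m \<le> N \<and> mass_since rmass m ?Z + m \<le> N"
      using v m unfolding valid_def by blast
    ultimately show ?thesis by linarith
  qed
  have 4: "birth z \<le> T \<and> wt (birth z) \<le> lmass z" if z: "z \<in> set ?Z'" for z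
  proof -
    obtain z' where "z' \<in> set ?Z" "birth z = birth z'" "lmass z' \<le> lmass z"
      using z by (cases P rule: rev_cases; cases Q)
        (fastforce simp: excise_def give_rmass_def give_lmass_def)+
    moreover have "\<forall>y\<in>set ?Z. birth y \<le> T \<and> wt (birth y) \<le> lmass y"
      using v unfolding valid_def by blast
    ultimately show ?thesis by (metis le_trans)
  qed
  have 5: "sorted (map place ?Z')"
  proof -
    have "sorted (map place ?Z)" using v unfolding valid_def by blast
    then show ?thesis by (simp add: excise_def sorted_append)
  qed
  show ?thesis unfolding valid_def
    apply (intro conjI allI ballI impI)
    subgoal by (rule 5)
    subgoal by (rule 1)
    subgoal by (rule 2)
    subgoal using 3 by simp
    subgoal using 3 by simp
    subgoal using 4 by simp
    subgoal using 4 by simp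
    done
qed

section \<open>Summaries that underestimate another one\<close>

definition dominated :: "marker list \<Rightarrow> marker list \<Rightarrow> bool" where
  "dominated Z' Z \<longleftrightarrow> place ` set Z' \<subseteq> place ` set Z \<and> (\<forall>D t. mass_at D t Z' \<le> mass_at D t Z)"

lemma dominated_refl: "dominated Z Z"
  by (simp add: dominated_def)

lemma dominated_trans: "dominated Z'' Z' \<Longrightarrow> dominated Z' Z \<Longrightarrow> dominated Z'' Z"
  unfolding dominated_def by (meson order_trans)

lemma mass_at_append [simp]: "mass_at D t (X @ Y) = mass_at D t X + mass_at D t Y"
  by (simp add: mass_at_def)

lemma dominated_excise:
  assumes "sorted (map place (P @ M @ Q))"
  shows "dominated (excise P M Q) (P @ M @ Q)"
proof -
  have img: "place ` set (excise P M Q) \<subseteq> place ` set (P @ M @ Q)"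
  proof -
    have "set (map place (excise P M Q)) \<subseteq> set (map place (P @ M @ Q))"
      by (simp only: excise_def map_append map_give_rmass map_give_lmass set_append) blast
    then show ?thesis by (simp only: list.set_map)
  qed
  have r: "mass_at True t (give_rmass (sum_list (map rmass M)) P) \<le> mass_at True t P + mass_at True t M" for t
  proof (cases P rule: rev_cases)
    case Nil then show ?thesis by (simp add: give_rmass_def mass_at_def)
  next
    case (snoc P' z)
    show ?thesis
    proof (cases "ereal t < place z")
      case True
      moreover have "\<forall>y\<in>set M. place z \<le> place y" using assms snoc by (auto simp: sorted_append)
      ultimately have "\<forall>y\<in>set M. ereal t < place y" using less_le_trans by blast
      then show ?thesis using snoc True by (simp add: give_rmass_def mass_at_def filter_True)
    next
      case False
      then show ?thesis using snoc by (simp add: give_rmass_def mass_at_def)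
    qed
  qed
  have r': "mass_at True t (give_lmass a Q) = mass_at True t Q" for t a
    by (cases Q) (simp_all add: give_lmass_def mass_at_def)
  have l: "mass_at False t (give_lmass (sum_list (map lmass M)) Q) \<le> mass_at False t Q + mass_at False t M" for t
  proof (cases Q)
    case Nil then show ?thesis by (simp add: give_lmass_def mass_at_def)
  next
    case (Cons z Q')
    show ?thesis
    proof (cases "place z \<le> ereal t")
      case True
      moreover have "\<forall>y\<in>set M. place y \<le> place z" using assms Cons by (auto simp: sorted_append)
      ultimately have "\<forall>y\<in>set M. place y \<le> ereal t" using order_trans by blast
      then show ?thesis using Cons True by (simp add: give_lmass_def mass_at_def filter_True)
    next
      case False
      then show ?thesis using Cons by (simp add: give_lmass_def mass_at_def)
    qed
  qed
  have l': "mass_at False t (give_rmass a P) = mass_at False t P" for t a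
    by (cases P rule: rev_cases) (simp_all add: give_rmass_def mass_at_def)
  have "mass_at D t (excise P M Q) \<le> mass_at D t (P @ M @ Q)" for D t
    using r[of t] r'[of t] l[of t] l'[of t] by (cases D) (simp_all add: excise_def)
  then show ?thesis using img by (simp add: dominated_def)
qed

lemma lsum_eq_sum: "k \<le> length Z \<Longrightarrow> lsum k Z = (\<Sum>j<k. lmass (Z ! j))"
  by (simp add: lsum_def sum_list_sum_nth atLeast0LessThan)

lemma rsum_eq_sum: "k \<le> length Z \<Longrightarrow> rsum k Z = (\<Sum>j\<in>{k..<length Z}. rmass (Z ! j))"
proof -
  assume k: "k \<le> length Z"
  have "rsum k Z = (\<Sum>j<length Z - k. rmass (Z ! (j + k)))"
    using k by (simp add: rsum_def sum_list_sum_nth atLeast0LessThan add.commute)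
  also have "\<dots> = (\<Sum>j\<in>{k..<length Z}. rmass (Z ! j))"
    using k sum.shift_bounds_nat_ivl[of "\<lambda>j. rmass (Z ! j)" 0 k "length Z - k"]
    by (simp add: atLeast0LessThan)
  finally show ?thesis .
qed

lemma lsum_diff: "p \<le> i \<Longrightarrow> i < length Z \<Longrightarrow> lsum (Suc i) Z = lsum p Z + (\<Sum>j\<in>{p..i}. lmass (Z ! j))"
  by (simp add: lsum_eq_sum atLeastLessThanSuc_atLeastAtMost[symmetric] lessThan_atLeast0 sum.atLeastLessThan_concat)

lemma rsum_diff: "i \<le> s \<Longrightarrow> s \<le> length Z \<Longrightarrow> rsum i Z = rsum s Z + (\<Sum>j\<in>{i..<s}. rmass (Z ! j))"
  by (simp add: rsum_eq_sum sum.atLeastLessThan_concat add.commute)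

lemma mass_since_eq_sum:
  "mass_since f m Z = (\<Sum>j | j < length Z \<and> m \<le> birth (Z ! j). f (Z ! j))"
proof -
  have "mass_since f m Z = sum_list (map (\<lambda>z. if m \<le> birth z then f z else 0) Z)"
    by (simp add: mass_since_def sum_list_map_filter')
  also have "\<dots> = (\<Sum>j<length Z. if m \<le> birth (Z ! j) then f (Z ! j) else 0)"
    by (simp add: sum_list_sum_nth atLeast0LessThan)
  also have "\<dots> = (\<Sum>j | j < length Z \<and> m \<le> birth (Z ! j). f (Z ! j))"
    by (simp add: sum.inter_filter[symmetric] flip: lessThan_iff) 
  finally show ?thesis .
qed

section \<open>Length of shortest summaries\<close>

lemma left_run:
  fixes i :: nat
  shows "\<exists>p\<le>i. (\<forall>j. p \<le> j \<and> j < i \<longrightarrow> \<not> R j) \<and> (p = 0 \<or> R (p - 1))"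
proof (induction i)
  case (Suc i)
  show ?case
  proof (cases "R i")
    case True
    then show ?thesis by (intro exI[of _ "Suc i"]) auto
  next
    case False
    from Suc obtain p where "p \<le> i" "\<forall>j. p \<le> j \<and> j < i \<longrightarrow> \<not> R j" "p = 0 \<or> R (p - 1)" by auto
    then show ?thesis using False by (intro exI[of _ p]) (auto simp: less_Suc_eq)
  qed
qed auto

lemma right_run:
  fixes i n :: nat
  assumes "i < n"
  shows "\<exists>s. i < s \<and> s \<le> n \<and> (\<forall>j. i < j \<and> j < s \<longrightarrow> \<not> R j) \<and> (s = n \<or> R s)"
proof -
  define s where "s = (LEAST s. i < s \<and> (s = n \<or> R s))"
  have ex: "i < n \<and> (n = n \<or> R n)" using assms by simp
  have "i < s \<and> (s = n \<or> R s)" unfolding s_def by (rule LeastI[of _ n]) (rule ex)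
  moreover have "s \<le> n" unfolding s_def by (rule Least_le) (rule ex)
  moreover have "\<not> R j" if "i < j" "j < s" for j
    using not_less_Least[of j "\<lambda>s. i < s \<and> (s = n \<or> R s)"] that unfolding s_def by auto
  ultimately show ?thesis by blast
qed

text \<open>Minimal length stands in for a deletion strategy: to refute an overlong summary it is
  enough to exhibit one more admissible deletion.\<close>

definition compressed :: "nat \<Rightarrow> (nat \<Rightarrow> nat) \<Rightarrow> nat \<Rightarrow> marker list \<Rightarrow> bool" where
  "compressed J wt N Z \<longleftrightarrow> valid J wt N N Z \<and>
     (\<forall>Z'. valid J wt N N Z' \<and> dominated Z' Z \<longrightarrow> length Z \<le> length Z')"

text \<open>A marker of age at least \<open>2 ^ a\<close> which cannot be deleted together with all the younger ones
  around it is charged to the mass between its neighbours of that age, and no item older than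
  \<open>2 ^ (a + 2)\<close> contributes to that mass.\<close>

lemma card_band:
  assumes c: "compressed J wt N Z"
  shows "card {i. i < length Z \<and> threshold (Suc a) N \<le> birth (Z ! i) \<and> birth (Z ! i) < threshold a N} \<le> 8 * 2 ^ J"
    (is "card ?I \<le> _")
proof -
  define old where "old j \<longleftrightarrow> birth (Z ! j) < threshold a N" for j
  define n where "n = length Z"
  define young where "young = {j. j < n \<and> threshold (Suc a) N \<le> birth (Z ! j)}"
  have v: "valid J wt N N Z" using c by (simp add: compressed_def)
  have s: "sorted (map place Z)" using v by (simp add: valid_def)
  \<comment> \<open>The window of \<open>i\<close> reaches from \<open>p i\<close> to just before
    \<open>q i\<close>. It consists of \<open>i\<close> and of the consecutive markers on both sides
    that are born since \<open>threshold a N\<close>.\<close>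
  have "\<exists>p. p \<le> i \<and> (\<forall>j. p \<le> j \<and> j < i \<longrightarrow> \<not> old j) \<and> (p = 0 \<or> old (p - 1))" for i
    using left_run[of i old] by auto
  then obtain p where p: "\<And>i. p i \<le> i" "\<And>i j. p i \<le> j \<Longrightarrow> j < i \<Longrightarrow> \<not> old j" "\<And>i. p i = 0 \<or> old (p i - 1)"
    by metis
  have "\<exists>s. i < n \<longrightarrow> i < s \<and> s \<le> n \<and> (\<forall>j. i < j \<and> j < s \<longrightarrow> \<not> old j) \<and> (s = n \<or> old s)" for i
    using right_run[of i n old] by blast
  then obtain q where "\<forall>i. i < n \<longrightarrow> i < q i \<and> q i \<le> n \<and> (\<forall>j. i < j \<and> j < q i \<longrightarrow> \<not> old j) \<and> (q i = n \<or> old (q i))"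
    by metis
  then have q: "\<And>i. i < n \<Longrightarrow> i < q i" "\<And>i. i < n \<Longrightarrow> q i \<le> n"
    "\<And>i j. i < n \<Longrightarrow> i < j \<Longrightarrow> j < q i \<Longrightarrow> \<not> old j" "\<And>i. i < n \<Longrightarrow> q i = n \<or> old (q i)"
    by blast+
  have I: "i < n" "old i" "threshold (Suc a) N \<le> birth (Z ! i)" if "i \<in> ?I" for i
    using that by (auto simp: n_def old_def)
  have between: "threshold (Suc a) N \<le> birth (Z ! j)" if "i \<in> ?I" "p i \<le> j" "j < q i" for i j
  proof (cases "j = i")
    case True
    then show ?thesis using I(3)[OF that(1)] by simp
  next
    case False
    then have "\<not> old j" using p(2)[of i j] q(3)[of i j] I(1)[OF that(1)] that by linarith
    then show ?thesis using threshold_antimono_Suc[of a N] by (simp add: old_def)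
  qed
  \<comment> \<open>If the gap condition held, the window could be excised. Its failure, compared
    with the invariant of the marker \<open>i\<close>, leaves \<open>N - birth\<close>, which is at
    least \<open>2 ^ a\<close>, to be covered by \<open>2 ^ J\<close> times the masses inside the
    window.\<close>
  have stuck: "2 ^ a \<le> 2 ^ J * ((\<Sum>j\<in>{p i..i}. lmass (Z ! j)) + (\<Sum>j\<in>{i..<q i}. rmass (Z ! j)))"
    if i: "i \<in> ?I" for i
  proof -
    define P where "P = take (p i) Z"
    define M where "M = take (q i - p i) (drop (p i) Z)"
    define Q where "Q = drop (q i) Z"
    have le: "p i \<le> i" "i < q i" "q i \<le> n" using p(1) q(1,2) I(1) i by auto
    have Z: "P @ M @ Q = Z"
    proof -
      have "M @ Q = drop (p i) Z" using le unfolding M_def Q_def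
        by (metis append_take_drop_id drop_drop le_add_diff_inverse2 less_imp_le order.trans)
      then show ?thesis by (simp add: P_def)
    qed
    have lens: "length P = p i" "length M = q i - p i" "length Q = n - q i"
      using le unfolding P_def M_def Q_def n_def by auto
    have Mset: "threshold (Suc a) N \<le> birth z" if z: "z \<in> set M" for z
    proof -
      from z obtain k where "k < length M" "z = M ! k" by (auto simp: in_set_conv_nth)
      then have "z = Z ! (p i + k)" "p i + k < q i" using le lens
        by (auto simp: M_def n_def)
      then show ?thesis using between[OF i, of "p i + k"] by simp
    qed
    have "\<not> 2 ^ J * N \<le> N + 2 ^ J * (sum_list (map lmass P) + sum_list (map rmass Q))"
    proof
      assume gap: "2 ^ J * N \<le> N + 2 ^ J * (sum_list (map lmass P) + sum_list (map rmass Q))"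
      have "valid J wt N N (excise P M Q)"
      proof (rule valid_excise[OF _ gap])
        fix m assume m: "m \<in> thresholds N"
        have lastP: "birth (last P) < threshold a N" if "P \<noteq> []"
        proof -
          have "p i \<noteq> 0" using that lens(1) by (metis length_0_conv)
          then have "old (p i - 1)" using p(3)[of i] by simp
          moreover have "last P = Z ! (p i - 1)" using that le \<open>p i \<noteq> 0\<close> lens unfolding P_def
            by (simp add: last_conv_nth n_def)
          ultimately show ?thesis by (simp add: old_def)
        qed
        have hdQ: "birth (hd Q) < threshold a N" if "Q \<noteq> []"
        proof -
          have "q i \<noteq> n" using that lens(3) by (metis diff_self_eq_0 length_0_conv)
          then have "old (q i)" using q(4)[of i] I(1)[OF i] by simp
          moreover have "hd Q = Z ! q i" using that le lens unfolding Q_def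
            by (simp add: hd_drop_conv_nth n_def)
          ultimately show ?thesis by (simp add: old_def)
        qed
        \<comment> \<open>No threshold lies strictly between those of \<open>a\<close> and
          \<open>Suc a\<close>. From \<open>threshold a N\<close> on, both neighbours are too old;
          up to \<open>threshold (Suc a) N\<close>, the whole window is young enough.\<close>
        show "(\<forall>z\<in>set M. m \<le> birth z) \<or> (P \<noteq> [] \<longrightarrow> birth (last P) < m) \<and> (Q \<noteq> [] \<longrightarrow> birth (hd Q) < m)"
        proof (cases "threshold a N \<le> m")
          case True
          then show ?thesis using lastP hdQ by auto
        next
          case False
          then obtain b where b: "m = threshold b N" using m threshold_le[of a N] unfolding thresholds_def by auto
          then have "\<not> b \<le> a" using False threshold_antimono[of b a N] by auto
          then have "m \<le> threshold (Suc a) N" using b threshold_antimono[of "Suc a" b N] by simp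
          then show ?thesis using Mset le_trans by blast
        qed
      qed (use v Z in simp)
      moreover have "dominated (excise P M Q) Z"
        using dominated_excise[of P M Q] s Z by simp
      ultimately have "length Z \<le> length (excise P M Q)" using c by (simp add: compressed_def)
      moreover have "length (excise P M Q) < length Z" using lens le Z by (auto simp: excise_def n_def)
      ultimately show False by simp
    qed
    moreover have "sum_list (map lmass P) = lsum (p i) Z" "sum_list (map rmass Q) = rsum (q i) Z"
      by (simp_all add: P_def Q_def lsum_def rsum_def)
    ultimately have "N + 2 ^ J * (lsum (p i) Z + rsum (q i) Z) < 2 ^ J * N" by simp
    also have "2 ^ J * N \<le> birth (Z ! i) + 2 ^ J * (lsum (Suc i) Z + rsum i Z)"
      using v I(1)[OF i] by (simp add: valid_def n_def)
    also have "lsum (Suc i) Z = lsum (p i) Z + (\<Sum>j\<in>{p i..i}. lmass (Z ! j))"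
      using le by (intro lsum_diff) (auto simp: n_def)
    also have "rsum i Z = rsum (q i) Z + (\<Sum>j\<in>{i..<q i}. rmass (Z ! j))"
      using le by (intro rsum_diff) (auto simp: n_def)
    finally have "N < birth (Z ! i) + 2 ^ J * ((\<Sum>j\<in>{p i..i}. lmass (Z ! j)) + (\<Sum>j\<in>{i..<q i}. rmass (Z ! j)))"
      by (simp add: algebra_simps)
    moreover have "birth (Z ! i) + 2 ^ a \<le> N"
      using I(2)[OF i] age_above[of a N] unfolding old_def by linarith
    ultimately show ?thesis by linarith
  qed
  have fin: "finite ?I" by simp
  \<comment> \<open>An old marker stops every other run, so the left halves of the windows are
    pairwise disjoint, and so are the right halves. A right half may meet the next left half, but
    they are charged to different masses.\<close>
  have disjL: "{p i..i} \<inter> {p i'..i'} = {}" if "i \<in> ?I" "i' \<in> ?I" "i < i'" for i i'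
    using p(2)[of i' i] I(2)[OF that(1)] that(3) by auto
  have disjR: "{i..<q i} \<inter> {i'..<q i'} = {}" if "i \<in> ?I" "i' \<in> ?I" "i < i'" for i i'
  proof -
    have "\<not> i' < q i" using q(3)[OF I(1)[OF that(1)] that(3)] I(2)[OF that(2)] by blast
    then show ?thesis by auto
  qed
  have subL: "{p i..i} \<subseteq> young" if i: "i \<in> ?I" for i
  proof
    fix j assume "j \<in> {p i..i}"
    then have "p i \<le> j" "j < q i" "j < n" using q(1)[OF I(1)[OF i]] I(1)[OF i] by auto
    then show "j \<in> young" using between[OF i] by (simp add: young_def)
  qed
  have subR: "{i..<q i} \<subseteq> young" if i: "i \<in> ?I" for i
  proof
    fix j assume "j \<in> {i..<q i}"
    then have "p i \<le> j" "j < q i" "j < n" using p(1)[of i] q(2)[OF I(1)[OF i]] by auto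
    then show "j \<in> young" using between[OF i] by (simp add: young_def)
  qed
  have "(\<Sum>i\<in>?I. \<Sum>j\<in>{p i..i}. lmass (Z ! j)) = (\<Sum>j\<in>(\<Union>i\<in>?I. {p i..i}). lmass (Z ! j))"
    by (intro sum.UNION_disjoint[symmetric] fin) (use disjL in \<open>auto simp: neq_iff\<close>)
  also have "\<dots> \<le> (\<Sum>j\<in>young. lmass (Z ! j))"
    by (intro sum_mono2 UN_least subL) (auto simp: young_def)
  also have "\<dots> = mass_since lmass (threshold (Suc a) N) Z"
    by (simp add: mass_since_eq_sum young_def n_def)
  finally have L: "(\<Sum>i\<in>?I. \<Sum>j\<in>{p i..i}. lmass (Z ! j)) \<le> mass_since lmass (threshold (Suc a) N) Z" .
  have "(\<Sum>i\<in>?I. \<Sum>j\<in>{i..<q i}. rmass (Z ! j)) = (\<Sum>j\<in>(\<Union>i\<in>?I. {i..<q i}). rmass (Z ! j))"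
    by (intro sum.UNION_disjoint[symmetric] fin) (use disjR in \<open>auto simp: neq_iff\<close>)
  also have "\<dots> \<le> (\<Sum>j\<in>young. rmass (Z ! j))"
    by (intro sum_mono2 UN_least subR) (auto simp: young_def)
  also have "\<dots> = mass_since rmass (threshold (Suc a) N) Z"
    by (simp add: mass_since_eq_sum young_def n_def)
  finally have R: "(\<Sum>i\<in>?I. \<Sum>j\<in>{i..<q i}. rmass (Z ! j)) \<le> mass_since rmass (threshold (Suc a) N) Z" .
  have "threshold (Suc a) N \<in> thresholds N" by (simp add: thresholds_def)
  then have m: "mass_since lmass (threshold (Suc a) N) Z + threshold (Suc a) N \<le> N"
    "mass_since rmass (threshold (Suc a) N) Z + threshold (Suc a) N \<le> N"
    using v unfolding valid_def by blast+
  \<comment> \<open>Less than \<open>2 * 2 ^ Suc a\<close> of either mass is born since the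
    threshold; the two masses together give the factor 8.\<close>
  have "card ?I * 2 ^ a = (\<Sum>i\<in>?I. 2 ^ a)" by simp
  also have "\<dots> \<le> (\<Sum>i\<in>?I. 2 ^ J * ((\<Sum>j\<in>{p i..i}. lmass (Z ! j)) + (\<Sum>j\<in>{i..<q i}. rmass (Z ! j))))"
    by (intro sum_mono stuck)
  also have "\<dots> = 2 ^ J * ((\<Sum>i\<in>?I. \<Sum>j\<in>{p i..i}. lmass (Z ! j)) + (\<Sum>i\<in>?I. \<Sum>j\<in>{i..<q i}. rmass (Z ! j)))"
    by (simp only: sum_distrib_left[symmetric] sum.distrib)
  also have "\<dots> \<le> 2 ^ J * (8 * 2 ^ a)"
    using L R m age_below[of N "Suc a"] by (intro mult_left_mono) auto
  finally have "card ?I * 2 ^ a \<le> (8 * 2 ^ J) * 2 ^ a" by (simp add: mult.assoc)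
  then show ?thesis by simp
qed

lemma card_older:
  assumes c: "compressed J wt N Z"
  shows "card {i. i < length Z \<and> threshold (a + d) N \<le> birth (Z ! i)}
    \<le> card {i. i < length Z \<and> threshold a N \<le> birth (Z ! i)} + d * (8 * 2 ^ J)"
proof (induction d)
  case (Suc d)
  let ?S = "\<lambda>b. {i. i < length Z \<and> threshold b N \<le> birth (Z ! i)}"
  have "?S (a + Suc d) \<subseteq> ?S (a + d) \<union> {i. i < length Z \<and> threshold (Suc (a + d)) N \<le> birth (Z ! i) \<and> birth (Z ! i) < threshold (a + d) N}"
    by auto
  then have "card (?S (a + Suc d)) \<le> card (?S (a + d) \<union> {i. i < length Z \<and> threshold (Suc (a + d)) N \<le> birth (Z ! i) \<and> birth (Z ! i) < threshold (a + d) N})"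
    by (intro card_mono) auto
  also have "\<dots> \<le> card (?S (a + d)) + 8 * 2 ^ J"
    using card_Un_le card_band[OF c, of "a + d"] by (meson add_left_mono le_trans)
  finally show ?case using Suc by simp
qed simp

text \<open>The youngest markers are bounded by their mass, at least \<open>w\<close> each, and not
  by age classes. This leaves \<open>d\<close> classes, a number governed by the ratio of
  \<open>N\<close> to \<open>w * 2 ^ J\<close> and not by \<open>N\<close> alone.\<close>

lemma length_compressed:
  assumes c: "compressed J wt N Z"
    and w: "\<And>b. threshold a N \<le> b \<Longrightarrow> w \<le> wt b"
    and N: "N < 2 * 2 ^ (a + d)"
    and wa: "2 ^ a \<le> w * 2 ^ J"
  shows "length Z \<le> 2 * 2 ^ J + d * (8 * 2 ^ J)"
proof -
  let ?S = "{i. i < length Z \<and> threshold a N \<le> birth (Z ! i)}"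
  have v: "valid J wt N N Z" using c by (simp add: compressed_def)
  have w0: "0 < w" using wa by (cases w) auto
  have "threshold a N \<in> thresholds N" by (simp add: thresholds_def)
  then have m: "mass_since lmass (threshold a N) Z + threshold a N \<le> N"
    using v unfolding valid_def by blast
  have "card ?S * w = (\<Sum>i\<in>?S. w)" by simp
  also have "\<dots> \<le> (\<Sum>i\<in>?S. lmass (Z ! i))"
  proof (rule sum_mono)
    fix i assume "i \<in> ?S"
    then have "w \<le> wt (birth (Z ! i))" "wt (birth (Z ! i)) \<le> lmass (Z ! i)"
      using w v by (auto simp: valid_def)
    then show "w \<le> lmass (Z ! i)" by simp
  qed
  also have "\<dots> = mass_since lmass (threshold a N) Z" by (simp add: mass_since_eq_sum)
  also have "\<dots> \<le> 2 * 2 ^ a" using m age_below[of N a] by linarith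
  also have "\<dots> \<le> (2 * 2 ^ J) * w" using wa by (simp add: mult.commute)
  finally have "card ?S \<le> 2 * 2 ^ J" using w0 by simp
  moreover have "threshold (a + d) N = 0" using N by (rule threshold_zero)
  ultimately show ?thesis using card_older[OF c, of a d] by simp
qed

definition compress :: "nat \<Rightarrow> (nat \<Rightarrow> nat) \<Rightarrow> nat \<Rightarrow> marker list \<Rightarrow> marker list" where
  "compress J wt N Z = arg_min length (\<lambda>Z'. valid J wt N N Z' \<and> dominated Z' Z)"

lemma compress:
  assumes "valid J wt N N Z"
  shows "compressed J wt N (compress J wt N Z)" "dominated (compress J wt N Z) Z"
proof -
  have "valid J wt N N Z \<and> dominated Z Z" using assms dominated_refl by simp
  from arg_min_nat_lemma[of "\<lambda>Z'. valid J wt N N Z' \<and> dominated Z' Z", OF this, of length]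
  have 1: "valid J wt N N (compress J wt N Z)" "dominated (compress J wt N Z) Z"
    and 2: "\<And>Z'. valid J wt N N Z' \<Longrightarrow> dominated Z' Z \<Longrightarrow> length (compress J wt N Z) \<le> length Z'"
    unfolding compress_def by blast+
  show "dominated (compress J wt N Z) Z" by fact
  show "compressed J wt N (compress J wt N Z)"
    unfolding compressed_def using 1 2 dominated_trans by blast
qed

definition insert_all :: "nat \<Rightarrow> nat \<Rightarrow> ereal list \<Rightarrow> marker list \<Rightarrow> marker list" where
  "insert_all T W xs Z = foldr (\<lambda>x. insort_key place (Marker x T W W)) xs Z"

definition sided :: "bool \<Rightarrow> real \<Rightarrow> ereal \<Rightarrow> bool" where
  "sided D t x \<longleftrightarrow> (if D then ereal t < x else x \<le> ereal t)"

definition tally :: "bool \<Rightarrow> real \<Rightarrow> ereal list \<Rightarrow> nat" where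
  "tally D t xs = length (filter (sided D t) xs)"

lemma valid_insert_all:
  assumes "valid J wt T N Z" "wt T \<le> W"
  shows "valid J wt T (N + W * length xs) (insert_all T W xs Z)"
proof (induction xs)
  case (Cons x xs)
  then show ?case using valid_insort[OF Cons assms(2), of x] by (simp add: insert_all_def algebra_simps)
qed (use assms in \<open>simp add: insert_all_def\<close>)

lemma mset_mass_at: "mset Z = mset Z' \<Longrightarrow> mass_at D t Z = mass_at D t Z'"
proof -
  assume "mset Z = mset Z'"
  then have "mset (map f (filter p Z)) = mset (map f (filter p Z'))" for f :: "marker \<Rightarrow> nat" and p
    by (simp only: mset_map mset_filter)
  then have "sum_list (map f (filter p Z)) = sum_list (map f (filter p Z'))" for f :: "marker \<Rightarrow> nat" and p
    by (metis sum_mset_sum_list)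
  then show ?thesis by (simp add: mass_at_def)
qed

lemma mass_at_insert_all: "mass_at D t (insert_all T W xs Z) = mass_at D t Z + W * tally D t xs"
proof (induction xs)
  case (Cons x xs)
  have "mass_at D t (insert_all T W (x # xs) Z) = mass_at D t (Marker x T W W # insert_all T W xs Z)"
    by (rule mset_mass_at) (simp add: insert_all_def)
  also have "\<dots> = (if sided D t x then W else 0) + mass_at D t (insert_all T W xs Z)"
    by (simp add: mass_at_def sided_def)
  finally show ?case using Cons by (simp add: tally_def)
qed (simp add: insert_all_def tally_def)

lemma place_insert_all: "place ` set (insert_all T W xs Z) = set xs \<union> place ` set Z"
  by (induction xs) (auto simp: insert_all_def set_insort_key)

text \<open>In a sorted list the markers up to \<open>t\<close> form a prefix, so \<open>t\<close>
  is one of the cuts that \<open>valid\<close> speaks of.\<close>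

lemma mass_at_gap:
  assumes v: "valid J wt T N Z"
  shows "2 ^ J * N \<le> T + 2 ^ J * (mass_at False t Z + mass_at True t Z)"
proof -
  let ?k = "length (filter (\<lambda>z. place z \<le> ereal t) Z)"
  have split: "take (length (filter (\<lambda>z. f z \<le> c) X)) X = filter (\<lambda>z. f z \<le> c) X \<and>
     drop (length (filter (\<lambda>z. f z \<le> c) X)) X = filter (\<lambda>z. c < f z) X"
    if "sorted (map f X)" for X and f :: "marker \<Rightarrow> ereal" and c
    using that
  proof (induction X)
    case (Cons x X)
    show ?case
    proof (cases "f x \<le> c")
      case True
      then show ?thesis using Cons by auto
    next
      case False
      then have gt: "\<forall>z\<in>set X. c < f z" using Cons.prems by (auto intro: less_le_trans)
      then have "filter (\<lambda>z. f z \<le> c) X = []" by (auto simp: filter_empty_conv not_le)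
      moreover have "filter (\<lambda>z. c < f z) X = X" using gt by (simp add: filter_True)
      ultimately show ?thesis using False by auto
    qed
  qed simp
  have s: "sorted (map place Z)" using v by (simp add: valid_def)
  have "?k \<le> length Z" by simp
  then have "2 ^ J * N \<le> T + 2 ^ J * (lsum ?k Z + rsum ?k Z)" using v unfolding valid_def by blast
  then show ?thesis using split[OF s, of "ereal t"] by (simp add: lsum_def rsum_def mass_at_def)
qed

section \<open>Exponential moments\<close>

text \<open>With the nonnegative integral, no integrability has to be carried along.\<close>

definition mgf_le :: "'a pmf \<Rightarrow> ('a \<Rightarrow> real) \<Rightarrow> real \<Rightarrow> bool" where
  "mgf_le p f c \<longleftrightarrow> (\<integral>\<^sup>+x. ennreal (exp (f x)) \<partial>measure_pmf p) \<le> ennreal (exp c)"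

lemma mgf_le_return: "f x \<le> c \<Longrightarrow> mgf_le (return_pmf x) f c"
  by (simp add: mgf_le_def)

text \<open>The supermartingale step: \<open>g\<close> is the potential before the last draw,
  \<open>f\<close> the one after it.\<close>

lemma mgf_le_bind:
  assumes "\<And>x. x \<in> set_pmf p \<Longrightarrow> mgf_le (k x) f (g x)" and "mgf_le p g c"
  shows "mgf_le (bind_pmf p k) f c"
proof -
  have "(\<integral>\<^sup>+x. ennreal (exp (f x)) \<partial>measure_pmf (bind_pmf p k)) =
      (\<integral>\<^sup>+x. (\<integral>\<^sup>+y. ennreal (exp (f y)) \<partial>measure_pmf (k x)) \<partial>measure_pmf p)" by simp
  also have "\<dots> \<le> (\<integral>\<^sup>+x. ennreal (exp (g x)) \<partial>measure_pmf p)"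
    by (intro nn_integral_mono_AE) (use assms(1) in \<open>auto simp: AE_measure_pmf_iff mgf_le_def\<close>)
  also have "\<dots> \<le> ennreal (exp c)" using assms(2) by (simp add: mgf_le_def)
  finally show ?thesis by (simp add: mgf_le_def)
qed

lemma mgf_le_mono:
  assumes "mgf_le p f c" "c \<le> c'" "\<And>x. x \<in> set_pmf p \<Longrightarrow> g x \<le> f x"
  shows "mgf_le p g c'"
proof -
  have "(\<integral>\<^sup>+x. ennreal (exp (g x)) \<partial>measure_pmf p) \<le> (\<integral>\<^sup>+x. ennreal (exp (f x)) \<partial>measure_pmf p)"
    by (intro nn_integral_mono_AE) (use assms(3) in \<open>auto simp: AE_measure_pmf_iff\<close>)
  also have "\<dots> \<le> ennreal (exp c)" using assms(1) by (simp add: mgf_le_def)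
  also have "\<dots> \<le> ennreal (exp c')" using assms(2) by (simp add: ennreal_leI)
  finally show ?thesis by (simp add: mgf_le_def)
qed

text \<open>As \<open>y\<close> may be arbitrarily negative, a centred variable has to be bounded
  only from above. For \<open>y = - u\<close> the inequality follows from
  \<open>exp u >= 1 + u\<close> and \<open>(1 - u + u^2) (1 + u) = 1 + u^3\<close>.\<close>

lemma exp_le_quadratic:
  fixes y :: real
  assumes "y \<le> 1"
  shows "exp y \<le> 1 + y + y\<^sup>2"
proof (cases "0 \<le> y")
  case True
  then show ?thesis using exp_bound[of y] assms by simp
next
  case False
  define u where "u = - y"
  have u: "0 < u" using False by (simp add: u_def)
  have "1 + u \<le> exp u" by (rule exp_ge_add_one_self)
  then have "exp y \<le> 1 / (1 + u)" using u by (simp add: u_def exp_minus field_simps)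
  also have "\<dots> \<le> 1 - u + u\<^sup>2"
  proof -
    have "(1 - u + u\<^sup>2) * (1 + u) = 1 + u ^ 3" by (simp add: algebra_simps power2_eq_square power3_eq_cube)
    then have "1 \<le> (1 - u + u\<^sup>2) * (1 + u)" using u by simp
    then show ?thesis using u by (simp add: divide_le_eq)
  qed
  finally show ?thesis by (simp add: u_def)
qed

lemma mgf_le_centered:
  assumes fin: "finite (set_pmf p)"
    and mean: "measure_pmf.expectation p X = 0"
    and var: "measure_pmf.expectation p (\<lambda>x. (X x)\<^sup>2) \<le> v"
    and bound: "\<And>x. x \<in> set_pmf p \<Longrightarrow> X x \<le> 1"
  shows "mgf_le p (\<lambda>x. c + X x) (c + v)"
proof -
  have int: "integrable (measure_pmf p) f" for f :: "'a \<Rightarrow> real"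
    by (rule integrable_measure_pmf_finite[OF fin])
  have "measure_pmf.expectation p (\<lambda>x. exp (c + X x)) \<le>
      measure_pmf.expectation p (\<lambda>x. exp c * (1 + X x + (X x)\<^sup>2))"
    by (intro integral_mono_AE int)
      (use bound exp_le_quadratic in \<open>auto simp: AE_measure_pmf_iff exp_add intro!: mult_left_mono\<close>)
  also have "\<dots> = exp c * (1 + measure_pmf.expectation p X + measure_pmf.expectation p (\<lambda>x. (X x)\<^sup>2))"
    by (simp add: int Bochner_Integration.integral_add)
  also have "\<dots> \<le> exp c * (1 + v)" using mean var by simp
  also have "\<dots> \<le> exp c * exp v" by (intro mult_left_mono exp_ge_add_one_self) simp
  finally have "measure_pmf.expectation p (\<lambda>x. exp (c + X x)) \<le> exp (c + v)" by (simp add: exp_add)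
  then show ?thesis
    unfolding mgf_le_def by (subst nn_integral_eq_integral) (auto simp: int intro!: ennreal_leI)
qed

lemma mgf_le_tail:
  assumes "mgf_le p f c"
  shows "measure_pmf.prob p {x. a \<le> f x} \<le> exp (c - a)"
proof -
  have "emeasure (measure_pmf p) {x. a \<le> f x} = (\<integral>\<^sup>+x. indicator {x. a \<le> f x} x \<partial>measure_pmf p)" by simp
  also have "\<dots> \<le> (\<integral>\<^sup>+x. ennreal (exp (- a)) * ennreal (exp (f x)) \<partial>measure_pmf p)"
  proof (intro nn_integral_mono)
    fix x
    show "(indicator {x. a \<le> f x} x :: ennreal) \<le> ennreal (exp (- a)) * ennreal (exp (f x))"
      by (auto simp: indicator_def simp flip: ennreal_mult' exp_add)
  qed
  also have "\<dots> = ennreal (exp (- a)) * (\<integral>\<^sup>+x. ennreal (exp (f x)) \<partial>measure_pmf p)"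
    by (rule nn_integral_cmult) simp
  also have "\<dots> \<le> ennreal (exp (- a)) * ennreal (exp c)"
    using assms by (intro mult_left_mono) (auto simp: mgf_le_def)
  also have "\<dots> = ennreal (exp (c - a))" by (simp flip: ennreal_mult' exp_add)
  finally show ?thesis by (simp add: measure_pmf.emeasure_eq_measure)
qed

section \<open>Thinning a sorted list at a random offset\<close>

definition thin :: "nat \<Rightarrow> ereal list \<Rightarrow> ereal list" where
  "thin r xs = map (\<lambda>k. xs ! (4 * k + r)) [0..<length xs div 4]"

lemma length_thin [simp]: "length (thin r xs) = length xs div 4"
  by (simp add: thin_def)

lemma set_thin: "r < 4 \<Longrightarrow> set (thin r xs) \<subseteq> set xs"
  by (auto simp: thin_def)

lemma tally_le: "tally D t xs \<le> length xs"
  by (simp add: tally_def)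

lemma tally_compl: "tally True t xs + tally False t xs = length xs"
  unfolding tally_def sided_def using sum_length_filter_compl[of "\<lambda>x. ereal t < x" xs] by (simp add: not_less)

lemma tally_sort [simp]: "tally D t (sort xs) = tally D t xs"
proof -
  have "mset (filter (sided D t) (sort xs)) = mset (filter (sided D t) xs)" by simp
  then show ?thesis unfolding tally_def by (metis size_mset)
qed

lemma tally_append [simp]: "tally D t (xs @ ys) = tally D t xs + tally D t ys"
  by (simp add: tally_def)

text \<open>The points up to \<open>t\<close> fill the first \<open>c\<close> positions, and
  \<open>(c + 3 - r) div 4\<close> of these positions are congruent to \<open>r\<close> modulo 4.
  The minimum discards an incomplete last group.\<close>

lemma tally_False_thin:
  assumes s: "sorted xs" and r: "r < 4"
  shows "tally False t (thin r xs) = min ((tally False t xs + 3 - r) div 4) (length xs div 4)"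
proof -
  define c where "c = tally False t xs"
  have pre: "xs ! p \<le> ereal t \<longleftrightarrow> p < c" if "p < length xs" for p
    using that s unfolding c_def tally_def sided_def
  proof (induction xs arbitrary: p)
    case (Cons x xs)
    show ?case
    proof (cases "x \<le> ereal t")
      case True
      then show ?thesis using Cons by (cases p) auto
    next
      case False
      then have "\<forall>y\<in>set (x # xs). \<not> y \<le> ereal t" using Cons.prems by (auto dest: order_trans)
      then have "filter (\<lambda>y. y \<le> ereal t) (x # xs) = []" by (simp add: filter_empty_conv)
      moreover have "\<not> (x # xs) ! p \<le> ereal t"
        using \<open>\<forall>y\<in>set (x # xs). \<not> y \<le> ereal t\<close> Cons.prems(1) nth_mem by blast
      ultimately show ?thesis by simp
    qed
  qed simp
  have "tally False t (thin r xs) = card {k. k < length xs div 4 \<and> xs ! (4 * k + r) \<le> ereal t}"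
    by (simp add: tally_def sided_def thin_def length_filter_conv_card cong: conj_cong)
  also have "{k. k < length xs div 4 \<and> xs ! (4 * k + r) \<le> ereal t} = {..<min ((c + 3 - r) div 4) (length xs div 4)}"
  proof -
    have "k < length xs div 4 \<and> xs ! (4 * k + r) \<le> ereal t \<longleftrightarrow> k < (c + 3 - r) div 4 \<and> k < length xs div 4" for k
    proof (cases "k < length xs div 4")
      case True
      then have "4 * k + r < length xs" using r by linarith
      then have "xs ! (4 * k + r) \<le> ereal t \<longleftrightarrow> 4 * k + r < c" using pre by blast
      moreover have "4 * k + r < c \<longleftrightarrow> k < (c + 3 - r) div 4" using r by linarith
      ultimately show ?thesis using True by simp
    qed simp
    then show ?thesis unfolding lessThan_def min_less_iff_conj by (rule Collect_cong)
  qed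
  finally show ?thesis by (simp add: c_def)
qed

lemma lessThan_4: "{..<4::nat} = {0, 1, 2, 3}"
  by auto

text \<open>The four offsets partition the positions, so their counts add up to the exact count, and
  each of them is a quarter of it up to rounding. The side \<open>D = True\<close> follows by
  complement, as all four results have the same length.\<close>

lemma thin_error:
  assumes s: "sorted xs" and d: "4 dvd length xs"
  shows "(\<Sum>r<4. 4 * real (tally D t (thin r xs)) - real (tally D t xs)) = 0"
    and "r < 4 \<Longrightarrow> \<bar>4 * real (tally D t (thin r xs)) - real (tally D t xs)\<bar> \<le> 4"
proof -
  define c where "c = tally False t xs"
  obtain m where m: "length xs = 4 * m" using d by (auto elim: dvdE)
  have cm: "c \<le> 4 * m" using tally_le[of False t xs] by (simp add: c_def m)
  have F: "tally False t (thin r xs) = (c + 3 - r) div 4" if "r < 4" for r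
    using tally_False_thin[OF s that, of t] cm by (simp add: c_def m)
  have T: "real (tally True t ys) = real (length ys) - real (tally False t ys)" for ys
    using tally_compl[of t ys] by simp
  have sumF: "(c + 3) div 4 + (c + 2) div 4 + (c + 1) div 4 + c div 4 = c"
  proof -
    obtain a b where ab: "c = b + a * 4" "b < 4"
      using mod_div_mult_eq[of c 4] mod_less_divisor[of 4 c] by (metis zero_less_numeral)
    have "(c + j) div 4 = (b + j) div 4 + a" for j
      using ab(1) div_mult_self1[of 4 "b + j" a] by (simp add: ac_simps)
    note e = this[of 3] this[of 2] this[of 1] this[of 0, simplified]
    from ab(2) have "b = 0 \<or> b = 1 \<or> b = 2 \<or> b = 3" by linarith
    then have s: "(b + 3) div 4 + (b + 2) div 4 + (b + 1) div 4 + b div 4 = b"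
      by (elim disjE) simp_all
    have "(c + 3) div 4 + (c + 2) div 4 + (c + 1) div 4 + c div 4 =
        ((b + 3) div 4 + (b + 2) div 4 + (b + 1) div 4 + b div 4) + a * 4"
      by (simp only: e)
    then show ?thesis by (simp only: s ab(1)[symmetric])
  qed
  have bound: "4 * ((c + 3 - r) div 4) \<le> c + 4 \<and> c \<le> 4 * ((c + 3 - r) div 4) + 4" if "r < 4"
    using that by linarith
  have sum0: "(\<Sum>r<4. 4 * real (tally False t (thin r xs)) - real c) = 0"
  proof -
    have "(\<Sum>r<4. 4 * real (tally False t (thin r xs)) - real c) =
        4 * real ((c + 3) div 4 + (c + 2) div 4 + (c + 1) div 4 + c div 4) - 4 * real c"
      unfolding lessThan_4 using F[of 0] F[of 1] F[of 2] F[of 3] by simp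
    then show ?thesis using sumF by simp
  qed
  have neg: "4 * real (tally True t (thin r xs)) - real (tally True t xs) =
      - (4 * real (tally False t (thin r xs)) - real c)" for r
    unfolding T by (simp add: m c_def)
  show "(\<Sum>r<4. 4 * real (tally D t (thin r xs)) - real (tally D t xs)) = 0"
    using sum0 by (cases D) (simp_all only: neg sum_negf c_def)
  show "\<bar>4 * real (tally D t (thin r xs)) - real (tally D t xs)\<bar> \<le> 4" if "r < 4"
  proof -
    have "\<bar>4 * real (tally False t (thin r xs)) - real c\<bar> \<le> 4"
      using bound[OF that] F[OF that] by linarith
    then show ?thesis by (cases D) (simp_all only: neg abs_minus_cancel c_def)
  qed
qed

section \<open>The general-expiration counter\<close>

datatype cstate = CState (total: nat) (fill: nat) (held: ereal) (bufs: "nat \<Rightarrow> ereal list") (marks: "marker list")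

text \<open>In phase \<open>q\<close> the markers receive points of weight \<open>4 ^ q\<close>, the buffer \<open>bufs i\<close> with
  \<open>1 \<le> i \<le> min q J\<close> holds points of weight \<open>4 ^ (q - i)\<close>, and one point is sampled out of every
  \<open>4 ^ (q - J)\<close> items (every single item while \<open>q \<le> J\<close>, by truncated subtraction). Buffers halve in
  size from one level to the next, so that their total size is \<open>O(2 ^ J)\<close>. The phase only changes when
  points reach the markers, and then all buffers are empty.\<close>

locale expiration_counter =
  fixes J ell :: nat
begin

text \<open>For \<open>q > 0\<close>, phase \<open>q\<close> lasts from
  \<open>4 ^ q * 2 ^ (J + ell)\<close> to four times this total. A point of weight
  \<open>4 ^ q\<close> is then at most the fraction \<open>1 / 2 ^ (J + ell)\<close> of the total,
  which controls deviations, and more than a quarter of this fraction, which limits the age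
  classes.\<close>

definition phase :: "nat \<Rightarrow> nat" where
  "phase N = (LEAST q. N < 4 ^ Suc q * 2 ^ (J + ell))"

definition birth_weight :: "nat \<Rightarrow> nat" where
  "birth_weight b = 4 ^ phase b"

definition cap :: "nat \<Rightarrow> nat" where
  "cap i = 8 * 2 ^ (J - i)"

text \<open>The size of a batch arriving at level \<open>i\<close>: single samples at the top level
  \<open>min q J\<close>, thinned full buffers below it.\<close>

definition chunk :: "nat \<Rightarrow> nat \<Rightarrow> nat" where
  "chunk q i = (if i < min q J then 2 ^ (J - i) else 1)"

definition absorb :: "ereal list \<Rightarrow> cstate \<Rightarrow> cstate" where
  "absorb xs \<sigma> = (let T = total \<sigma>; N = T + birth_weight T * length xs in
     CState N (fill \<sigma>) (held \<sigma>) (bufs \<sigma>)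
       (compress J birth_weight N (insert_all T (birth_weight T) xs (marks \<sigma>))))"

definition set_buf :: "nat \<Rightarrow> ereal list \<Rightarrow> cstate \<Rightarrow> cstate" where
  "set_buf i b \<sigma> = CState (total \<sigma>) (fill \<sigma>) (held \<sigma>) ((bufs \<sigma>)(i := b)) (marks \<sigma>)"

primrec push :: "nat \<Rightarrow> ereal list \<Rightarrow> cstate \<Rightarrow> cstate pmf" where
  "push 0 xs \<sigma> = return_pmf (absorb xs \<sigma>)"
| "push (Suc i) xs \<sigma> = (let b = bufs \<sigma> (Suc i) @ xs in
     if length b < cap (Suc i) then return_pmf (set_buf (Suc i) b \<sigma>)
     else bind_pmf (pmf_of_set {..<4}) (\<lambda>r. push i (thin r (sort b)) (set_buf (Suc i) [] \<sigma>)))"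

text \<open>When \<open>fill\<close> is 0 the coin succeeds with probability 1, so the sample left
  over from the previous block is overwritten.\<close>

definition step :: "ereal \<Rightarrow> cstate \<Rightarrow> cstate pmf" where
  "step x \<sigma> = bind_pmf (bernoulli_pmf (1 / (real (fill \<sigma>) + 1))) (\<lambda>c.
     let h = (if c then x else held \<sigma>) in
     if Suc (fill \<sigma>) < 4 ^ (phase (total \<sigma>) - J)
     then return_pmf (CState (total \<sigma>) (Suc (fill \<sigma>)) h (bufs \<sigma>) (marks \<sigma>))
     else push (min (phase (total \<sigma>)) J) [h] (CState (total \<sigma>) 0 h (bufs \<sigma>) (marks \<sigma>)))"

definition start :: cstate where
  "start = CState 0 0 \<infinity> (\<lambda>_. []) []"

section \<open>Phases and the number of markers\<close>

lemma phase_upper: "N < 4 ^ Suc (phase N) * 2 ^ (J + ell)"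
proof -
  have "N < 4 ^ Suc N * 2 ^ (J + ell)"
  proof -
    have "N < 2 ^ N" by (rule less_exp)
    also have "(2::nat) ^ N \<le> 4 ^ N" by (intro power_mono) auto
    also have "(4::nat) ^ N \<le> 4 ^ Suc N * 2 ^ (J + ell)" by simp
    finally show ?thesis .
  qed
  then show ?thesis unfolding phase_def by (rule LeastI)
qed

lemma phase_lower: "q < phase N \<Longrightarrow> 4 ^ Suc q * 2 ^ (J + ell) \<le> N"
  using not_less_Least[of q "\<lambda>q. N < 4 ^ Suc q * 2 ^ (J + ell)"] unfolding phase_def by simp

lemma phase_lower': "phase N \<noteq> 0 \<Longrightarrow> 4 ^ phase N * 2 ^ (J + ell) \<le> N"
  using phase_lower[of "phase N - 1" N] by simp

definition max_marks :: nat where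
  "max_marks = 2 * 2 ^ J + (ell + 3) * (8 * 2 ^ J)"

text \<open>For \<open>a = J + 2 * (q - 1)\<close>, every marker born since
  \<open>threshold a N\<close> comes from phase \<open>q - 1\<close> or later and so weighs at least
  \<open>4 ^ (q - 1)\<close>. Beyond \<open>a\<close>, the classes up to the full age of the stream
  number \<open>ell + 3\<close>.\<close>

lemma length_compressed_le:
  assumes c: "compressed J birth_weight N Z"
  shows "length Z \<le> max_marks"
proof -
  define q where "q = phase N"
  define a where "a = J + 2 * (q - 1)"
  have pow: "(4::nat) ^ n = 2 ^ (2 * n)" for n by (simp add: power_mult)
  show ?thesis unfolding max_marks_def
  proof (rule length_compressed[OF c, of a "4 ^ (q - 1)"])
    show "2 ^ a \<le> 4 ^ (q - 1) * (2::nat) ^ J" by (simp add: a_def pow power_add)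
    have "N < 2 ^ (2 * Suc q + (J + ell))" using phase_upper[of N] by (simp add: q_def pow power_add)
    also have "\<dots> \<le> 2 ^ Suc (a + (ell + 3))" unfolding a_def by (intro power_increasing) auto
    finally show "N < 2 * 2 ^ (a + (ell + 3))" by (simp only: power_Suc)
  next
    fix b assume b: "threshold a N \<le> b"
    have "q - 1 \<le> phase b"
    proof (cases "q \<le> 1")
      case False
      define c where "c = q - 2"
      have q: "q = Suc (Suc c)" using False by (simp add: c_def)
      have "4 ^ q * 2 ^ (J + ell) \<le> N" using phase_lower'[of N] False by (simp add: q_def)
      also have "N < b + 2 * 2 ^ a" using age_below[of N a] b by simp
      also have "2 ^ a = 4 ^ Suc c * (2::nat) ^ J" by (simp add: a_def q pow power_add)
      finally have "4 ^ q * 2 ^ (J + ell) < b + 2 * (4 ^ Suc c * 2 ^ J)" .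
      moreover have "4 ^ Suc c * (2::nat) ^ J \<le> 4 ^ Suc c * 2 ^ (J + ell)" by (intro mult_left_mono power_increasing) auto
      moreover have "4 ^ q * (2::nat) ^ (J + ell) = 4 * (4 ^ Suc c * 2 ^ (J + ell))" by (simp add: q)
      \<comment> \<open>The age is less than half of \<open>4 ^ q * 2 ^ (J + ell)\<close>, hence the
        birth is still above a quarter of it, where phase \<open>q - 1\<close> starts.\<close>
      ultimately have le: "4 ^ Suc c * 2 ^ (J + ell) \<le> b" by linarith
      show ?thesis
      proof (rule ccontr)
        assume "\<not> q - 1 \<le> phase b"
        then have "Suc (phase b) \<le> Suc c" using q by simp
        then have "(4::nat) ^ Suc (phase b) * 2 ^ (J + ell) \<le> 4 ^ Suc c * 2 ^ (J + ell)"
          by (intro mult_right_mono power_increasing) auto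
        then show False using phase_upper[of b] le by linarith
      qed
    qed simp
    then show "4 ^ (q - 1) \<le> birth_weight b" unfolding birth_weight_def by (intro power_increasing) auto
  qed
qed

section \<open>Invariants and conservation of weight\<close>

definition buf_ok :: "nat \<Rightarrow> nat \<Rightarrow> ereal list \<Rightarrow> bool" where
  "buf_ok q i b \<longleftrightarrow> (if 1 \<le> i \<and> i \<le> min q J then length b < cap i \<and> chunk q i dvd length b else b = [])"

definition good :: "cstate \<Rightarrow> bool" where
  "good \<sigma> \<longleftrightarrow> valid J birth_weight (total \<sigma>) (total \<sigma>) (marks \<sigma>) \<and> length (marks \<sigma>) \<le> max_marks \<and>
     fill \<sigma> < 4 ^ (phase (total \<sigma>) - J) \<and> (\<forall>i. buf_ok (phase (total \<sigma>)) i (bufs \<sigma> i))"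

text \<open>Exactly the number of items seen: sampling and thinning preserve the total weight and
  randomize only where it sits.\<close>

definition items :: "cstate \<Rightarrow> nat" where
  "items \<sigma> = total \<sigma> + (\<Sum>i\<in>{1..J}. 4 ^ (phase (total \<sigma>) - i) * length (bufs \<sigma> i)) + fill \<sigma>"

definition stored :: "cstate \<Rightarrow> ereal set" where
  "stored \<sigma> = insert (held \<sigma>) ((\<Union>i. set (bufs \<sigma> i)) \<union> place ` set (marks \<sigma>))"

text \<open>The side \<open>D = True\<close> answers queries; \<open>D = False\<close> serves the
  analysis.\<close>

definition est :: "bool \<Rightarrow> real \<Rightarrow> cstate \<Rightarrow> nat" where
  "est D t \<sigma> = mass_at D t (marks \<sigma>) +
     (\<Sum>i\<in>{1..J}. 4 ^ (phase (total \<sigma>) - i) * tally D t (bufs \<sigma> i)) +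
     fill \<sigma> * tally D t [held \<sigma>]"

text \<open>The precondition of \<open>push i xs\<close>. A batch leaves a level only when the
  buffer there has been emptied, so at level 0 all buffers are empty, and the change of phase that
  \<open>absorb\<close> may cause reweights nothing.\<close>

definition ready :: "nat \<Rightarrow> ereal list \<Rightarrow> cstate \<Rightarrow> bool" where
  "ready i xs \<sigma> \<longleftrightarrow> good \<sigma> \<and> fill \<sigma> = 0 \<and> i \<le> min (phase (total \<sigma>)) J \<and> (\<forall>j>i. bufs \<sigma> j = []) \<and>
     length xs = chunk (phase (total \<sigma>)) i"

lemma set_buf_simps [simp]: "total (set_buf i b \<sigma>) = total \<sigma>" "fill (set_buf i b \<sigma>) = fill \<sigma>"
  "held (set_buf i b \<sigma>) = held \<sigma>" "marks (set_buf i b \<sigma>) = marks \<sigma>"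
  "bufs (set_buf i b \<sigma>) = (bufs \<sigma>)(i := b)"
  by (simp_all add: set_buf_def)

lemma sum_fun_upd:
  assumes "finite A" "i \<in> A"
  shows "(\<Sum>j\<in>A. f j (if j = i then b else g j)) + f i (g i) = (\<Sum>j\<in>A. f j (g j)) + (f i b :: 'a :: comm_monoid_add)"
proof -
  have "(\<Sum>j\<in>A - {i}. f j (if j = i then b else g j)) = (\<Sum>j\<in>A - {i}. f j (g j))"
    by (intro sum.cong) auto
  then show ?thesis using assms by (simp add: sum.remove ac_simps)
qed

lemma items_set_buf:
  assumes "1 \<le> i" "i \<le> J"
  shows "items (set_buf i b \<sigma>) + 4 ^ (phase (total \<sigma>) - i) * length (bufs \<sigma> i) =
    items \<sigma> + 4 ^ (phase (total \<sigma>) - i) * length b"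
  using sum_fun_upd[of "{1..J}" i "\<lambda>j b. 4 ^ (phase (total \<sigma>) - j) * length b" b "bufs \<sigma>"] assms
  by (simp add: items_def fun_upd_def)

lemma est_set_buf:
  assumes "1 \<le> i" "i \<le> J"
  shows "est D t (set_buf i b \<sigma>) + 4 ^ (phase (total \<sigma>) - i) * tally D t (bufs \<sigma> i) =
    est D t \<sigma> + 4 ^ (phase (total \<sigma>) - i) * tally D t b"
  using sum_fun_upd[of "{1..J}" i "\<lambda>j b. 4 ^ (phase (total \<sigma>) - j) * tally D t b" b "bufs \<sigma>"] assms
  by (simp add: est_def fun_upd_def)

lemma good_set_buf:
  "good \<sigma> \<Longrightarrow> buf_ok (phase (total \<sigma>)) i b \<Longrightarrow> good (set_buf i b \<sigma>)"
  by (simp add: good_def)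

lemma absorb:
  assumes r: "ready 0 xs \<sigma>"
  shows "good (absorb xs \<sigma>)"
    "items (absorb xs \<sigma>) = items \<sigma> + 4 ^ phase (total \<sigma>) * length xs"
    "stored (absorb xs \<sigma>) \<subseteq> stored \<sigma> \<union> set xs"
    "est D t (absorb xs \<sigma>) \<le> est D t \<sigma> + 4 ^ phase (total \<sigma>) * tally D t xs"
    "bufs (absorb xs \<sigma>) i = []" "fill (absorb xs \<sigma>) = 0"
proof -
  have v: "valid J birth_weight (total \<sigma>) (total \<sigma>) (marks \<sigma>)" and f: "fill \<sigma> = 0"
    using r by (auto simp: ready_def good_def)
  have b: "bufs \<sigma> i = []" for i
    using r by (cases i) (auto simp: ready_def good_def buf_ok_def dest!: spec[of _ 0])
  define N where "N = total \<sigma> + birth_weight (total \<sigma>) * length xs"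
  define Z where "Z = insert_all (total \<sigma>) (birth_weight (total \<sigma>)) xs (marks \<sigma>)"
  have a: "absorb xs \<sigma> = CState N 0 (held \<sigma>) (bufs \<sigma>) (compress J birth_weight N Z)"
    by (simp add: absorb_def Let_def N_def Z_def f)
  have "valid J birth_weight (total \<sigma>) N Z" unfolding N_def Z_def by (rule valid_insert_all[OF v]) simp
  then have vN: "valid J birth_weight N N Z" by (rule valid_advance) (simp_all add: N_def)
  note c = compress[OF vN]
  have "valid J birth_weight N N (compress J birth_weight N Z)" using c(1) by (simp add: compressed_def)
  then show "good (absorb xs \<sigma>)"
    using length_compressed_le[OF c(1)] by (simp add: a good_def b buf_ok_def cap_def)
  show "items (absorb xs \<sigma>) = items \<sigma> + 4 ^ phase (total \<sigma>) * length xs"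
    by (simp add: a items_def b f N_def birth_weight_def)
  have "place ` set (compress J birth_weight N Z) \<subseteq> place ` set Z" using c(2) by (simp add: dominated_def)
  also have "\<dots> = set xs \<union> place ` set (marks \<sigma>)" by (simp add: Z_def place_insert_all)
  finally show "stored (absorb xs \<sigma>) \<subseteq> stored \<sigma> \<union> set xs" by (auto simp: a stored_def)
  have "mass_at D t (compress J birth_weight N Z) \<le> mass_at D t Z" using c(2) by (simp add: dominated_def)
  also have "\<dots> = mass_at D t (marks \<sigma>) + 4 ^ phase (total \<sigma>) * tally D t xs"
    by (simp add: Z_def mass_at_insert_all birth_weight_def)
  finally show "est D t (absorb xs \<sigma>) \<le> est D t \<sigma> + 4 ^ phase (total \<sigma>) * tally D t xs"
    by (simp add: a est_def b f tally_def)
  show "bufs (absorb xs \<sigma>) i = []" "fill (absorb xs \<sigma>) = 0" by (simp_all add: a b)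
qed

text \<open>Buffer, batch and capacity are multiples of \<open>chunk\<close>, so a buffer cannot
  overshoot. A full one has exactly its capacity, which is divisible by 4, and thinning then
  preserves weight.\<close>

lemma ready_SucD:
  assumes r: "ready (Suc i) xs \<sigma>"
  shows "Suc i \<le> J" "Suc i \<le> phase (total \<sigma>)" "length (bufs \<sigma> (Suc i) @ xs) \<le> cap (Suc i)"
    "chunk (phase (total \<sigma>)) (Suc i) dvd length (bufs \<sigma> (Suc i) @ xs)"
proof -
  let ?q = "phase (total \<sigma>)"
  show i: "Suc i \<le> J" "Suc i \<le> ?q" using r by (auto simp: ready_def)
  have ok: "buf_ok ?q (Suc i) (bufs \<sigma> (Suc i))" and l: "length xs = chunk ?q (Suc i)"
    using r by (auto simp: ready_def good_def)
  have d: "chunk ?q (Suc i) dvd length (bufs \<sigma> (Suc i))" and lt: "length (bufs \<sigma> (Suc i)) < cap (Suc i)"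
    using ok i by (auto simp: buf_ok_def)
  show "chunk ?q (Suc i) dvd length (bufs \<sigma> (Suc i) @ xs)" using d l by simp
  have cd: "chunk ?q (Suc i) dvd cap (Suc i)" by (simp add: chunk_def cap_def)
  from d cd obtain u v where "length (bufs \<sigma> (Suc i)) = chunk ?q (Suc i) * u" "cap (Suc i) = chunk ?q (Suc i) * v"
    by (auto elim!: dvdE)
  moreover from this lt have "u < v" by auto
  ultimately show "length (bufs \<sigma> (Suc i) @ xs) \<le> cap (Suc i)"
    using mult_le_mono2[of "Suc u" v "chunk ?q (Suc i)"] l by simp
qed

lemma cap_Suc: "Suc i \<le> J \<Longrightarrow> cap (Suc i) = 4 * 2 ^ (J - i)"
  by (simp add: cap_def Suc_diff_Suc[symmetric])

lemma ready_thin: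
  assumes r: "ready (Suc i) xs \<sigma>" and full: "\<not> length (bufs \<sigma> (Suc i) @ xs) < cap (Suc i)"
  shows "ready i (thin s (sort (bufs \<sigma> (Suc i) @ xs))) (set_buf (Suc i) [] \<sigma>)"
    "length (bufs \<sigma> (Suc i) @ xs) = 4 * 2 ^ (J - i)"
proof -
  note D = ready_SucD[OF r]
  show len: "length (bufs \<sigma> (Suc i) @ xs) = 4 * 2 ^ (J - i)" using D(1,3) full cap_Suc by simp
  have "buf_ok (phase (total \<sigma>)) (Suc i) []" by (simp add: buf_ok_def cap_def)
  then have "good (set_buf (Suc i) [] \<sigma>)" using r good_set_buf by (simp add: ready_def)
  then show "ready i (thin s (sort (bufs \<sigma> (Suc i) @ xs))) (set_buf (Suc i) [] \<sigma>)"
    using r len D(1,2) by (auto simp: ready_def chunk_def less_Suc_eq)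
qed

lemma push_support:
  assumes "ready i xs \<sigma>" "\<sigma>' \<in> set_pmf (push i xs \<sigma>)"
  shows "good \<sigma>' \<and> items \<sigma>' = items \<sigma> + 4 ^ (phase (total \<sigma>) - i) * length xs \<and>
    stored \<sigma>' \<subseteq> stored \<sigma> \<union> set xs"
  using assms
proof (induction i arbitrary: xs \<sigma>)
  case 0
  then show ?case using absorb[OF 0(1)] by simp
next
  case (Suc i)
  note D = ready_SucD[OF Suc.prems(1)]
  let ?q = "phase (total \<sigma>)" and ?b = "bufs \<sigma> (Suc i) @ xs"
  have g: "good \<sigma>" using Suc.prems(1) by (simp add: ready_def)
  show ?case
  proof (cases "length ?b < cap (Suc i)")
    case True
    then have \<sigma>': "\<sigma>' = set_buf (Suc i) ?b \<sigma>" using Suc.prems(2) by simp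
    have "buf_ok ?q (Suc i) ?b" using D True by (simp add: buf_ok_def)
    then have "good \<sigma>'" using g \<sigma>' good_set_buf by simp
    moreover have "items \<sigma>' = items \<sigma> + 4 ^ (?q - Suc i) * length xs"
      using items_set_buf[of "Suc i" ?b \<sigma>] D(1) \<sigma>' by (simp add: algebra_simps)
    moreover have "stored \<sigma>' \<subseteq> stored \<sigma> \<union> set xs" by (auto simp: \<sigma>' stored_def split: if_splits)
    ultimately show ?thesis by simp
  next
    case False
    let ?\<sigma> = "set_buf (Suc i) [] \<sigma>"
    obtain s where s: "s < 4" "\<sigma>' \<in> set_pmf (push i (thin s (sort ?b)) ?\<sigma>)"
      using Suc.prems(2) False by (auto simp: Let_def set_pmf_of_set lessThan_empty_iff)
    note R = ready_thin[OF Suc.prems(1) False]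
    have IH: "good \<sigma>'" "items \<sigma>' = items ?\<sigma> + 4 ^ (?q - i) * length (thin s (sort ?b))"
      "stored \<sigma>' \<subseteq> stored ?\<sigma> \<union> set (thin s (sort ?b))"
      using Suc.IH[OF R(1) s(2)] by auto
    have "?q - i = Suc (?q - Suc i)" using D(2) by simp
    then have "items \<sigma>' = items ?\<sigma> + 4 ^ (?q - Suc i) * (4 * 2 ^ (J - i))"
      using IH(2) R(2) by simp
    also have "\<dots> = items ?\<sigma> + 4 ^ (?q - Suc i) * length (bufs \<sigma> (Suc i)) + 4 ^ (?q - Suc i) * length xs"
      using R(2) by (simp flip: distrib_left)
    also have "\<dots> = items \<sigma> + 4 ^ (?q - Suc i) * length xs"
      using items_set_buf[of "Suc i" "[]" \<sigma>] D(1) by simp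
    finally have "items \<sigma>' = items \<sigma> + 4 ^ (?q - Suc i) * length xs" .
    moreover have "stored ?\<sigma> \<union> set (thin s (sort ?b)) \<subseteq> stored \<sigma> \<union> set xs"
      using set_thin[OF s(1), of "sort ?b"] by (auto simp: stored_def split: if_splits)
    ultimately show ?thesis using IH by blast
  qed
qed


text \<open>The variance of the future compactions an item takes part in is paid for in advance:
  \<open>deposit q i\<close> is held by every item waiting at level \<open>i\<close>, and each new item of the
  stream contributes its share \<open>toll q\<close> of the deposit of its sample.\<close>

definition deposit :: "nat \<Rightarrow> nat \<Rightarrow> real" where
  "deposit q i = 2 * 16 ^ q * (1 - (1 / 2) ^ i) / (4 ^ i * 2 ^ J)"

definition toll :: "nat \<Rightarrow> real" where
  "toll q = deposit q (min q J) / 4 ^ (q - J)"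

definition reserve :: "cstate \<Rightarrow> real" where
  "reserve \<sigma> = (\<Sum>i\<in>{1..J}. deposit (phase (total \<sigma>)) i * length (bufs \<sigma> i)) +
     fill \<sigma> * toll (phase (total \<sigma>))"

lemma deposit_0 [simp]: "deposit q 0 = 0"
  by (simp add: deposit_def)

lemma deposit_nonneg: "0 \<le> deposit q i"
  by (simp add: deposit_def power_le_one)

lemma toll_nonneg: "0 \<le> toll q"
  by (simp add: toll_def deposit_nonneg)

lemma reserve_nonneg: "0 \<le> reserve \<sigma>"
  unfolding reserve_def
  by (intro add_nonneg_nonneg sum_nonneg mult_nonneg_nonneg deposit_nonneg toll_nonneg) auto

text \<open>The recurrence behind \<open>deposit\<close>: a full buffer pays for its own compaction
  and for the deposits of the survivors. With
  \<open>deposit q i = c i * 16 ^ q / (4 ^ i * 2 ^ J)\<close> it reads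
  \<open>c (Suc i) - c i = (1 / 2) ^ i\<close>, and \<open>c 0 = 0\<close> gives the factor
  \<open>2 * (1 - (1 / 2) ^ i)\<close>. That this stays below 2 is the geometric sum of the
  variances.\<close>

lemma deposit_Suc:
  assumes "Suc i \<le> J" "Suc i \<le> q"
  shows "16 * (4 ^ (q - Suc i))\<^sup>2 + deposit q i * 2 ^ (J - i) = deposit q (Suc i) * (4 * 2 ^ (J - i))"
proof -
  obtain a where q: "q = Suc i + a" using assms(2) by (auto dest: le_Suc_ex)
  obtain b where J: "J = Suc i + b" using assms(1) by (auto dest: le_Suc_ex)
  have 16: "(16::real) ^ n = 4 ^ n * 4 ^ n" for n by (simp flip: power_mult_distrib)
  have 4: "(4::real) ^ n = 2 ^ n * 2 ^ n" for n by (simp flip: power_mult_distrib)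
  show ?thesis unfolding deposit_def
    by (simp add: q J power_add 16 4 power2_eq_square power_divide field_simps)
qed

lemma reserve_set_buf:
  assumes "1 \<le> i" "i \<le> J"
  shows "reserve (set_buf i b \<sigma>) + deposit (phase (total \<sigma>)) i * length (bufs \<sigma> i) =
    reserve \<sigma> + deposit (phase (total \<sigma>)) i * length b"
  using sum_fun_upd[of "{1..J}" i "\<lambda>j b. deposit (phase (total \<sigma>)) j * length b" b "bufs \<sigma>"] assms
  by (simp add: reserve_def fun_upd_def)

lemma est_set_buf_real:
  assumes "1 \<le> i" "i \<le> J"
  shows "real (est D t (set_buf i b \<sigma>)) = real (est D t \<sigma>) +
    4 ^ (phase (total \<sigma>) - i) * real (tally D t b) - 4 ^ (phase (total \<sigma>) - i) * real (tally D t (bufs \<sigma> i))"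
  using arg_cong[OF est_set_buf[OF assms, of D t b \<sigma>], of real] by simp

text \<open>The logarithm of the supermartingale. Compactions cause variance in bursts; with the
  reserve added, it is charged to each arriving item at a rate that depends only on the
  phase.\<close>

definition weighted :: "real \<Rightarrow> bool \<Rightarrow> real \<Rightarrow> cstate \<Rightarrow> real" where
  "weighted s D t \<sigma> = s * est D t \<sigma> + s\<^sup>2 * reserve \<sigma>"

lemma mgf_compaction:
  assumes s: "0 \<le> s" "s * (4 * w) \<le> 1" and w: "0 \<le> w" and d: "4 dvd length b"
  shows "mgf_le (pmf_of_set {..<4}) (\<lambda>r. c + s * (w * (4 * real (tally D t (thin r (sort b))) - real (tally D t b))))
     (c + s\<^sup>2 * (16 * w\<^sup>2))"
proof (rule mgf_le_centered)
  let ?X = "\<lambda>r. 4 * real (tally D t (thin r (sort b))) - real (tally D t b)"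
  have ne: "{..<4::nat} \<noteq> {}" by (simp add: lessThan_empty_iff)
  have E: "measure_pmf.expectation (pmf_of_set {..<4::nat}) f = (\<Sum>r<4. f r) / 4" for f :: "nat \<Rightarrow> real"
    using integral_pmf_of_set[OF ne, of f] by simp
  have sum0: "(\<Sum>r<4. ?X r) = 0" and bd: "\<And>r. r < 4 \<Longrightarrow> \<bar>?X r\<bar> \<le> 4"
    using thin_error[where xs = "sort b" and D = D and t = t] d by simp_all
  show "finite (set_pmf (pmf_of_set {..<4::nat}))" by (simp add: set_pmf_of_set ne)
  show "measure_pmf.expectation (pmf_of_set {..<4}) (\<lambda>r. s * (w * ?X r)) = 0"
    unfolding E by (simp only: sum_distrib_left[symmetric] sum0)
  have "(s * (w * ?X r))\<^sup>2 \<le> s\<^sup>2 * (16 * w\<^sup>2)" if "r < 4" for r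
  proof -
    have "(?X r)\<^sup>2 \<le> 4\<^sup>2" using bd[OF that] by (intro abs_le_square_iff[THEN iffD1]) simp
    then have "(s * w)\<^sup>2 * (?X r)\<^sup>2 \<le> (s * w)\<^sup>2 * 4\<^sup>2" by (intro mult_left_mono) auto
    then show ?thesis by (simp add: power_mult_distrib mult.assoc mult.commute mult.left_commute)
  qed
  then have "(\<Sum>r<4. (s * (w * ?X r))\<^sup>2) \<le> (\<Sum>r<4::nat. s\<^sup>2 * (16 * w\<^sup>2))" by (intro sum_mono) auto
  then show "measure_pmf.expectation (pmf_of_set {..<4}) (\<lambda>r. (s * (w * ?X r))\<^sup>2) \<le> s\<^sup>2 * (16 * w\<^sup>2)"
    unfolding E by simp
  show "s * (w * ?X r) \<le> 1" if "r \<in> set_pmf (pmf_of_set {..<4})" for r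
  proof -
    have "r < 4" using that by (simp add: set_pmf_of_set ne)
    then have "?X r \<le> 4" using bd[of r] by (simp add: abs_le_iff)
    then have "s * (w * ?X r) \<le> s * (w * 4)" using s w by (intro mult_left_mono) auto
    then show ?thesis using s by (simp add: mult.commute)
  qed
qed

text \<open>The bound on \<open>s\<close> is asked for only above level 0, since
  \<open>absorb\<close> is deterministic. In phase 0 the items go straight to the markers, and
  \<open>s\<close> is free.\<close>

lemma mgf_push:
  assumes "ready i xs \<sigma>" "0 \<le> s" "0 < i \<Longrightarrow> s * 4 ^ phase (total \<sigma>) \<le> 1"
  shows "mgf_le (push i xs \<sigma>) (weighted s D t)
    (weighted s D t \<sigma> + s * (4 ^ (phase (total \<sigma>) - i) * tally D t xs) +
      s\<^sup>2 * (deposit (phase (total \<sigma>)) i * length xs))"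
  using assms
proof (induction i arbitrary: xs \<sigma>)
  case 0
  let ?\<sigma>' = "absorb xs \<sigma>"
  \<comment> \<open>Points that have reached the markers take part in no further random step, so
    their deposit is 0.\<close>
  have "reserve ?\<sigma>' = 0" using absorb(5,6)[OF 0(1)] by (simp add: reserve_def)
  moreover have "0 \<le> reserve \<sigma>" by (rule reserve_nonneg)
  ultimately have "s\<^sup>2 * reserve ?\<sigma>' \<le> s\<^sup>2 * reserve \<sigma>" by simp
  moreover have "s * real (est D t ?\<sigma>') \<le> s * real (est D t \<sigma> + 4 ^ phase (total \<sigma>) * tally D t xs)"
    using absorb(4)[OF 0(1)] 0(2) by (intro mult_left_mono) (simp_all only: of_nat_le_iff)
  ultimately show ?case by (auto intro!: mgf_le_return simp: weighted_def algebra_simps)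
next
  case (Suc i)
  note D = ready_SucD[OF Suc.prems(1)]
  let ?q = "phase (total \<sigma>)" and ?b = "bufs \<sigma> (Suc i) @ xs"
  define w where "w = (4::real) ^ (?q - Suc i)"
  show ?case
  proof (cases "length ?b < cap (Suc i)")
    case True
    have "real (est D t (set_buf (Suc i) ?b \<sigma>)) = real (est D t \<sigma>) + w * tally D t xs"
      using est_set_buf_real[of "Suc i" D t ?b \<sigma>] D(1) by (simp add: w_def algebra_simps)
    moreover have "reserve (set_buf (Suc i) ?b \<sigma>) = reserve \<sigma> + deposit ?q (Suc i) * length xs"
      using reserve_set_buf[of "Suc i" ?b \<sigma>] D(1) by (simp add: algebra_simps)
    ultimately have "weighted s D t (set_buf (Suc i) ?b \<sigma>) = weighted s D t \<sigma> + s * (w * tally D t xs) +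
        s\<^sup>2 * (deposit ?q (Suc i) * length xs)"
      by (simp add: weighted_def algebra_simps)
    then show ?thesis using True by (simp add: mgf_le_return w_def)
  next
    case False
    let ?\<sigma> = "set_buf (Suc i) [] \<sigma>"
    note R = ready_thin[OF Suc.prems(1) False]
    have w4: "(4::real) ^ (?q - i) = 4 * w" using D(2) by (simp add: w_def Suc_diff_Suc[symmetric])
    have small: "s * (4 * w) \<le> 1"
    proof -
      have "4 * w \<le> 4 ^ ?q" unfolding w4[symmetric] by (intro power_increasing) auto
      then have "s * (4 * w) \<le> s * 4 ^ ?q" using Suc.prems(2) by (intro mult_left_mono) auto
      then show ?thesis using Suc.prems(3) by simp
    qed
    have e: "real (est D t ?\<sigma>) + w * tally D t (bufs \<sigma> (Suc i)) = est D t \<sigma>"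
      using est_set_buf_real[of "Suc i" D t "[]" \<sigma>] D(1) by (simp add: w_def tally_def)
    have res: "reserve ?\<sigma> + deposit ?q (Suc i) * length (bufs \<sigma> (Suc i)) = reserve \<sigma>"
      using reserve_set_buf[of "Suc i" "[]" \<sigma>] D(1) by simp
    \<comment> \<open>The potential with the content of the full buffer counted exactly and the
      survivors' deposits set aside; the offset adds a centred error to it.\<close>
    define c where "c = weighted s D t ?\<sigma> + s * (w * tally D t ?b) + s\<^sup>2 * (deposit ?q i * 2 ^ (J - i))"
    have "mgf_le (push (Suc i) xs \<sigma>) (weighted s D t) (c + s\<^sup>2 * (16 * w\<^sup>2))"
      unfolding push.simps Let_def if_not_P[OF False]
    proof (rule mgf_le_bind)
      show "mgf_le (pmf_of_set {..<4}) (\<lambda>r. c + s * (w * (4 * real (tally D t (thin r (sort ?b))) - real (tally D t ?b))))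
          (c + s\<^sup>2 * (16 * w\<^sup>2))"
        by (rule mgf_compaction[OF Suc.prems(2) small]) (simp_all only: R(2), simp_all add: w_def)
    next
      fix r
      have "mgf_le (push i (thin r (sort ?b)) ?\<sigma>) (weighted s D t) (weighted s D t ?\<sigma> +
          s * (4 ^ (phase (total ?\<sigma>) - i) * tally D t (thin r (sort ?b))) +
          s\<^sup>2 * (deposit (phase (total ?\<sigma>)) i * length (thin r (sort ?b))))"
        using Suc.prems by (intro Suc.IH R(1)) simp_all
      moreover have "real (length (thin r (sort ?b))) = 2 ^ (J - i)" using R(2) by simp
      ultimately show "mgf_le (push i (thin r (sort ?b)) ?\<sigma>) (weighted s D t)
          (c + s * (w * (4 * real (tally D t (thin r (sort ?b))) - real (tally D t ?b))))"
        by (simp add: w4 c_def algebra_simps)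
    qed
    moreover have "c + s\<^sup>2 * (16 * w\<^sup>2) = weighted s D t \<sigma> + s * (w * tally D t xs) + s\<^sup>2 * (deposit ?q (Suc i) * length xs)"
    proof -
      have "16 * w\<^sup>2 + deposit ?q i * 2 ^ (J - i) = deposit ?q (Suc i) * length ?b"
        using deposit_Suc[OF D(1,2)] R(2) by (simp add: w_def)
      then have "16 * w\<^sup>2 + deposit ?q i * 2 ^ (J - i) + reserve ?\<sigma> = reserve \<sigma> + deposit ?q (Suc i) * length xs"
        using res by (simp add: algebra_simps)
      then have 1: "s\<^sup>2 * (16 * w\<^sup>2) + s\<^sup>2 * (deposit ?q i * 2 ^ (J - i)) + s\<^sup>2 * reserve ?\<sigma> =
          s\<^sup>2 * reserve \<sigma> + s\<^sup>2 * (deposit ?q (Suc i) * length xs)"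
        by (simp only: distrib_left[symmetric])
      have 2: "s * real (est D t ?\<sigma>) + s * (w * tally D t ?b) = s * est D t \<sigma> + s * (w * tally D t xs)"
        using e by (simp add: algebra_simps flip: e)
      show ?thesis using 1 2 by (simp add: c_def weighted_def)
    qed
    ultimately show ?thesis by (simp add: w_def)
  qed
qed

lemma ready_entry:
  assumes g: "good \<sigma>"
  shows "ready (min (phase (total \<sigma>)) J) [h] (CState (total \<sigma>) 0 k (bufs \<sigma>) (marks \<sigma>))"
proof -
  have "good (CState (total \<sigma>) 0 k (bufs \<sigma>) (marks \<sigma>))" using g by (simp add: good_def)
  moreover have "bufs \<sigma> j = []" if "min (phase (total \<sigma>)) J < j" for j
  proof -
    have "buf_ok (phase (total \<sigma>)) j (bufs \<sigma> j)" using g by (simp add: good_def)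
    then show ?thesis using that unfolding buf_ok_def by (auto split: if_splits)
  qed
  ultimately show ?thesis by (simp add: ready_def chunk_def)
qed

definition variance_rate :: "nat \<Rightarrow> real" where
  "variance_rate q = (4 ^ (q - J) - 1) + toll q"

lemma entry_weight: "(4::nat) ^ (q - min q J) = 4 ^ (q - J)"
  by (cases "q \<le> J") auto

lemma step_support:
  assumes g: "good \<sigma>" and \<sigma>': "\<sigma>' \<in> set_pmf (step x \<sigma>)"
  shows "good \<sigma>' \<and> items \<sigma>' = Suc (items \<sigma>) \<and> stored \<sigma>' \<subseteq> insert x (stored \<sigma>)"
proof -
  obtain b where b: "\<sigma>' \<in> set_pmf (let h = if b then x else held \<sigma> in
     if Suc (fill \<sigma>) < 4 ^ (phase (total \<sigma>) - J)
     then return_pmf (CState (total \<sigma>) (Suc (fill \<sigma>)) h (bufs \<sigma>) (marks \<sigma>))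
     else push (min (phase (total \<sigma>)) J) [h] (CState (total \<sigma>) 0 h (bufs \<sigma>) (marks \<sigma>)))"
    using \<sigma>' unfolding step_def set_bind_pmf by blast
  define h where "h = (if b then x else held \<sigma>)"
  have h: "h = x \<or> h = held \<sigma>" by (simp add: h_def)
  note \<sigma>' = b[folded h_def, unfolded Let_def]
  show ?thesis
  proof (cases "Suc (fill \<sigma>) < 4 ^ (phase (total \<sigma>) - J)")
    case True
    then show ?thesis using \<sigma>' g h by (auto simp: good_def items_def stored_def)
  next
    case False
    then have f: "4 ^ (phase (total \<sigma>) - J) = Suc (fill \<sigma>)" using g by (simp add: good_def)
    let ?\<sigma> = "CState (total \<sigma>) 0 h (bufs \<sigma>) (marks \<sigma>)"
    from push_support[OF ready_entry[OF g, of h h], of \<sigma>'] \<sigma>' False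
    have "good \<sigma>'" "items \<sigma>' = items ?\<sigma> + 4 ^ (phase (total \<sigma>) - min (phase (total \<sigma>)) J)"
      "stored \<sigma>' \<subseteq> stored ?\<sigma> \<union> {h}" by simp_all
    moreover have "stored ?\<sigma> \<union> {h} \<subseteq> insert x (stored \<sigma>)" using h by (auto simp: stored_def)
    ultimately show ?thesis using f by (auto simp: entry_weight items_def)
  qed
qed

text \<open>Replacing the sample with probability \<open>1 / (l + 1)\<close> keeps the estimate
  unbiased: the error \<open>X\<close> has mean 0 and variance \<open>l * (e - y)^2\<close>, at most
  \<open>l\<close>. One \<open>toll\<close> per item adds up to the deposit of the sample when the
  block is complete.\<close>

lemma mgf_step:
  assumes g: "good \<sigma>" and s: "0 \<le> s" "phase (total \<sigma>) \<noteq> 0 \<Longrightarrow> s * 4 ^ phase (total \<sigma>) \<le> 1"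
  shows "mgf_le (step x \<sigma>) (weighted s D t)
    (weighted s D t \<sigma> + s * tally D t [x] + s\<^sup>2 * variance_rate (phase (total \<sigma>)))"
proof -
  define q where "q = phase (total \<sigma>)"
  define l where "l = fill \<sigma>"
  define y where "y = real (tally D t [held \<sigma>])"
  define e where "e = real (tally D t [x])"
  define X where "X c = (if c then l * (e - y) else y - e)" for c
  define \<tau> where "\<tau> h = CState (total \<sigma>) 0 h (bufs \<sigma>) (marks \<sigma>)" for h
  have ye: "y \<in> {0, 1}" "e \<in> {0, 1}" by (auto simp: y_def e_def tally_def)
  have l: "l < 4 ^ (q - J)" using g by (simp add: good_def l_def q_def)
  have est: "real (est D t \<sigma>) = real (est D t (\<tau> h)) + l * y" for h
    by (simp add: est_def \<tau>_def l_def y_def)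
  have res: "reserve \<sigma> = reserve (\<tau> h) + l * toll q" for h
    by (simp add: reserve_def \<tau>_def l_def q_def)
  define c where "c = weighted s D t \<sigma> + s * e + s\<^sup>2 * toll q"
  have prob: "0 \<le> 1 / (real l + 1)" "1 / (real l + 1) \<le> 1" by auto
  have E: "measure_pmf.expectation (bernoulli_pmf (1 / (real l + 1))) f =
      f True / (real l + 1) + f False * (l / (real l + 1))" for f :: "bool \<Rightarrow> real"
    by (subst integral_bernoulli_pmf[OF prob]) (simp add: field_simps)
  have "mgf_le (step x \<sigma>) (weighted s D t) (c + s\<^sup>2 * l)"
    unfolding step_def l_def[symmetric]
  proof (rule mgf_le_bind)
    show "mgf_le (bernoulli_pmf (1 / (real l + 1))) (\<lambda>b. c + s * X b) (c + s\<^sup>2 * l)"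
    proof (rule mgf_le_centered)
      show "finite (set_pmf (bernoulli_pmf (1 / (real l + 1))))" by (rule finite_subset[of _ UNIV]) auto
      show "measure_pmf.expectation (bernoulli_pmf (1 / (real l + 1))) (\<lambda>b. s * X b) = 0"
        unfolding E X_def by (simp add: field_simps)
      have "(l * (e - y))\<^sup>2 / (real l + 1) + (y - e)\<^sup>2 * (l / (real l + 1)) = l * (e - y)\<^sup>2"
      proof -
        have "(l * (e - y))\<^sup>2 / (real l + 1) + (y - e)\<^sup>2 * (l / (real l + 1)) = l * (e - y)\<^sup>2 * (real l + 1) / (real l + 1)"
          by (simp add: power2_eq_square algebra_simps flip: add_divide_distrib)
        then show ?thesis by simp
      qed
      also have "\<dots> \<le> real l * 1" using ye by (intro mult_left_mono) auto
      finally have "s\<^sup>2 * ((l * (e - y))\<^sup>2 / (real l + 1) + (y - e)\<^sup>2 * (l / (real l + 1))) \<le> s\<^sup>2 * l"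
        by (intro mult_left_mono) auto
      then show "measure_pmf.expectation (bernoulli_pmf (1 / (real l + 1))) (\<lambda>b. (s * X b)\<^sup>2) \<le> s\<^sup>2 * l"
        unfolding E X_def by (simp add: power_mult_distrib distrib_left)
    next
      fix b assume b: "b \<in> set_pmf (bernoulli_pmf (1 / (real l + 1)))"
      show "s * X b \<le> 1"
      proof (cases "l = 0")
        \<comment> \<open>The item is then held with certainty and the error vanishes. In phase 0,
          where \<open>s\<close> may be large, this is the only possible case.\<close>
        case True
        then have "b" using b prob by (cases b) (auto simp: set_pmf_iff)
        then show ?thesis using True by (simp add: X_def)
      next
        case False
        then have q0: "q \<noteq> 0" using l by (cases q) auto
        have "l \<le> (4::nat) ^ q" using l power_increasing[of "q - J" q "4::nat"] by linarith
        then have lq: "real l \<le> 4 ^ q" by (metis of_nat_le_iff of_nat_numeral of_nat_power)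
        have "X b \<le> real l" using ye False by (auto simp: X_def)
        from mult_left_mono[OF order_trans[OF this lq] s(1)] have "s * X b \<le> s * 4 ^ q" .
        then show ?thesis using s(2) q0 by (simp add: q_def)
      qed
    qed
  next
    fix b
    define h where "h = (if b then x else held \<sigma>)"
    have X: "(l + 1) * real (tally D t [h]) = l * y + e + X b"
      by (simp add: h_def X_def y_def e_def algebra_simps)
    have key: "weighted s D t (\<tau> h) + s * ((l + 1) * real (tally D t [h])) + s\<^sup>2 * ((l + 1) * toll q) = c + s * X b"
      unfolding X using est[of h] res[of h] by (simp add: weighted_def c_def algebra_simps)
    have "mgf_le (if Suc l < 4 ^ (phase (total \<sigma>) - J)
        then return_pmf (CState (total \<sigma>) (Suc l) h (bufs \<sigma>) (marks \<sigma>))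
        else push (min (phase (total \<sigma>)) J) [h] (CState (total \<sigma>) 0 h (bufs \<sigma>) (marks \<sigma>)))
       (weighted s D t) (c + s * X b)"
    proof (cases "Suc l < 4 ^ (phase (total \<sigma>) - J)")
      case True
      have "weighted s D t (CState (total \<sigma>) (Suc l) h (bufs \<sigma>) (marks \<sigma>)) =
          weighted s D t (\<tau> h) + s * ((l + 1) * real (tally D t [h])) + s\<^sup>2 * ((l + 1) * toll q)"
        by (simp add: weighted_def est_def reserve_def \<tau>_def q_def algebra_simps)
      then show ?thesis using True key by (simp add: mgf_le_return)
    next
      case False
      then have f: "4 ^ (q - J) = Suc l" using l by (simp add: q_def)
      then have f': "4 ^ (q - J) = real l + 1" by (metis of_nat_Suc of_nat_numeral of_nat_power add.commute)
      have tq: "real (l + 1) * toll q = deposit q (min q J)" by (simp add: toll_def f' field_simps)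
      have w: "(4::real) ^ (q - min q J) = real l + 1"
        using entry_weight[of q] f by (metis of_nat_Suc of_nat_numeral of_nat_power add.commute)
      have "mgf_le (push (min q J) [h] (\<tau> h)) (weighted s D t)
         (weighted s D t (\<tau> h) + s * (4 ^ (phase (total (\<tau> h)) - min q J) * tally D t [h]) +
          s\<^sup>2 * (deposit (phase (total (\<tau> h))) (min q J) * length [h]))"
      proof (rule mgf_push[OF _ s(1)])
        show "ready (min q J) [h] (\<tau> h)" unfolding q_def \<tau>_def by (rule ready_entry[OF g])
      qed (use s(2) in \<open>simp add: \<tau>_def q_def\<close>)
      then have "mgf_le (push (min q J) [h] (\<tau> h)) (weighted s D t)
         (weighted s D t (\<tau> h) + s * ((l + 1) * real (tally D t [h])) + s\<^sup>2 * ((l + 1) * toll q))"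
        unfolding tq using w by (simp add: \<tau>_def algebra_simps flip: q_def)
      then have "mgf_le (push (min q J) [h] (\<tau> h)) (weighted s D t) (c + s * X b)"
        unfolding key .
      then show ?thesis using False by (simp add: \<tau>_def q_def)
    qed
    then show "mgf_le (let h = if b then x else held \<sigma> in if Suc l < 4 ^ (phase (total \<sigma>) - J)
        then return_pmf (CState (total \<sigma>) (Suc l) h (bufs \<sigma>) (marks \<sigma>))
        else push (min (phase (total \<sigma>)) J) [h] (CState (total \<sigma>) 0 h (bufs \<sigma>) (marks \<sigma>)))
       (weighted s D t) (c + s * X b)" unfolding Let_def h_def .
  qed
  moreover have "c + s\<^sup>2 * l \<le> weighted s D t \<sigma> + s * tally D t [x] + s\<^sup>2 * variance_rate q"
  proof -
    have "l + 1 \<le> (4::nat) ^ (q - J)" using l by simp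
    then have "real (l + 1) \<le> real (4 ^ (q - J))" by (simp only: of_nat_le_iff)
    then have "real l + 1 \<le> 4 ^ (q - J)" by (simp only: of_nat_add of_nat_1 of_nat_power of_nat_numeral)
    then have "s\<^sup>2 * (real l + toll q) \<le> s\<^sup>2 * variance_rate q"
      by (intro mult_left_mono) (auto simp: variance_rate_def)
    then show ?thesis by (simp add: c_def e_def algebra_simps)
  qed
  ultimately show ?thesis unfolding q_def by (rule mgf_le_mono) simp
qed


section \<open>Deviation bounds for a whole stream\<close>

definition counting :: "ereal list \<Rightarrow> cstate pmf" where
  "counting es = foldl (\<lambda>p x. bind_pmf p (step x)) (return_pmf start) es"

lemma counting_Nil [simp]: "counting [] = return_pmf start"
  by (simp add: counting_def)

lemma counting_snoc [simp]: "counting (es @ [x]) = bind_pmf (counting es) (step x)"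
  by (simp add: counting_def)

lemma phase_0 [simp]: "phase 0 = 0"
  using phase_lower'[of 0] by fastforce

lemma good_start: "good start"
  by (auto simp: good_def start_def valid_Nil max_marks_def buf_ok_def cap_def)

lemma counting_support:
  "\<sigma> \<in> set_pmf (counting es) \<Longrightarrow> good \<sigma> \<and> items \<sigma> = length es \<and> stored \<sigma> \<subseteq> insert \<infinity> (set es)"
proof (induction es arbitrary: \<sigma> rule: rev_induct)
  case Nil
  then show ?case using good_start by (simp add: start_def items_def stored_def)
next
  case (snoc x es)
  then obtain \<sigma>0 where "\<sigma>0 \<in> set_pmf (counting es)" "\<sigma> \<in> set_pmf (step x \<sigma>0)" by auto
  then show ?case using snoc.IH[of \<sigma>0] step_support[of \<sigma>0 \<sigma> x] by auto
qed

lemma variance_rate_le: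
  "variance_rate q \<le> (if q = 0 then 0 else 3 * 4 ^ q / 2 ^ J)"
proof (cases "q = 0")
  case True
  then show ?thesis by (simp add: variance_rate_def toll_def)
next
  case False
  have pow: "(4::real) ^ min q J * 4 ^ (q - J) = 4 ^ q" by (simp flip: power_add)
  have "toll q = 2 * 16 ^ q * (1 - (1 / 2) ^ min q J) / (4 ^ min q J * 4 ^ (q - J) * 2 ^ J)"
    by (simp add: toll_def deposit_def mult.assoc mult.left_commute mult.commute)
  also have "\<dots> \<le> 2 * 16 ^ q * 1 / (4 ^ min q J * 4 ^ (q - J) * 2 ^ J)"
    by (intro divide_right_mono mult_left_mono) auto
  also have "\<dots> = 2 * 4 ^ q / 2 ^ J"
  proof -
    have "(16::real) ^ q = 4 ^ q * 4 ^ q" by (simp flip: power_mult_distrib)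
    then show ?thesis unfolding pow by simp
  qed
  finally have 1: "toll q \<le> 2 * 4 ^ q / 2 ^ J" .
  have 2: "(4::real) ^ (q - J) - 1 \<le> 4 ^ q / 2 ^ J"
  proof (cases "q \<le> J")
    case False
    then have "(4::real) ^ (q - J) = 4 ^ q / 4 ^ J" by (simp add: power_diff)
    also have "\<dots> \<le> 4 ^ q / 2 ^ J" by (intro divide_left_mono power_mono) auto
    finally show ?thesis by simp
  qed simp
  show ?thesis using 1 2 False by (simp add: variance_rate_def add_divide_distrib[symmetric])
qed

text \<open>Outside phase 0, \<open>4 ^ q <= n / 2 ^ (J + ell)\<close>. This gives
  \<open>s * 4 ^ q <= 1\<close> as well as one bound on the variance rate that is valid for every
  item.\<close>

lemma mgf_counting:
  fixes s :: real and n :: nat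
  assumes "length es \<le> n" "0 \<le> s" "s * n \<le> 2 ^ (J + ell)"
  shows "mgf_le (counting es) (weighted s D t)
    (s * tally D t es + s\<^sup>2 * (length es * (3 * n / (2 ^ J * 2 ^ (J + ell)))))"
  using assms(1)
proof (induction es rule: rev_induct)
  case Nil
  show ?case by (auto intro!: mgf_le_return simp: weighted_def est_def reserve_def start_def mass_at_def tally_def)
next
  case (snoc x es)
  define r where "r = 3 * n / (2 ^ J * 2 ^ (J + ell))"
  define c where "c = s * tally D t [x] + s\<^sup>2 * r"
  show ?case unfolding counting_snoc
  proof (rule mgf_le_bind)
    fix \<sigma> assume \<sigma>: "\<sigma> \<in> set_pmf (counting es)"
    define q where "q = phase (total \<sigma>)"
    have g: "good \<sigma>" and it: "items \<sigma> = length es" using counting_support[OF \<sigma>] by auto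
    have tn: "total \<sigma> \<le> n" using it snoc.prems by (simp add: items_def)
    have q: "(4::real) ^ q * 2 ^ (J + ell) \<le> real n" if "q \<noteq> 0"
    proof -
      have "4 ^ q * 2 ^ (J + ell) \<le> n" using phase_lower'[of "total \<sigma>"] that tn by (simp add: q_def)
      then have "real (4 ^ q * 2 ^ (J + ell)) \<le> real n" by (simp only: of_nat_le_iff)
      then show ?thesis by (simp only: of_nat_mult of_nat_power of_nat_numeral)
    qed
    have s4: "s * 4 ^ q \<le> 1" if "q \<noteq> 0"
    proof -
      have "s * ((4::real) ^ q * 2 ^ (J + ell)) \<le> s * real n" by (rule mult_left_mono[OF q[OF that] assms(2)])
      also have "\<dots> \<le> 2 ^ (J + ell)" by (rule assms(3))
      finally have "(s * 4 ^ q) * 2 ^ (J + ell) \<le> 1 * 2 ^ (J + ell)" by (simp add: mult.assoc)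
      then show ?thesis by (rule mult_right_le_imp_le) simp
    qed
    have "variance_rate q \<le> r"
    proof (cases "q = 0")
      case True
      then show ?thesis using variance_rate_le[of q] by (simp add: r_def order_trans[of _ 0])
    next
      case False
      have "(4::real) ^ q \<le> n / 2 ^ (J + ell)" by (rule mult_imp_le_div_pos[OF _ q[OF False]]) simp
      then have "3 * 4 ^ q / 2 ^ J \<le> 3 * (n / 2 ^ (J + ell)) / 2 ^ J" by (intro divide_right_mono) auto
      also have "\<dots> = r" by (simp add: r_def mult.commute)
      finally show ?thesis using variance_rate_le[of q] False by simp
    qed
    then have v: "s\<^sup>2 * variance_rate q \<le> s\<^sup>2 * r" by (intro mult_left_mono) auto
    have "mgf_le (step x \<sigma>) (weighted s D t) (weighted s D t \<sigma> + s * tally D t [x] + s\<^sup>2 * variance_rate q)"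
      unfolding q_def using s4 by (intro mgf_step[OF g assms(2)]) (simp add: q_def)
    then show "mgf_le (step x \<sigma>) (weighted s D t) (c + weighted s D t \<sigma>)"
      by (rule mgf_le_mono) (use v in \<open>auto simp: c_def\<close>)
  next
    have "mgf_le (counting es) (weighted s D t) (s * tally D t es + s\<^sup>2 * (length es * r))"
      using snoc by (simp add: r_def)
    then show "mgf_le (counting es) (\<lambda>\<sigma>. c + weighted s D t \<sigma>)
       (s * tally D t (es @ [x]) + s\<^sup>2 * (length (es @ [x]) * (3 * n / (2 ^ J * 2 ^ (J + ell)))))"
      unfolding r_def[symmetric]
    proof -
      assume a: "mgf_le (counting es) (weighted s D t) (s * tally D t es + s\<^sup>2 * (length es * r))"
      have "(\<integral>\<^sup>+\<sigma>. ennreal (exp (c + weighted s D t \<sigma>)) \<partial>measure_pmf (counting es)) =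
          ennreal (exp c) * (\<integral>\<^sup>+\<sigma>. ennreal (exp (weighted s D t \<sigma>)) \<partial>measure_pmf (counting es))"
        by (subst nn_integral_cmult[symmetric]) (simp_all add: exp_add ennreal_mult')
      also have "\<dots> \<le> ennreal (exp c) * ennreal (exp (s * tally D t es + s\<^sup>2 * (length es * r)))"
        using a by (intro mult_left_mono) (auto simp: mgf_le_def)
      also have "\<dots> = ennreal (exp (c + (s * tally D t es + s\<^sup>2 * (length es * r))))"
        by (simp add: exp_add ennreal_mult')
      also have "c + (s * tally D t es + s\<^sup>2 * (length es * r)) = s * tally D t (es @ [x]) + s\<^sup>2 * (length (es @ [x]) * r)"
        by (simp add: c_def algebra_simps)
      finally show "mgf_le (counting es) (\<lambda>\<sigma>. c + weighted s D t \<sigma>) (s * tally D t (es @ [x]) + s\<^sup>2 * (length (es @ [x]) * r))"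
        by (simp add: mgf_le_def)
    qed
  qed
qed

lemma counting_tail:
  assumes "es \<noteq> []"
  shows "measure_pmf.prob (counting es) {\<sigma>. tally D t es + length es / 2 ^ J \<le> est D t \<sigma>} \<le> exp (- (2 ^ ell / 12))"
proof -
  define n where "n = real (length es)"
  \<comment> \<open>For \<open>s * n = x * 2 ^ (J + ell)\<close> the exponent in the tail bound is
    \<open>2 ^ ell * (3 * x^2 - x)\<close>. It is least at \<open>x = 1 / 6\<close>, with the value
    \<open>- (2 ^ ell / 12)\<close>.\<close>
  define s where "s = 2 ^ (J + ell) / (6 * n)"
  have n: "0 < n" using assms by (simp add: n_def)
  have s: "0 < s" "s * n = 2 ^ (J + ell) / 6" using n by (simp_all add: s_def)
  define a where "a = s * (tally D t es + n / 2 ^ J)"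
  have "mgf_le (counting es) (weighted s D t)
    (s * tally D t es + s\<^sup>2 * (length es * (3 * length es / (2 ^ J * 2 ^ (J + ell)))))"
  proof (rule mgf_counting)
    show "s * real (length es) \<le> 2 ^ (J + ell)" using s(2) unfolding n_def by (simp only:) simp
  qed (use s in auto)
  from mgf_le_tail[OF this, of a]
  have tail: "measure_pmf.prob (counting es) {\<sigma>. a \<le> weighted s D t \<sigma>} \<le>
      exp (s * tally D t es + s\<^sup>2 * (n * (3 * n / (2 ^ J * 2 ^ (J + ell)))) - a)"
    by (simp add: n_def)
  have "s\<^sup>2 * (n * (3 * n / (2 ^ J * 2 ^ (J + ell)))) = 3 * (s * n)\<^sup>2 / (2 ^ J * 2 ^ (J + ell))"
    by (simp add: power2_eq_square)
  also have "\<dots> = 2 ^ ell / 12" unfolding s(2) by (simp add: power2_eq_square power_add)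
  finally have v: "s\<^sup>2 * (n * (3 * n / (2 ^ J * 2 ^ (J + ell)))) = 2 ^ ell / 12" .
  have "s * (n / 2 ^ J) = (s * n) / 2 ^ J" by simp
  also have "\<dots> = 2 ^ ell / 6" unfolding s(2) by (simp add: power_add)
  finally have "s * tally D t es + s\<^sup>2 * (n * (3 * n / (2 ^ J * 2 ^ (J + ell)))) - a = - (2 ^ ell / 12)"
    unfolding v a_def by (simp add: distrib_left)
  note tail = tail[unfolded this]
  have "measure_pmf.prob (counting es) {\<sigma>. tally D t es + n / 2 ^ J \<le> est D t \<sigma>} \<le>
      measure_pmf.prob (counting es) {\<sigma>. a \<le> weighted s D t \<sigma>}"
  proof (intro measure_pmf.finite_measure_mono)
    show "{\<sigma>. tally D t es + n / 2 ^ J \<le> est D t \<sigma>} \<subseteq> {\<sigma>. a \<le> weighted s D t \<sigma>}"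
    proof clarify
      fix \<sigma> assume "tally D t es + n / 2 ^ J \<le> real (est D t \<sigma>)"
      then have "a \<le> s * est D t \<sigma>" unfolding a_def using s by (intro mult_left_mono) auto
      also have "\<dots> \<le> weighted s D t \<sigma>" by (simp add: weighted_def reserve_nonneg)
      finally show "a \<le> weighted s D t \<sigma>" .
    qed
  qed simp
  then show ?thesis using tail by (simp add: n_def)
qed

text \<open>Buffers and the sample split exactly between the two sides of \<open>t\<close>; weight
  is missing only in the markers.\<close>

lemma est_total:
  assumes g: "good \<sigma>"
  shows "items \<sigma> - items \<sigma> / 2 ^ J \<le> real (est True t \<sigma>) + est False t \<sigma>"
proof -
  have v: "valid J birth_weight (total \<sigma>) (total \<sigma>) (marks \<sigma>)" using g by (simp add: good_def)
  define m where "m = mass_at False t (marks \<sigma>) + mass_at True t (marks \<sigma>)"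
  have "2 ^ J * total \<sigma> \<le> total \<sigma> + 2 ^ J * m" using mass_at_gap[OF v, of t] by (simp add: m_def)
  then have "real (2 ^ J * total \<sigma>) \<le> real (total \<sigma> + 2 ^ J * m)" by (simp only: of_nat_le_iff)
  then have "real (total \<sigma>) \<le> (total \<sigma> + 2 ^ J * real m) / 2 ^ J" by (simp add: pos_le_divide_eq mult.commute)
  also have "\<dots> = total \<sigma> / 2 ^ J + m" by (simp add: add_divide_distrib)
  also have "total \<sigma> / 2 ^ J \<le> items \<sigma> / 2 ^ J"
  proof -
    have "total \<sigma> \<le> items \<sigma>" by (simp add: items_def)
    then have "real (total \<sigma>) \<le> real (items \<sigma>)" by (simp only: of_nat_le_iff)
    then show ?thesis by (rule divide_right_mono) simp
  qed
  finally have "real (total \<sigma>) \<le> items \<sigma> / 2 ^ J + m" by simp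
  moreover have "est True t \<sigma> + est False t \<sigma> + total \<sigma> = items \<sigma> + m"
  proof -
    have "tally True t [held \<sigma>] + tally False t [held \<sigma>] = 1" using tally_compl[of t "[held \<sigma>]"] by simp
    then have h: "fill \<sigma> * tally True t [held \<sigma>] + fill \<sigma> * tally False t [held \<sigma>] = fill \<sigma>"
      by (simp flip: distrib_left)
    have "(\<Sum>i\<in>{1..J}. 4 ^ (phase (total \<sigma>) - i) * tally True t (bufs \<sigma> i)) +
        (\<Sum>i\<in>{1..J}. 4 ^ (phase (total \<sigma>) - i) * tally False t (bufs \<sigma> i)) =
        (\<Sum>i\<in>{1..J}. 4 ^ (phase (total \<sigma>) - i) * length (bufs \<sigma> i))"
      by (simp add: sum.distrib[symmetric] distrib_left[symmetric] tally_compl)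
    then show ?thesis using h by (simp add: est_def items_def m_def)
  qed
  then have "real (est True t \<sigma>) + est False t \<sigma> + total \<sigma> = items \<sigma> + real m" by (simp flip: of_nat_add)
  ultimately show ?thesis by linarith
qed

text \<open>In the lower bound, one \<open>n / 2 ^ J\<close> is the deviation on the expired side
  and the other is the weight lost by deletions.\<close>

theorem counting_accurate:
  "measure_pmf.prob (counting es) {\<sigma>. \<bar>real (est True t \<sigma>) - tally True t es\<bar> \<le> 2 * length es / 2 ^ J}
    \<ge> 1 - 2 * exp (- (2 ^ ell / 12))"
proof (cases "es = []")
  case True
  then show ?thesis by (simp add: start_def est_def mass_at_def tally_def)
next
  case False
  define n where "n = length es"
  let ?G = "{\<sigma>. \<bar>real (est True t \<sigma>) - tally True t es\<bar> \<le> 2 * n / 2 ^ J}"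
  let ?B = "\<lambda>D. {\<sigma>. tally D t es + n / 2 ^ J \<le> est D t \<sigma>}"
  have "measure_pmf.prob (counting es) (- ?G) \<le> measure_pmf.prob (counting es) (?B True \<union> ?B False)"
  proof (intro measure_pmf.finite_measure_mono_AE)
    show "AE \<sigma> in measure_pmf (counting es). \<sigma> \<in> - ?G \<longrightarrow> \<sigma> \<in> ?B True \<union> ?B False"
      unfolding AE_measure_pmf_iff
    proof (intro ballI impI, rule ccontr)
      fix \<sigma> assume \<sigma>: "\<sigma> \<in> set_pmf (counting es)" and bad: "\<sigma> \<in> - ?G" and "\<sigma> \<notin> ?B True \<union> ?B False"
      then have lt: "est True t \<sigma> < tally True t es + n / 2 ^ J" "est False t \<sigma> < tally False t es + n / 2 ^ J"
        by auto
      have "good \<sigma>" "items \<sigma> = n" using counting_support[OF \<sigma>] by (auto simp: n_def)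
      then have "n - n / 2 ^ J \<le> real (est True t \<sigma>) + est False t \<sigma>" using est_total[of \<sigma> t] by simp
      moreover have "real (tally True t es) + tally False t es = n"
        using tally_compl[of t es] by (simp add: n_def flip: of_nat_add)
      moreover have "0 \<le> n / 2 ^ J" "2 * n / 2 ^ J = n / 2 ^ J + n / 2 ^ J" by simp_all
      ultimately have "\<bar>real (est True t \<sigma>) - tally True t es\<bar> \<le> 2 * n / 2 ^ J" using lt by linarith
      then show False using bad by simp
    qed
  qed simp
  also have "\<dots> \<le> measure_pmf.prob (counting es) (?B True) + measure_pmf.prob (counting es) (?B False)"
    by (intro measure_Un_le) auto
  also have "\<dots> \<le> 2 * exp (- (2 ^ ell / 12))"
    using counting_tail[OF False, of True t] counting_tail[OF False, of False t] by (simp add: n_def)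
  finally have "measure_pmf.prob (counting es) (- ?G) \<le> 2 * exp (- (2 ^ ell / 12))" .
  then show ?thesis using measure_pmf.prob_compl[of ?G "counting es"] by (simp add: n_def Compl_eq_Diff_UNIV)
qed

end

section \<open>Storing the counter in words\<close>

text \<open>Unlike injectivity, this allows a field to be split off the front of a longer word
  list.\<close>

definition prefix_free :: "('a \<Rightarrow> word list) \<Rightarrow> bool" where
  "prefix_free f \<longleftrightarrow> (\<forall>x y u v. f x @ u = f y @ v \<longrightarrow> x = y \<and> u = v)"

lemma prefix_freeD: "prefix_free f \<Longrightarrow> f x @ u = f y @ v \<Longrightarrow> x = y \<and> u = v"
  by (auto simp: prefix_free_def)

text \<open>The flags 0 and 1 announce a further entry and the end.\<close>

definition enc_list :: "('a \<Rightarrow> word list) \<Rightarrow> 'a list \<Rightarrow> word list" where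
  "enc_list f xs = concat (map (\<lambda>x. CounterWord 0 # f x) xs) @ [CounterWord 1]"

lemma prefix_free_enc_list:
  assumes f: "prefix_free f"
  shows "prefix_free (enc_list f)"
proof -
  have "enc_list f xs @ u = enc_list f ys @ v \<Longrightarrow> xs = ys \<and> u = v" for xs ys u v
  proof (induction xs arbitrary: ys)
    case Nil
    then show ?case by (cases ys) (auto simp: enc_list_def)
  next
    case (Cons x xs)
    show ?case
    proof (cases ys)
      case Nil
      then show ?thesis using Cons.prems by (simp add: enc_list_def)
    next
      case (Cons y ys')
      then have "f x @ (enc_list f xs @ u) = f y @ (enc_list f ys' @ v)"
        using Cons.prems by (simp add: enc_list_def)
      from prefix_freeD[OF f this] show ?thesis using Cons.IH[of ys'] Cons by simp
    qed
  qed
  then show ?thesis unfolding prefix_free_def by blast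
qed

text \<open>The initial value \<open>\<infinity>\<close> of \<open>held\<close> need not be a time of the stream, hence not a storable
  \<open>TimeWord\<close>.\<close>

definition enc_time :: "ereal \<Rightarrow> word" where
  "enc_time \<tau> = (if \<tau> = \<infinity> then CounterWord 1 else if \<tau> = -\<infinity> then CounterWord 0 else TimeWord \<tau>)"

lemma enc_time_inj: "enc_time x = enc_time y \<Longrightarrow> x = y"
  by (auto simp: enc_time_def split: if_splits)

definition enc_marker :: "marker \<Rightarrow> word list" where
  "enc_marker z = [enc_time (place z), CounterWord (birth z), CounterWord (lmass z), CounterWord (rmass z)]"

lemma prefix_free_enc_marker: "prefix_free enc_marker"
  by (auto simp: prefix_free_def enc_marker_def intro: marker.expand dest: enc_time_inj)

lemma prefix_free_enc_time: "prefix_free (\<lambda>x. [enc_time x])"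
  by (auto simp: prefix_free_def dest: enc_time_inj)

lemma length_enc_list: "length (enc_list f xs) = (\<Sum>x\<leftarrow>xs. Suc (length (f x))) + 1"
  by (induction xs) (auto simp: enc_list_def)

lemma set_enc_list: "set (enc_list f xs) \<subseteq> {CounterWord 0, CounterWord 1} \<union> (\<Union>x\<in>set xs. set (f x))"
  by (auto simp: enc_list_def)

lemma run_snoc: "run A (xs @ [x]) = bind_pmf (run A xs) (update A x)"
  by (simp add: run_def)

lemma active_count_tally: "inserted_by t ls \<Longrightarrow> active_count t ls = tally True t (map snd ls)"
  unfolding active_count_def tally_def inserted_by_def
  by (induction ls) (auto simp: active_def sided_def)

lemma sum_list_pow2: "(\<Sum>i\<leftarrow>[1..<Suc n]. 2 ^ (n - i)) < (2::nat) ^ n"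
proof -
  have "(\<Sum>i\<leftarrow>[1..<Suc n]. 2 ^ (n - i)) = (\<Sum>i\<in>{1..n}. (2::nat) ^ (n - i))"
    by (simp add: sum_list_distinct_conv_sum_set atLeastLessThanSuc_atLeastAtMost del: upt_Suc)
  also have "\<dots> = (\<Sum>i<n. 2 ^ i)"
    by (rule sum.reindex_bij_witness[of _ "\<lambda>i. n - i" "\<lambda>i. n - i"]) auto
  also have "\<dots> < 2 ^ n" by (induction n) auto
  finally show ?thesis .
qed

lemma storable_enc_time:
  assumes "\<tau> \<in> insert \<infinity> S" and "\<And>e. e \<in> S \<Longrightarrow> \<exists>x s. (x, s, e) \<in> set xs"
  shows "storable 2 U xs (enc_time \<tau>)"
  using assms by (fastforce simp: enc_time_def power2_eq_square)

lemma storable_counter: "c \<le> length xs + 2 \<Longrightarrow> storable 2 U xs (CounterWord c)"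
proof -
  assume "c \<le> length xs + 2"
  also have "\<dots> \<le> (length xs + 2) ^ 2" by (rule self_le_power) auto
  finally show ?thesis by (simp only: storable.simps)
qed

context expiration_counter
begin

text \<open>Of the function \<open>bufs\<close> only the levels 1 to \<open>J\<close> are written.
  In good states the other levels are empty, so the encoding is injective on these.\<close>

definition enc_state :: "cstate \<Rightarrow> word list" where
  "enc_state \<sigma> = [CounterWord (total \<sigma>), CounterWord (fill \<sigma>), enc_time (held \<sigma>)] @
     enc_list (enc_list (\<lambda>x. [enc_time x])) (map (bufs \<sigma>) [1..<Suc J]) @ enc_list enc_marker (marks \<sigma>)"

lemma enc_state_inj:
  assumes g: "good \<sigma>" "good \<sigma>'" and e: "enc_state \<sigma> = enc_state \<sigma>'"
  shows "\<sigma> = \<sigma>'"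
proof -
  have h: "total \<sigma> = total \<sigma>'" "fill \<sigma> = fill \<sigma>'" "held \<sigma> = held \<sigma>'"
    using e by (auto simp: enc_state_def dest: enc_time_inj)
  have "enc_list (enc_list (\<lambda>x. [enc_time x])) (map (bufs \<sigma>) [1..<Suc J]) @ enc_list enc_marker (marks \<sigma>) =
      enc_list (enc_list (\<lambda>x. [enc_time x])) (map (bufs \<sigma>') [1..<Suc J]) @ enc_list enc_marker (marks \<sigma>')"
    using e by (simp add: enc_state_def)
  from prefix_freeD[OF prefix_free_enc_list[OF prefix_free_enc_list[OF prefix_free_enc_time]] this]
  have b: "map (bufs \<sigma>) [1..<Suc J] = map (bufs \<sigma>') [1..<Suc J]"
    and m: "enc_list enc_marker (marks \<sigma>) @ [] = enc_list enc_marker (marks \<sigma>') @ []" by simp_all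
  have m: "marks \<sigma> = marks \<sigma>'" using prefix_freeD[OF prefix_free_enc_list[OF prefix_free_enc_marker] m] by simp
  have "bufs \<sigma> i = bufs \<sigma>' i" for i
  proof (cases "1 \<le> i \<and> i \<le> J")
    case True
    then have "i \<in> set [1..<Suc J]" by auto
    then show ?thesis using b by (simp only: map_eq_conv) 
  next
    case False
    have "buf_ok (phase (total \<sigma>)) i (bufs \<sigma> i)" "buf_ok (phase (total \<sigma>')) i (bufs \<sigma>' i)"
      using g by (auto simp: good_def)
    then show ?thesis using False by (auto simp: buf_ok_def)
  qed
  then show ?thesis using h m by (intro cstate.expand) auto
qed

definition dec_state :: "word list \<Rightarrow> cstate" where
  "dec_state w = (SOME \<sigma>. good \<sigma> \<and> enc_state \<sigma> = w)"

lemma dec_enc_state: "good \<sigma> \<Longrightarrow> dec_state (enc_state \<sigma>) = \<sigma>"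
  unfolding dec_state_def by (rule some_equality) (auto intro: enc_state_inj)

definition word_counter :: counter where
  "word_counter = \<lparr> init = return_pmf (enc_state start),
     update = (\<lambda>l w. map_pmf enc_state (step (snd l) (dec_state w))),
     estimate = (\<lambda>t w. real (est True t (dec_state w))) \<rparr>"

text \<open>All reachable states are good, so decoding recovers them.\<close>

lemma run_word_counter: "run word_counter ls = map_pmf enc_state (counting (map snd ls))"
proof (induction ls rule: rev_induct)
  case Nil
  show ?case by (simp add: run_def word_counter_def)
next
  case (snoc l ls)
  have "run word_counter (ls @ [l]) =
      bind_pmf (counting (map snd ls)) (\<lambda>\<sigma>. map_pmf enc_state (step (snd l) (dec_state (enc_state \<sigma>))))"
    by (simp only: run_snoc snoc.IH) (simp add: bind_map_pmf word_counter_def)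
  also have "\<dots> = bind_pmf (counting (map snd ls)) (\<lambda>\<sigma>. map_pmf enc_state (step (snd l) \<sigma>))"
    using counting_support by (intro bind_pmf_cong) (auto simp: dec_enc_state)
  finally show ?case by (simp add: map_bind_pmf)
qed

lemma word_counter_accurate:
  assumes "inserted_by t ls"
  shows "measure_pmf.prob (run word_counter ls)
    {w. \<bar>estimate word_counter t w - real (active_count t ls)\<bar> \<le> 2 * length ls / 2 ^ J} \<ge> 1 - 2 * exp (- (2 ^ ell / 12))"
proof -
  let ?p = "counting (map snd ls)"
  have "measure_pmf.prob (run word_counter ls)
      {w. \<bar>estimate word_counter t w - real (active_count t ls)\<bar> \<le> 2 * length ls / 2 ^ J} =
    measure_pmf.prob ?p {\<sigma>. \<bar>estimate word_counter t (enc_state \<sigma>) - real (active_count t ls)\<bar> \<le> 2 * length ls / 2 ^ J}"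
    by (simp add: run_word_counter vimage_def)
  also have "\<dots> = measure_pmf.prob ?p
      {\<sigma>. \<bar>real (est True t \<sigma>) - tally True t (map snd ls)\<bar> \<le> 2 * length (map snd ls) / 2 ^ J}"
    by (intro measure_pmf.finite_measure_eq_AE)
      (auto simp: AE_measure_pmf_iff word_counter_def dec_enc_state active_count_tally[OF assms] dest!: counting_support)
  finally show ?thesis using counting_accurate[of "map snd ls" t] by simp
qed

text \<open>A buffered time takes two words including its flag, and the capacities sum to less than
  \<open>8 * 2 ^ J\<close>; a marker takes five words.\<close>

lemma length_enc_state:
  assumes g: "good \<sigma>"
  shows "length (enc_state \<sigma>) \<le> 160 * (ell + 1) * 2 ^ J"
proof -
  have b: "length (bufs \<sigma> i) \<le> 8 * 2 ^ (J - i)" for i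
  proof -
    have "buf_ok (phase (total \<sigma>)) i (bufs \<sigma> i)" using g by (simp add: good_def)
    then show ?thesis by (auto simp: buf_ok_def cap_def split: if_splits)
  qed
  have l1: "length (enc_list (\<lambda>x. [enc_time x]) b) = 2 * length b + 1" for b
    by (simp add: length_enc_list sum_list_triv)
  have "length (enc_list (enc_list (\<lambda>x. [enc_time x])) (map (bufs \<sigma>) [1..<Suc J])) =
      (\<Sum>i\<leftarrow>[1..<Suc J]. 2 * length (bufs \<sigma> i) + 2) + 1"
    by (subst length_enc_list) (simp add: l1 o_def del: upt_Suc)
  also have "(\<Sum>i\<leftarrow>[1..<Suc J]. 2 * length (bufs \<sigma> i) + 2) \<le> (\<Sum>i\<leftarrow>[1..<Suc J]. 16 * 2 ^ (J - i) + 2)"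
  proof (rule sum_list_mono)
    fix i show "2 * length (bufs \<sigma> i) + 2 \<le> 16 * 2 ^ (J - i) + 2" using b[of i] by simp
  qed
  also have "\<dots> = 16 * (\<Sum>i\<leftarrow>[1..<Suc J]. 2 ^ (J - i)) + 2 * J"
    by (subst sum_list_addf, subst sum_list_const_mult) (simp add: sum_list_triv del: upt_Suc)
  finally have B: "length (enc_list (enc_list (\<lambda>x. [enc_time x])) (map (bufs \<sigma>) [1..<Suc J])) \<le> 16 * 2 ^ J + 2 * J + 1"
    using sum_list_pow2[of J] by linarith
  have "length (enc_list enc_marker (marks \<sigma>)) = 5 * length (marks \<sigma>) + 1"
    by (simp add: length_enc_list enc_marker_def sum_list_triv)
  then have "length (enc_state \<sigma>) \<le> 16 * 2 ^ J + 2 * J + 5 * max_marks + 5"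
    using B g by (simp add: enc_state_def good_def del: upt_Suc)
  moreover have "J < 2 ^ J" by (rule less_exp)
  moreover have "5 * max_marks = (130 + 40 * ell) * 2 ^ J" by (simp add: max_marks_def algebra_simps)
  moreover have "160 * (ell + 1) * 2 ^ J = 16 * 2 ^ J + 2 * 2 ^ J + (130 + 40 * ell) * 2 ^ J + (12 + 120 * ell) * 2 ^ J"
    by (simp add: algebra_simps)
  moreover have "5 \<le> (12 + 120 * ell) * (2 ^ J :: nat)"
    using mult_le_mono[of 5 "12 + 120 * ell" 1 "2 ^ J"] by simp
  ultimately show ?thesis by linarith
qed

lemma storable_enc_state:
  assumes \<sigma>: "\<sigma> \<in> set_pmf (counting es)" and len: "length es \<le> length xs"
    and es: "\<And>e. e \<in> set es \<Longrightarrow> \<exists>x s. (x, s, e) \<in> set xs" and w: "w \<in> set (enc_state \<sigma>)"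
  shows "storable 2 U xs w"
proof -
  note S = counting_support[OF \<sigma>]
  have v: "valid J birth_weight (total \<sigma>) (total \<sigma>) (marks \<sigma>)" using S by (simp add: good_def)
  have n: "total \<sigma> + fill \<sigma> \<le> length xs" using S len by (simp add: items_def)
  have time: "storable 2 U xs (enc_time \<tau>)" if "\<tau> \<in> stored \<sigma>" for \<tau>
    using S that es by (intro storable_enc_time[of _ "set es"]) auto
  \<comment> \<open>At threshold 0 the mass bound of \<open>valid\<close> covers all markers, so
    each of their counters is at most \<open>total\<close>.\<close>
  have "0 \<in> thresholds (total \<sigma>)"
  proof -
    have "total \<sigma> < 2 * 2 ^ total \<sigma>" using less_exp[of "total \<sigma>"] by linarith
    then show ?thesis using threshold_zero unfolding thresholds_def by (metis insertI2 rangeI)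
  qed
  then have "mass_since lmass 0 (marks \<sigma>) + 0 \<le> total \<sigma> \<and> mass_since rmass 0 (marks \<sigma>) + 0 \<le> total \<sigma>"
    using v unfolding valid_def by blast
  then have mass: "sum_list (map lmass (marks \<sigma>)) \<le> total \<sigma>" "sum_list (map rmass (marks \<sigma>)) \<le> total \<sigma>"
    by (simp_all add: mass_since_def)
  have marker: "storable 2 U xs w" if z: "z \<in> set (marks \<sigma>)" and w: "w \<in> set (enc_marker z)" for z w
  proof -
    have "birth z \<le> total \<sigma>" using v z unfolding valid_def by blast
    moreover have "lmass z \<le> total \<sigma>" "rmass z \<le> total \<sigma>"
      using member_le_sum_list[of "lmass z" "map lmass (marks \<sigma>)"] member_le_sum_list[of "rmass z" "map rmass (marks \<sigma>)"] mass z
      by auto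
    moreover have "place z \<in> stored \<sigma>" using z by (auto simp: stored_def)
    ultimately show ?thesis
      using w n by (auto simp: enc_marker_def simp del: storable.simps intro!: storable_counter time)
  qed
  have buf: "storable 2 U xs w" if "w \<in> set (enc_list (\<lambda>x. [enc_time x]) (bufs \<sigma> i))" for i w
    using that subsetD[OF set_enc_list that]
    by (auto simp del: storable.simps intro!: storable_counter time simp: stored_def)
  have head: "w \<in> {CounterWord (total \<sigma>), CounterWord (fill \<sigma>), enc_time (held \<sigma>)} \<Longrightarrow> storable 2 U xs w"
    using n by (auto simp del: storable.simps intro!: storable_counter time simp: stored_def)
  have flag: "w \<in> {CounterWord 0, CounterWord 1} \<Longrightarrow> storable 2 U xs w"
    by (auto simp del: storable.simps intro!: storable_counter)
  from w consider "w \<in> {CounterWord (total \<sigma>), CounterWord (fill \<sigma>), enc_time (held \<sigma>)}"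
    | "w \<in> set (enc_list (enc_list (\<lambda>x. [enc_time x])) (map (bufs \<sigma>) [1..<Suc J]))"
    | "w \<in> set (enc_list enc_marker (marks \<sigma>))"
    by (auto simp: enc_state_def simp del: upt_Suc)
  then show ?thesis
  proof cases
    case 1 then show ?thesis by (rule head)
  next
    case 2
    from subsetD[OF set_enc_list 2] show ?thesis using flag buf by (auto simp del: upt_Suc storable.simps)
  next
    case 3
    from subsetD[OF set_enc_list 3] show ?thesis using flag marker by (auto simp del: storable.simps)
  qed
qed

end

section \<open>Count-Min sketches\<close>

lemma prob_bind_pmf:
  "measure_pmf.prob (bind_pmf M f) X = measure_pmf.expectation M (\<lambda>x. measure_pmf.prob (f x) X)"
proof -
  have "ennreal (measure_pmf.prob (bind_pmf M f) X) = (\<integral>\<^sup>+x. ennreal (measure_pmf.prob (f x) X) \<partial>measure_pmf M)"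
    by (simp flip: measure_pmf.emeasure_eq_measure)
  also have "\<dots> = ennreal (measure_pmf.expectation M (\<lambda>x. measure_pmf.prob (f x) X))"
    by (intro nn_integral_eq_integral measure_pmf.integrable_const_bound[of _ 1]) auto
  finally show ?thesis by (simp add: integral_nonneg)
qed

lemma prob_pair_pmf_Times:
  "measure_pmf.prob (pair_pmf p q) (A \<times> B) = measure_pmf.prob p A * measure_pmf.prob q B"
proof -
  have "pair_pmf p q = bind_pmf p (\<lambda>a. map_pmf (Pair a) q)" by (simp add: pair_pmf_def map_pmf_def)
  then have "measure_pmf.prob (pair_pmf p q) (A \<times> B) =
      measure_pmf.expectation p (\<lambda>a. measure_pmf.prob q (Pair a -` (A \<times> B)))"
    by (simp add: prob_bind_pmf)
  also have "\<dots> = measure_pmf.expectation p (\<lambda>a. indicator A a * measure_pmf.prob q B)"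
    by (intro Bochner_Integration.integral_cong) (auto simp: indicator_def)
  finally show ?thesis by simp
qed

lemma draw_all_Cons:
  "draw_all (p # ps) = bind_pmf p (\<lambda>y. bind_pmf (draw_all ps) (\<lambda>ys. return_pmf (y # ys)))"
  by (simp add: pair_pmf_def map_bind_pmf)

text \<open>Fresh coins applied to each component separately keep the components independent;
  commuting the draws regroups them by component.\<close>

lemma bind_draw_all:
  "bind_pmf (draw_all ps) (\<lambda>ys. draw_all (map f ys)) = draw_all (map (\<lambda>p. bind_pmf p f) ps)"
proof (induction ps)
  case Nil
  then show ?case by (simp add: bind_return_pmf)
next
  case (Cons p ps)
  have "bind_pmf (draw_all (p # ps)) (\<lambda>ys. draw_all (map f ys)) =
      bind_pmf p (\<lambda>y. bind_pmf (draw_all ps) (\<lambda>ys. bind_pmf (f y) (\<lambda>z. bind_pmf (draw_all (map f ys)) (\<lambda>zs. return_pmf (z # zs)))))"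
    by (simp only: draw_all_Cons bind_assoc_pmf bind_return_pmf list.map)
  also have "\<dots> = bind_pmf p (\<lambda>y. bind_pmf (f y) (\<lambda>z. bind_pmf (draw_all ps) (\<lambda>ys. bind_pmf (draw_all (map f ys)) (\<lambda>zs. return_pmf (z # zs)))))"
    by (subst bind_commute_pmf) (rule refl)
  also have "\<dots> = bind_pmf p (\<lambda>y. bind_pmf (f y) (\<lambda>z. bind_pmf (bind_pmf (draw_all ps) (\<lambda>ys. draw_all (map f ys))) (\<lambda>zs. return_pmf (z # zs))))"
    by (simp only: bind_assoc_pmf)
  also have "\<dots> = draw_all (map (\<lambda>p. bind_pmf p f) (p # ps))"
    by (simp only: Cons.IH draw_all_Cons bind_assoc_pmf list.map)
  finally show ?case .
qed

lemma bind_draw_all_update: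
  "i < length ps \<Longrightarrow> bind_pmf (draw_all ps) (\<lambda>ys. map_pmf (\<lambda>c. ys[i := c]) (f (ys ! i))) =
    draw_all (ps[i := bind_pmf (ps ! i) f])"
proof (induction ps arbitrary: i)
  case (Cons p ps)
  show ?case
  proof (cases i)
    case 0
    have "bind_pmf (draw_all (p # ps)) (\<lambda>ys. map_pmf (\<lambda>c. ys[i := c]) (f (ys ! i))) =
        bind_pmf p (\<lambda>y. bind_pmf (draw_all ps) (\<lambda>ys. bind_pmf (f y) (\<lambda>c. return_pmf (c # ys))))"
      by (simp add: 0 draw_all_Cons bind_assoc_pmf bind_return_pmf map_pmf_def del: draw_all.simps)
    also have "\<dots> = bind_pmf p (\<lambda>y. bind_pmf (f y) (\<lambda>c. bind_pmf (draw_all ps) (\<lambda>ys. return_pmf (c # ys))))"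
      by (subst bind_commute_pmf) (rule refl)
    also have "\<dots> = draw_all ((p # ps)[i := bind_pmf ((p # ps) ! i) f])"
      by (simp add: 0 draw_all_Cons bind_assoc_pmf del: draw_all.simps)
    finally show ?thesis .
  next
    case (Suc j)
    have "bind_pmf (draw_all (p # ps)) (\<lambda>ys. map_pmf (\<lambda>c. ys[i := c]) (f (ys ! i))) =
        bind_pmf p (\<lambda>y. bind_pmf (bind_pmf (draw_all ps) (\<lambda>ys. map_pmf (\<lambda>c. ys[j := c]) (f (ys ! j)))) (\<lambda>ys. return_pmf (y # ys)))"
      by (simp add: Suc draw_all_Cons bind_assoc_pmf bind_return_pmf map_pmf_def del: draw_all.simps)
    also have "\<dots> = draw_all ((p # ps)[i := bind_pmf ((p # ps) ! i) f])"
      using Cons by (simp add: Suc draw_all_Cons del: draw_all.simps)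
    finally show ?thesis .
  qed
qed simp

lemma map_nth_draw_all: "i < length ps \<Longrightarrow> map_pmf (\<lambda>ys. ys ! i) (draw_all ps) = ps ! i"
proof (induction ps arbitrary: i)
  case (Cons p ps)
  show ?case
  proof (cases i)
    case 0
    then show ?thesis
      by (simp add: draw_all_Cons map_bind_pmf bind_return_pmf' del: draw_all.simps)
  next
    case (Suc j)
    have "map_pmf (\<lambda>ys. ys ! i) (draw_all (p # ps)) = bind_pmf p (\<lambda>_. map_pmf (\<lambda>ys. ys ! j) (draw_all ps))"
      by (simp add: Suc draw_all_Cons map_bind_pmf map_pmf_def bind_assoc_pmf bind_return_pmf del: draw_all.simps)
    then show ?thesis using Cons by (simp add: Suc)
  qed
qed simp

lemma set_draw_all: "set_pmf (draw_all ps) = {ys. list_all2 (\<lambda>y p. y \<in> set_pmf p) ys ps}"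
  by (induction ps) (auto simp: list_all2_Cons2 image_iff)

lemma prob_draw_all:
  "measure_pmf.prob (draw_all ps) {ys. \<forall>y\<in>set ys. P y} = (\<Prod>p\<leftarrow>ps. measure_pmf.prob p {y. P y})"
proof (induction ps)
  case (Cons p ps)
  have "measure_pmf.prob (draw_all (p # ps)) {ys. \<forall>y\<in>set ys. P y} =
      measure_pmf.prob (pair_pmf p (draw_all ps)) ({y. P y} \<times> {ys. \<forall>y\<in>set ys. P y})"
    by (simp add: vimage_def) (rule arg_cong2[where f = measure], auto)
  then show ?case using Cons by (simp add: prob_pair_pmf_Times)
qed simp

lemma prob_draw_all_union:
  "measure_pmf.prob (draw_all ps) {ys. \<exists>y\<in>set ys. P y} \<le> (\<Sum>p\<leftarrow>ps. measure_pmf.prob p {y. P y})"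
proof (induction ps)
  case (Cons p ps)
  let ?q = "pair_pmf p (draw_all ps)"
  have "measure_pmf.prob (draw_all (p # ps)) {ys. \<exists>y\<in>set ys. P y} =
      measure_pmf.prob ?q (fst -` {y. P y} \<union> snd -` {ys. \<exists>y\<in>set ys. P y})"
    by (simp add: vimage_def) (rule arg_cong2[where f = measure], auto)
  also have "\<dots> \<le> measure_pmf.prob ?q (fst -` {y. P y}) + measure_pmf.prob ?q (snd -` {ys. \<exists>y\<in>set ys. P y})"
    by (intro measure_Un_le) auto
  also have "\<dots> = measure_pmf.prob (map_pmf fst ?q) {y. P y} + measure_pmf.prob (map_pmf snd ?q) {ys. \<exists>y\<in>set ys. P y}"
    by (simp only: measure_map_pmf)
  also have "\<dots> = measure_pmf.prob p {y. P y} + measure_pmf.prob (draw_all ps) {ys. \<exists>y\<in>set ys. P y}"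
    by (simp only: map_fst_pair_pmf map_snd_pair_pmf)
  finally show ?case using Cons by simp
qed simp

section \<open>Distribution of the rows\<close>

definition cell_lifetimes :: "(nat \<Rightarrow> nat) \<Rightarrow> nat \<Rightarrow> item list \<Rightarrow> lifetime list" where
  "cell_lifetimes hg c xs = map snd (filter (\<lambda>x. hg (fst x) = c) xs)"

definition row :: "nat \<Rightarrow> word list pmf \<Rightarrow> (word list \<Rightarrow> nat \<Rightarrow> nat) \<Rightarrow> counter \<Rightarrow> item list \<Rightarrow>
    (word list \<times> word list list) pmf" where
  "row w G h K xs = bind_pmf G (\<lambda>g. map_pmf (Pair g)
     (draw_all (map (\<lambda>c. run K (cell_lifetimes (h g) c xs)) [0..<w])))"

text \<open>An update treats the rows separately with fresh coins, so they stay independent, and so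
  do the cells of a row given its hash function. Hash values have to be below \<open>w\<close>,
  since a list update out of range would lose the item.\<close>

lemma run_count_min:
  assumes h: "\<And>g x. g \<in> set_pmf G \<Longrightarrow> x \<in> set xs \<Longrightarrow> h g (fst x) < w"
  shows "run (count_min d w G h K) xs = draw_all (replicate d (row w G h K xs))"
  using h
proof (induction xs rule: rev_induct)
  case Nil
  have "row w G h K [] = pair_pmf G (draw_all (replicate w (init K)))"
    by (simp add: row_def cell_lifetimes_def run_def pair_pmf_def map_pmf_def map_replicate_const)
  then show ?case by (simp add: run_def count_min_def)
next
  case (snoc y xs)
  obtain x l where y: "y = (x, l)" by (cases y)
  define F where "F = (\<lambda>(g, cells). map_pmf (\<lambda>c. (g, cells[h g x := c])) (update K l (cells ! h g x)))"
  have "run (count_min d w G h K) (xs @ [y]) = bind_pmf (draw_all (replicate d (row w G h K xs))) (\<lambda>st. draw_all (map F st))"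
    using snoc by (simp add: run_snoc y F_def count_min_def)
  also have "\<dots> = draw_all (replicate d (bind_pmf (row w G h K xs) F))"
    by (simp add: bind_draw_all)
  also have "bind_pmf (row w G h K xs) F = row w G h K (xs @ [y])"
    unfolding row_def bind_assoc_pmf
  proof (rule bind_pmf_cong[OF refl])
    fix g assume g: "g \<in> set_pmf G"
    let ?ps = "map (\<lambda>c. run K (cell_lifetimes (h g) c xs)) [0..<w]"
    have i: "h g x < length ?ps" using snoc.prems[OF g, of y] by (simp add: y)
    have "bind_pmf (map_pmf (Pair g) (draw_all ?ps)) F =
        map_pmf (Pair g) (bind_pmf (draw_all ?ps) (\<lambda>ys. map_pmf (\<lambda>c. ys[h g x := c]) (update K l (ys ! h g x))))"
      by (simp add: F_def bind_map_pmf map_bind_pmf pmf.map_comp o_def)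
    also have "\<dots> = map_pmf (Pair g) (draw_all (?ps[h g x := bind_pmf (?ps ! h g x) (update K l)]))"
      by (subst bind_draw_all_update[OF i]) (rule refl)
    also have "?ps[h g x := bind_pmf (?ps ! h g x) (update K l)] =
        map (\<lambda>c. run K (cell_lifetimes (h g) c (xs @ [y]))) [0..<w]"
      using i by (intro nth_equalityI) (auto simp: nth_list_update cell_lifetimes_def y run_snoc)
    finally show "bind_pmf (map_pmf (Pair g) (draw_all ?ps)) F =
        map_pmf (Pair g) (draw_all (map (\<lambda>c. run K (cell_lifetimes (h g) c (xs @ [y]))) [0..<w]))" .
  qed
  finally show ?case .
qed

lemma prob_row:
  assumes "\<And>g. g \<in> set_pmf G \<Longrightarrow> h g q < w"
  shows "measure_pmf.prob (row w G h K xs) {(g, cells). P (cells ! h g q)} =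
    measure_pmf.expectation G (\<lambda>g. measure_pmf.prob (run K (cell_lifetimes (h g) (h g q) xs)) {s. P s})"
proof -
  have "measure_pmf.prob (row w G h K xs) {(g, cells). P (cells ! h g q)} =
    measure_pmf.expectation G (\<lambda>g. measure_pmf.prob (map_pmf (Pair g)
     (draw_all (map (\<lambda>c. run K (cell_lifetimes (h g) c xs)) [0..<w]))) {(g, cells). P (cells ! h g q)})"
    unfolding row_def by (rule prob_bind_pmf)
  also have "\<dots> = measure_pmf.expectation G (\<lambda>g. measure_pmf.prob (run K (cell_lifetimes (h g) (h g q) xs)) {s. P s})"
  proof (rule integral_cong_AE)
    show "AE g in measure_pmf G. measure_pmf.prob (map_pmf (Pair g)
       (draw_all (map (\<lambda>c. run K (cell_lifetimes (h g) c xs)) [0..<w]))) {(g, cells). P (cells ! h g q)} =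
      measure_pmf.prob (run K (cell_lifetimes (h g) (h g q) xs)) {s. P s}"
      unfolding AE_measure_pmf_iff
    proof
      fix g assume g: "g \<in> set_pmf G"
      let ?ps = "map (\<lambda>c. run K (cell_lifetimes (h g) c xs)) [0..<w]"
      have i: "h g q < length ?ps" using assms[OF g] by simp
      have "measure_pmf.prob (map_pmf (Pair g) (draw_all ?ps)) {(g, cells). P (cells ! h g q)} =
          measure_pmf.prob (map_pmf (\<lambda>ys. ys ! h g q) (draw_all ?ps)) {s. P s}"
        by (simp add: vimage_def)
      also have "\<dots> = measure_pmf.prob (run K (cell_lifetimes (h g) (h g q) xs)) {s. P s}"
        unfolding map_nth_draw_all[OF i] using i by simp
      finally show "measure_pmf.prob (map_pmf (Pair g) (draw_all ?ps)) {(g, cells). P (cells ! h g q)} =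
        measure_pmf.prob (run K (cell_lifetimes (h g) (h g q) xs)) {s. P s}" .
    qed
  qed simp_all
  finally show ?thesis .
qed

section \<open>Collisions and accuracy\<close>

lemma hash_less:
  assumes "pairwise_independent_hashing U w G h" "0 < w" "x \<in> {1..U}" "g \<in> set_pmf G"
  shows "h g x < w"
proof -
  have "map_pmf (\<lambda>g. h g x) G = pmf_of_set {..<w}"
    using assms by (simp add: pairwise_independent_hashing_def)
  then have "set_pmf (map_pmf (\<lambda>g. h g x) G) = {..<w}" using assms(2) by (simp add: set_pmf_of_set lessThan_empty_iff)
  then show ?thesis using assms(4) by auto
qed

lemma prob_collision:
  assumes H: "pairwise_independent_hashing U w G h" and w: "0 < w"
    and x: "x \<in> {1..U}" "y \<in> {1..U}" "x \<noteq> y"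
  shows "measure_pmf.prob G {g. h g x = h g y} = 1 / w"
proof -
  have val: "measure_pmf.prob G {g. h g z = c} = 1 / w" if "z \<in> {1..U}" "c < w" for z c
  proof -
    have "map_pmf (\<lambda>g. h g z) G = pmf_of_set {..<w}" using H that by (simp add: pairwise_independent_hashing_def)
    then have "pmf (map_pmf (\<lambda>g. h g z) G) c = 1 / w"
      using w that by (simp add: lessThan_empty_iff indicator_def)
    then show ?thesis by (simp add: pmf_map vimage_def)
  qed
  have ind: "prob_space.indep_var (measure_pmf G) (count_space UNIV) (\<lambda>g. h g x) (count_space UNIV) (\<lambda>g. h g y)"
    using H x by (simp add: pairwise_independent_hashing_def)
  have joint: "measure_pmf.prob G {g. h g x = c \<and> h g y = c} = (1 / w) * (1 / w)" if "c < w" for c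
    using prob_space.indep_varD[OF measure_pmf.prob_space_axioms ind, of "{c}" "{c}"] val[OF x(1) that] val[OF x(2) that]
    by (simp add: vimage_def)
  have "measure_pmf.prob G {g. h g x = h g y} = measure_pmf.prob G (\<Union>c\<in>{..<w}. {g. h g x = c \<and> h g y = c})"
    by (intro measure_pmf.finite_measure_eq_AE)
      (auto simp: AE_measure_pmf_iff intro: hash_less[OF H w x(2)])
  also have "\<dots> = (\<Sum>c<w. measure_pmf.prob G {g. h g x = c \<and> h g y = c})"
    by (intro measure_pmf.finite_measure_finite_Union) (auto simp: disjoint_family_on_def)
  also have "\<dots> = (\<Sum>c<w. (1 / w) * (1 / w))" by (intro sum.cong) (simp_all add: joint)
  also have "\<dots> = 1 / w" using w by simp
  finally show ?thesis .
qed

text \<open>All inserted items count, active or not, which makes the bound independent of the query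
  time.\<close>

definition collisions :: "(nat \<Rightarrow> nat) \<Rightarrow> nat \<Rightarrow> item list \<Rightarrow> nat" where
  "collisions hg q xs = length (filter (\<lambda>x. fst x \<noteq> q \<and> hg (fst x) = hg q) xs)"

lemma expectation_collisions:
  assumes H: "pairwise_independent_hashing U w G h" and w: "0 < w"
    and xs: "fst ` set xs \<subseteq> {1..U}" and q: "q \<in> {1..U}"
  shows "measure_pmf.expectation G (\<lambda>g. real (collisions (h g) q xs)) \<le> length xs / w"
    "integrable (measure_pmf G) (\<lambda>g. real (collisions (h g) q xs))"
proof -
  show int: "integrable (measure_pmf G) (\<lambda>g. real (collisions (h g) q ys))" for ys
    by (rule measure_pmf.integrable_const_bound[of _ "length ys"]) (auto simp: collisions_def)
  show "measure_pmf.expectation G (\<lambda>g. real (collisions (h g) q xs)) \<le> length xs / w"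
    using xs
  proof (induction xs)
    case Nil
    then show ?case by (simp add: collisions_def)
  next
    case (Cons x xs)
    let ?I = "\<lambda>g. indicator {g. fst x \<noteq> q \<and> h g (fst x) = h g q} g :: real"
    have "(\<lambda>g. real (collisions (h g) q (x # xs))) = (\<lambda>g. ?I g + real (collisions (h g) q xs))"
      by (auto simp: collisions_def indicator_def)
    then have "measure_pmf.expectation G (\<lambda>g. real (collisions (h g) q (x # xs))) =
        measure_pmf.prob G {g. fst x \<noteq> q \<and> h g (fst x) = h g q} +
        measure_pmf.expectation G (\<lambda>g. real (collisions (h g) q xs))"
      using int by (simp only:) (subst Bochner_Integration.integral_add, auto intro!: measure_pmf.integrable_const_bound[of _ 1])
    also have "measure_pmf.prob G {g. fst x \<noteq> q \<and> h g (fst x) = h g q} \<le> 1 / w"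
      using prob_collision[OF H w, of "fst x" q] Cons.prems q by (cases "fst x = q") auto
    finally show ?case using Cons by (simp add: add_divide_distrib)
  qed
qed

lemma cell_bounds:
  shows "frequency t xs q \<le> active_count t (cell_lifetimes hg (hg q) xs)"
    "active_count t (cell_lifetimes hg (hg q) xs) \<le> frequency t xs q + collisions hg q xs"
  by (induction xs) (auto simp: frequency_def active_count_def cell_lifetimes_def collisions_def)

lemma length_cell_lifetimes: "length (cell_lifetimes hg c xs) \<le> length xs"
  by (simp add: cell_lifetimes_def)

lemma valid_lifetimes_cell:
  "valid_lifetimes (map snd xs) \<Longrightarrow> valid_lifetimes (cell_lifetimes hg c xs)"
  unfolding valid_lifetimes_def cell_lifetimes_def
  using sorted_filter[of "fst \<circ> snd" xs] by auto

text \<open>The error budget is halved between counter and collisions. The expected number of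
  collisions is at most \<open>\<epsilon> * n / 8\<close>, so by Markov it exceeds
  \<open>\<epsilon> * n / 2\<close> with probability at most 1/4; the failure of the counter adds
  another 1/4. All \<open>d\<close> rows must overestimate to spoil the minimum, whereas one
  underestimate suffices, whence \<open>(1 / 2) ^ d\<close> and \<open>d * \<gamma>\<close>.\<close>

lemma count_min_accurate:
  assumes eps: "0 < \<epsilon>" and d: "0 < d" and w: "8 \<le> \<epsilon> * w"
    and H: "pairwise_independent_hashing U w G h"
    and K: "approximate_counter (\<epsilon> / 2) \<gamma> K" and \<gamma>: "\<gamma> \<le> 1 / 4"
    and xs: "general_expiration_stream U xs" and t: "inserted_by t (map snd xs)" and q: "q \<in> {1..U}"
  shows "measure_pmf.prob (run (count_min d w G h K) xs)
     {st. \<bar>estimate (count_min d w G h K) (t, q) st - real (frequency t xs q)\<bar> \<le> \<epsilon> * real (length xs)}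
    \<ge> 1 - (d * \<gamma> + (1 / 2) ^ d)"
proof -
  define n where "n = real (length xs)"
  define f where "f = real (frequency t xs q)"
  define R where "R = row w G h K xs"
  define e where "e = (\<lambda>(g, cells). estimate K t (cells ! h g q))"
  have w0: "0 < w" using w by (cases w) auto
  have dom: "fst ` set xs \<subseteq> {1..U}" and v: "valid_lifetimes (map snd xs)"
    using xs by (auto simp: general_expiration_stream_def)
  have hl: "h g x < w" if "g \<in> set_pmf G" "x \<in> {1..U}" for g x using hash_less[OF H w0] that by blast
  have run: "run (count_min d w G h K) xs = draw_all (replicate d R)"
    unfolding R_def by (rule run_count_min) (use hl dom in force)
  let ?ls = "\<lambda>g. cell_lifetimes (h g) (h g q) xs"
  let ?bad = "\<lambda>g. {s. \<not> \<bar>estimate K t s - real (active_count t (?ls g))\<bar> \<le> \<epsilon> / 2 * real (length (?ls g))}"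
  have bad: "measure_pmf.prob (run K (?ls g)) (?bad g) \<le> \<gamma>" for g
  proof -
    have "inserted_by t (?ls g)" using t by (auto simp: inserted_by_def cell_lifetimes_def)
    moreover have "valid_lifetimes (?ls g)" using v by (rule valid_lifetimes_cell)
    ultimately have "1 - \<gamma> \<le> measure_pmf.prob (run K (?ls g)) (- ?bad g)"
      using K by (simp add: approximate_counter_def Compl_eq)
    then show ?thesis using measure_pmf.prob_compl[of "?bad g" "run K (?ls g)"] by (simp add: Compl_eq_Diff_UNIV)
  qed
  have good: "f - \<epsilon> * n \<le> estimate K t s" "estimate K t s \<le> f + \<epsilon> / 2 * n + collisions (h g) q xs"
    if "s \<notin> ?bad g" for s g
  proof -
    have "\<bar>estimate K t s - real (active_count t (?ls g))\<bar> \<le> \<epsilon> / 2 * real (length (?ls g))" using that by simp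
    also have "\<dots> \<le> \<epsilon> / 2 * n" using eps length_cell_lifetimes[of "h g" "h g q" xs] by (simp add: n_def)
    finally have "\<bar>estimate K t s - real (active_count t (?ls g))\<bar> \<le> \<epsilon> / 2 * n" .
    moreover have "f \<le> active_count t (?ls g)" using cell_bounds(1)[of t xs q "h g"] by (simp add: f_def)
    moreover have "real (active_count t (?ls g)) \<le> f + collisions (h g) q xs"
      using cell_bounds(2)[of t "h g" q xs] unfolding f_def of_nat_add[symmetric] of_nat_le_iff .
    moreover have "\<epsilon> / 2 * n \<le> \<epsilon> * n" using eps by (intro mult_right_mono) (auto simp: n_def)
    ultimately show "f - \<epsilon> * n \<le> estimate K t s" "estimate K t s \<le> f + \<epsilon> / 2 * n + collisions (h g) q xs"
      by linarith+
  qed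
  have low: "measure_pmf.prob R {r. e r < f - \<epsilon> * n} \<le> \<gamma>"
  proof -
    have "measure_pmf.prob R {r. e r < f - \<epsilon> * n} = measure_pmf.expectation G
        (\<lambda>g. measure_pmf.prob (run K (?ls g)) {s. estimate K t s < f - \<epsilon> * n})"
      unfolding R_def e_def using prob_row[of G h q w K xs "\<lambda>s. estimate K t s < f - \<epsilon> * n"] hl q
      by (simp add: case_prod_beta')
    also have "\<dots> \<le> measure_pmf.expectation G (\<lambda>_. \<gamma>)"
    proof (intro integral_mono_AE)
      show "AE g in measure_pmf G. measure_pmf.prob (run K (?ls g)) {s. estimate K t s < f - \<epsilon> * n} \<le> \<gamma>"
      proof (intro AE_I2)
        fix g
        have "{s. estimate K t s < f - \<epsilon> * n} \<subseteq> ?bad g" using good(1)[of _ g] by fastforce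
        then have "measure_pmf.prob (run K (?ls g)) {s. estimate K t s < f - \<epsilon> * n} \<le> measure_pmf.prob (run K (?ls g)) (?bad g)"
          by (intro measure_pmf.finite_measure_mono) auto
        then show "measure_pmf.prob (run K (?ls g)) {s. estimate K t s < f - \<epsilon> * n} \<le> \<gamma>"
          using bad[of g] by (rule order_trans)
      qed
    qed (auto intro!: measure_pmf.integrable_const_bound[of _ 1])
    finally show ?thesis by simp
  qed
  have high: "measure_pmf.prob R {r. f + \<epsilon> * n < e r} \<le> 1 / 2"
  proof -
    let ?C = "{g. \<epsilon> / 2 * n < collisions (h g) q xs}"
    have "measure_pmf.prob R {r. f + \<epsilon> * n < e r} = measure_pmf.expectation G
        (\<lambda>g. measure_pmf.prob (run K (?ls g)) {s. f + \<epsilon> * n < estimate K t s})"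
      unfolding R_def e_def using prob_row[of G h q w K xs "\<lambda>s. f + \<epsilon> * n < estimate K t s"] hl q
      by (simp add: case_prod_beta')
    also have "\<dots> \<le> measure_pmf.expectation G (\<lambda>g. \<gamma> + indicator ?C g)"
    proof (intro integral_mono_AE)
      show "AE g in measure_pmf G. measure_pmf.prob (run K (?ls g)) {s. f + \<epsilon> * n < estimate K t s} \<le> \<gamma> + indicator ?C g"
      proof (intro AE_I2)
        fix g
        show "measure_pmf.prob (run K (?ls g)) {s. f + \<epsilon> * n < estimate K t s} \<le> \<gamma> + indicator ?C g"
        proof (cases "g \<in> ?C")
          case True
          have "0 \<le> \<gamma>" using bad[of g] measure_nonneg order_trans by blast
          then show ?thesis using True by (simp add: add_increasing)
        next
          case False
          have "{s. f + \<epsilon> * n < estimate K t s} \<subseteq> ?bad g"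
          proof
            fix s assume "s \<in> {s. f + \<epsilon> * n < estimate K t s}"
            then show "s \<in> ?bad g" using good(2)[of s g] False by (smt (verit) field_sum_of_halves mem_Collect_eq distrib_right)
          qed
          then have "measure_pmf.prob (run K (?ls g)) {s. f + \<epsilon> * n < estimate K t s} \<le> measure_pmf.prob (run K (?ls g)) (?bad g)"
            by (intro measure_pmf.finite_measure_mono) auto
          then show ?thesis using bad[of g] False by simp
        qed
      qed
    qed (auto intro!: measure_pmf.integrable_const_bound[of _ 1] Bochner_Integration.integrable_add)
    also have "\<dots> = \<gamma> + measure_pmf.prob G ?C"
      by (simp add: Bochner_Integration.integral_add measure_pmf.integrable_const_bound[of _ 1])
    also have "measure_pmf.prob G ?C \<le> 1 / 4"
    proof (cases "xs = []")
      case True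
      then show ?thesis by (simp add: collisions_def n_def)
    next
      case False
      then have n: "0 < n" by (simp add: n_def)
      have "measure_pmf.prob G ?C \<le> measure_pmf.prob G {g. \<epsilon> / 2 * n \<le> collisions (h g) q xs}"
        by (intro measure_pmf.finite_measure_mono) auto
      also have "\<dots> \<le> measure_pmf.expectation G (\<lambda>g. real (collisions (h g) q xs)) / (\<epsilon> / 2 * n)"
        using integral_Markov_inequality_measure[where A = "{}" and M = "measure_pmf G"
            and u = "\<lambda>g. real (collisions (h g) q xs)" and c = "\<epsilon> / 2 * n"]
          expectation_collisions(2)[OF H w0 dom q] eps n by simp
      also have "\<dots> \<le> (n / w) / (\<epsilon> / 2 * n)"
        using expectation_collisions(1)[OF H w0 dom q] eps n by (intro divide_right_mono) (auto simp: n_def)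
      also have "\<dots> = 2 / (\<epsilon> * w)" using n by simp
      also have "\<dots> \<le> 2 / 8" using w by (intro divide_left_mono) auto
      finally show ?thesis by simp
    qed
    finally show ?thesis using \<gamma> by simp
  qed
  let ?st = "draw_all (replicate d R)"
  let ?good = "{st. \<bar>estimate (count_min d w G h K) (t, q) st - f\<bar> \<le> \<epsilon> * n}"
  have "measure_pmf.prob ?st (- ?good) \<le>
      measure_pmf.prob ?st ({st. \<exists>r\<in>set st. e r < f - \<epsilon> * n} \<union> {st. \<forall>r\<in>set st. f + \<epsilon> * n < e r})"
  proof (intro measure_pmf.finite_measure_mono_AE)
    show "AE st in measure_pmf ?st. st \<in> - ?good \<longrightarrow>
        st \<in> {st. \<exists>r\<in>set st. e r < f - \<epsilon> * n} \<union> {st. \<forall>r\<in>set st. f + \<epsilon> * n < e r}"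
      unfolding AE_measure_pmf_iff
    proof (intro ballI impI, rule ccontr)
      fix st assume st: "st \<in> set_pmf ?st" and b: "st \<in> - ?good"
        and "st \<notin> {st. \<exists>r\<in>set st. e r < f - \<epsilon> * n} \<union> {st. \<forall>r\<in>set st. f + \<epsilon> * n < e r}"
      then have ge: "\<And>r. r \<in> set st \<Longrightarrow> f - \<epsilon> * n \<le> e r" and "\<exists>r\<in>set st. e r \<le> f + \<epsilon> * n"
        by (auto simp: not_less)
      then obtain r where r: "r \<in> set st" "e r \<le> f + \<epsilon> * n" by blast
      have "estimate (count_min d w G h K) (t, q) st = Min (e ` set st)" by (simp add: count_min_def e_def)
      moreover have "Min (e ` set st) \<le> e r" using r(1) by (intro Min_le) auto
      moreover have "f - \<epsilon> * n \<le> Min (e ` set st)" using r(1) ge by (subst Min_ge_iff) auto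
      ultimately show False using b r(2) by (auto simp: abs_le_iff)
    qed
  qed simp
  also have "\<dots> \<le> measure_pmf.prob ?st {st. \<exists>r\<in>set st. e r < f - \<epsilon> * n} +
      measure_pmf.prob ?st {st. \<forall>r\<in>set st. f + \<epsilon> * n < e r}"
    by (intro measure_Un_le) auto
  also have "measure_pmf.prob ?st {st. \<exists>r\<in>set st. e r < f - \<epsilon> * n} \<le> d * \<gamma>"
  proof -
    have "(\<Sum>p\<leftarrow>replicate d R. measure_pmf.prob p {r. e r < f - \<epsilon> * n}) \<le> d * \<gamma>"
      using low by (simp add: sum_list_replicate mult_left_mono)
    then show ?thesis using prob_draw_all_union[of "replicate d R" "\<lambda>r. e r < f - \<epsilon> * n"] by linarith
  qed
  also have "measure_pmf.prob ?st {st. \<forall>r\<in>set st. f + \<epsilon> * n < e r} \<le> (1 / 2) ^ d"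
    unfolding prob_draw_all using high by (simp add: power_mono)
  finally have "measure_pmf.prob ?st (- ?good) \<le> d * \<gamma> + (1 / 2) ^ d" by simp
  then show ?thesis unfolding run using measure_pmf.prob_compl[of ?good ?st]
    by (simp add: n_def f_def Compl_eq_Diff_UNIV)
qed

section \<open>Pairwise independent hashing\<close>

lemma indep_var_of_joint:
  assumes J: "map_pmf (\<lambda>g. (f g, k g)) G = pair_pmf P Q"
  shows "prob_space.indep_var (measure_pmf G) (count_space UNIV) f (count_space UNIV) k"
proof -
  have f: "map_pmf f G = P" using arg_cong[OF J, of "map_pmf fst"]
    by (simp add: pmf.map_comp o_def map_fst_pair_pmf)
  have k: "map_pmf k G = Q" using arg_cong[OF J, of "map_pmf snd"]
    by (simp add: pmf.map_comp o_def map_snd_pair_pmf)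
  have eq: "measure_pmf P \<Otimes>\<^sub>M measure_pmf Q = distr (measure_pmf G) (count_space UNIV \<Otimes>\<^sub>M count_space UNIV) (\<lambda>g. (f g, k g))"
  proof (rule pair_measure_eqI)
    fix A B
    have "emeasure (distr (measure_pmf G) (count_space UNIV \<Otimes>\<^sub>M count_space UNIV) (\<lambda>g. (f g, k g))) (A \<times> B) =
        emeasure (measure_pmf (map_pmf (\<lambda>g. (f g, k g)) G)) (A \<times> B)"
      by (subst emeasure_distr) (auto simp: space_pair_measure intro!: pair_measureI)
    then show "emeasure (measure_pmf P) A * emeasure (measure_pmf Q) B =
        emeasure (distr (measure_pmf G) (count_space UNIV \<Otimes>\<^sub>M count_space UNIV) (\<lambda>g. (f g, k g))) (A \<times> B)"
      unfolding J by (simp add: measure_pmf.emeasure_eq_measure prob_pair_pmf_Times ennreal_mult')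
  qed (auto intro!: measure_pmf.sigma_finite_measure_axioms sets_pair_measure_cong)
  have "distr (measure_pmf G) (count_space UNIV) f = measure_pmf P" "distr (measure_pmf G) (count_space UNIV) k = measure_pmf Q"
    using f k by (simp_all add: map_pmf_rep_eq[symmetric])
  then show ?thesis
    using eq by (subst prob_space.indep_var_distribution_eq[OF measure_pmf.prob_space_axioms]) simp
qed

lemma map_pmf_equivariant:
  assumes "bij_betw \<phi> I I" "finite I" "I \<noteq> {}" "inj \<tau>" "\<And>i. i \<in> I \<Longrightarrow> f (\<phi> i) = \<tau> (f i)"
  shows "pmf (map_pmf f (pmf_of_set I)) (\<tau> z) = pmf (map_pmf f (pmf_of_set I)) z"
proof -
  have "map_pmf f (pmf_of_set I) = map_pmf f (map_pmf \<phi> (pmf_of_set I))"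
    using assms by (simp add: map_pmf_of_set_bij_betw)
  also have "\<dots> = map_pmf \<tau> (map_pmf f (pmf_of_set I))"
    unfolding pmf.map_comp using assms by (intro map_pmf_cong) (auto simp: set_pmf_of_set)
  finally have "pmf (map_pmf f (pmf_of_set I)) (\<tau> z) = pmf (map_pmf \<tau> (map_pmf f (pmf_of_set I))) (\<tau> z)" by simp
  then show ?thesis by (simp only: pmf_map_inj'[OF assms(4)])
qed

definition toggle :: "'a \<Rightarrow> 'a set \<Rightarrow> 'a set" where
  "toggle k A = (if k \<in> A then A - {k} else insert k A)"

lemma odd_card_toggle:
  assumes "finite A"
  shows "odd (card (toggle k A \<inter> X)) = (odd (card (A \<inter> X)) \<noteq> (k \<in> X))"
proof (cases "k \<in> X")
  case True
  then have "toggle k A \<inter> X = toggle k (A \<inter> X)" by (auto simp: toggle_def)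
  moreover have "odd (card (toggle k (A \<inter> X))) = even (card (A \<inter> X))"
    using assms by (cases "k \<in> A \<inter> X") (auto simp: toggle_def card_Diff_singleton card_gt_0_iff)
  ultimately show ?thesis using True by simp
next
  case False
  then have "toggle k A \<inter> X = A \<inter> X" by (auto simp: toggle_def)
  then show ?thesis using False by simp
qed

text \<open>Subsets of \<open>{..<b}\<close> stand for vectors over the field with two elements, and the parity of
  the intersection for their scalar product.\<close>

definition hash_bit :: "nat set \<times> bool \<Rightarrow> nat set \<Rightarrow> bool" where
  "hash_bit i X \<longleftrightarrow> odd (card (fst i \<inter> X)) \<noteq> snd i"

definition bit_indices :: "nat \<Rightarrow> (nat set \<times> bool) set" where
  "bit_indices b = Pow {..<b} \<times> UNIV"

text \<open>Symmetry replaces counting. Flipping the constant term negates both bits; toggling an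
  element \<open>k\<close> in which \<open>X\<close> and \<open>Y\<close> differ negates exactly
  one. These moves reach all four pairs from any one, so the pairs are equally likely.\<close>

lemma hash_bit_joint:
  assumes X: "X \<subseteq> {..<b}" "Y \<subseteq> {..<b}" "X \<noteq> Y"
  shows "map_pmf (\<lambda>i. (hash_bit i X, hash_bit i Y)) (pmf_of_set (bit_indices b)) =
    pair_pmf (pmf_of_set UNIV) (pmf_of_set UNIV)"
proof -
  define P where "P = map_pmf (\<lambda>i. (hash_bit i X, hash_bit i Y)) (pmf_of_set (bit_indices b))"
  have I: "finite (bit_indices b)" "bit_indices b \<noteq> {}" by (auto simp: bit_indices_def)
  obtain k where k: "k < b" "(k \<in> X) \<noteq> (k \<in> Y)" using X by blast
  have 1: "pmf P (\<not> u, \<not> v) = pmf P (u, v)" for u v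
  proof -
    have "pmf P ((\<lambda>(u, v). (\<not> u, \<not> v)) (u, v)) = pmf P (u, v)" unfolding P_def
    proof (rule map_pmf_equivariant[OF _ I])
      show "bij_betw (\<lambda>(A, c). (A, \<not> c)) (bit_indices b) (bit_indices b)"
        by (rule bij_betw_byWitness[where f' = "\<lambda>(A, c). (A, \<not> c)"]) (auto simp: bit_indices_def)
    qed (auto simp: inj_on_def hash_bit_def)
    then show ?thesis by simp
  qed
  have 2: "pmf P ((\<lambda>(u, v). (u \<noteq> (k \<in> X), v \<noteq> (k \<in> Y))) (u, v)) = pmf P (u, v)" for u v
    unfolding P_def
  proof (rule map_pmf_equivariant[OF _ I])
    show "bij_betw (\<lambda>(A, c). (toggle k A, c)) (bit_indices b) (bit_indices b)"
      using k(1) by (intro bij_betw_byWitness[where f' = "\<lambda>(A, c). (toggle k A, c)"])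
        (auto simp: bit_indices_def toggle_def split: if_splits)
    show "(hash_bit (case i of (A, c) \<Rightarrow> (toggle k A, c)) X, hash_bit (case i of (A, c) \<Rightarrow> (toggle k A, c)) Y) =
        (\<lambda>(u, v). (u \<noteq> (k \<in> X), v \<noteq> (k \<in> Y))) (hash_bit i X, hash_bit i Y)" if "i \<in> bit_indices b" for i
    proof -
      obtain A c where i: "i = (A, c)" by (cases i)
      have "finite A" using that by (auto simp: i bit_indices_def dest: finite_subset)
      then show ?thesis by (auto simp: i hash_bit_def odd_card_toggle)
    qed
  qed (auto simp: inj_on_def)
  have all: "pmf P z = pmf P (True, True)" for z
  proof (cases z)
    case (Pair u v)
    show ?thesis
      using k(2) 1[of True True] 1[of True False] 2[of True True] 2[of False False] 2[of True False] Pair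
      by (cases u; cases v; cases "k \<in> X") auto
  qed
  have "(\<Sum>z\<in>UNIV. pmf P z) = 1" by (rule sum_pmf_eq_1) auto
  moreover have "(\<Sum>z\<in>UNIV. pmf P z) = (\<Sum>z\<in>(UNIV :: (bool \<times> bool) set). pmf P (True, True))"
    by (intro sum.cong refl all)
  moreover have "card (UNIV :: (bool \<times> bool) set) = 4" by (simp add: card_prod)
  ultimately have "pmf P z = 1 / 4" for z using all[of z] by simp
  moreover have "pmf (pair_pmf (pmf_of_set UNIV) (pmf_of_set UNIV)) z = 1 / 4" for z :: "bool \<times> bool"
    by (cases z) (simp add: pmf_pair)
  ultimately show ?thesis unfolding P_def[symmetric] by (intro pmf_eqI) (simp only:)
qed

primrec hash_value :: "(nat set \<times> bool) list \<Rightarrow> nat set \<Rightarrow> nat" where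
  "hash_value [] X = 0"
| "hash_value (i # is) X = of_bool (hash_bit i X) + 2 * hash_value is X"

lemma uniform_double:
  "bind_pmf (pmf_of_set (UNIV :: bool set)) (\<lambda>u. bind_pmf (pmf_of_set {..<2 ^ r}) (\<lambda>a. return_pmf (of_bool u + 2 * a))) =
    pmf_of_set {..<2 ^ Suc r :: nat}"
proof -
  have ne: "{..<2 ^ r :: nat} \<noteq> {}" by (simp add: lessThan_empty_iff)
  have "bij_betw (\<lambda>(u, a). of_bool u + 2 * a) (UNIV \<times> {..<2 ^ r :: nat}) {..<2 ^ Suc r}"
    by (rule bij_betw_byWitness[where f' = "\<lambda>n. (odd n, n div 2)"]) auto
  then have "map_pmf (\<lambda>(u, a). of_bool u + 2 * a) (pmf_of_set (UNIV \<times> {..<2 ^ r :: nat})) = pmf_of_set {..<2 ^ Suc r}"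
    by (rule map_pmf_of_set_bij_betw) (use ne in auto)
  moreover have "pmf_of_set (UNIV \<times> {..<2 ^ r :: nat}) = pair_pmf (pmf_of_set (UNIV :: bool set)) (pmf_of_set {..<2 ^ r})"
    by (intro pmf_eqI) (auto simp: ne pmf_pair indicator_def card_cartesian_product split: prod.splits)
  ultimately show ?thesis by (simp add: pair_pmf_def map_bind_pmf)
qed

lemma hash_value_joint:
  assumes X: "X \<subseteq> {..<b}" "Y \<subseteq> {..<b}" "X \<noteq> Y"
  shows "map_pmf (\<lambda>is. (hash_value is X, hash_value is Y)) (draw_all (replicate r (pmf_of_set (bit_indices b)))) =
    pair_pmf (pmf_of_set {..<2 ^ r}) (pmf_of_set {..<2 ^ r})"
proof (induction r)
  case 0
  have "{..<1::nat} = {0}" by auto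
  then show ?case by (simp add: pmf_of_set_singleton)
next
  case (Suc r)
  let ?M = "pmf_of_set (bit_indices b)" and ?D = "draw_all (replicate r (pmf_of_set (bit_indices b)))"
  let ?B = "pmf_of_set (UNIV :: bool set)" and ?U = "pmf_of_set {..<2 ^ r :: nat}"
  have "map_pmf (\<lambda>is. (hash_value is X, hash_value is Y)) (draw_all (replicate (Suc r) ?M)) =
     bind_pmf ?M (\<lambda>i. bind_pmf ?D (\<lambda>is. return_pmf
       (of_bool (hash_bit i X) + 2 * hash_value is X, of_bool (hash_bit i Y) + 2 * hash_value is Y)))"
    by (simp add: draw_all_Cons map_bind_pmf del: draw_all.simps)
  also have "\<dots> = bind_pmf (map_pmf (\<lambda>i. (hash_bit i X, hash_bit i Y)) ?M) (\<lambda>(u, v).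
     bind_pmf (map_pmf (\<lambda>is. (hash_value is X, hash_value is Y)) ?D) (\<lambda>(a, c). return_pmf (of_bool u + 2 * a, of_bool v + 2 * c)))"
    by (simp add: bind_map_pmf)
  also have "\<dots> = bind_pmf ?B (\<lambda>u. bind_pmf ?B (\<lambda>v. bind_pmf ?U (\<lambda>a. bind_pmf ?U (\<lambda>c.
      return_pmf (of_bool u + 2 * a, of_bool v + 2 * c)))))"
    unfolding hash_bit_joint[OF X] Suc.IH by (simp add: pair_pmf_def bind_assoc_pmf bind_return_pmf)
  \<comment> \<open>The draws are regrouped by key instead of by binary digit.\<close>
  also have "\<dots> = bind_pmf ?B (\<lambda>u. bind_pmf ?U (\<lambda>a. bind_pmf ?B (\<lambda>v. bind_pmf ?U (\<lambda>c.
      return_pmf (of_bool u + 2 * a, of_bool v + 2 * c)))))"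
    by (intro bind_pmf_cong refl) (rule bind_commute_pmf)
  also have "\<dots> = pair_pmf (bind_pmf ?B (\<lambda>u. bind_pmf ?U (\<lambda>a. return_pmf (of_bool u + 2 * a))))
      (bind_pmf ?B (\<lambda>v. bind_pmf ?U (\<lambda>c. return_pmf (of_bool v + 2 * c))))"
    by (simp add: pair_pmf_def bind_assoc_pmf bind_return_pmf)
  finally show ?case unfolding uniform_double .
qed

definition enc_hash :: "(nat set \<times> bool \<Rightarrow> nat \<times> nat) \<Rightarrow> (nat set \<times> bool) list \<Rightarrow> word list" where
  "enc_hash e is = concat (map (\<lambda>i. [CounterWord (fst (e i)), ElemWord (snd (e i))]) is)"

lemma enc_hash_inj: "inj_on e I \<Longrightarrow> inj_on (enc_hash e) (lists I)"
proof (rule inj_onI)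
  fix xs ys
  assume e: "inj_on e I"
  show "xs \<in> lists I \<Longrightarrow> ys \<in> lists I \<Longrightarrow> enc_hash e xs = enc_hash e ys \<Longrightarrow> xs = ys"
  proof (induction xs arbitrary: ys)
    case Nil
    then show ?case by (cases ys) (auto simp: enc_hash_def)
  next
    case (Cons x xs)
    then obtain y ys' where ys: "ys = y # ys'" by (cases ys) (auto simp: enc_hash_def)
    then have "e x = e y" using Cons.prems by (simp add: enc_hash_def prod_eq_iff)
    then have "x = y" using inj_onD[OF e] Cons.prems ys by auto
    then show ?case using Cons ys by (simp add: enc_hash_def)
  qed
qed

text \<open>The seed of one output bit is one of \<open>2 * 2 ^ b <= 4 * U\<close> possibilities, so
  it fits into a counter below 4 and a universe element; \<open>r\<close> output bits take
  \<open>2 * r\<close> words.\<close>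

lemma ex_pairwise_independent_hashing:
  "\<exists>G h. pairwise_independent_hashing U (2 ^ r) G h \<and>
     (\<forall>g\<in>set_pmf G. length g \<le> 2 * r \<and> (\<forall>v\<in>set g. (\<exists>c<4. v = CounterWord c) \<or> (\<exists>u\<in>{1..U}. v = ElemWord u)))"
proof (cases "U = 0")
  case True
  then show ?thesis
    by (intro exI[of _ "return_pmf []"] exI) (auto simp: pairwise_independent_hashing_def)
next
  case False
  define b where "b = (LEAST b. U < 2 ^ b)"
  have b: "U < 2 ^ b" unfolding b_def by (rule LeastI[of _ U]) (rule less_exp)
  have b': "2 ^ b \<le> 2 * U"
  proof (cases b)
    case 0 then show ?thesis using False by simp
  next
    case (Suc a)
    then have "\<not> U < 2 ^ a" using not_less_Least[of a "\<lambda>b. U < 2 ^ b"] by (simp add: b_def)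
    then show ?thesis using Suc by simp
  qed
  \<comment> \<open>The extra key 0 gives every key a partner, so that single hash values are
    uniform as marginals of the joint distribution, even for \<open>U = 1\<close>.\<close>
  have "card {0..U} \<le> card (Pow {..<b})" using b by (simp add: card_Pow)
  then obtain X where X: "X ` {0..U} \<subseteq> Pow {..<b}" "inj_on X {0..U}"
    using card_le_inj[of "{0..U}" "Pow {..<b}"] by auto
  have "card (bit_indices b) \<le> card ({..<4::nat} \<times> {1..U})"
    using b' by (simp add: bit_indices_def card_cartesian_product card_Pow)
  then obtain e :: "nat set \<times> bool \<Rightarrow> nat \<times> nat" where e: "e ` bit_indices b \<subseteq> {..<4} \<times> {1..U}" "inj_on e (bit_indices b)"
    using card_le_inj[of "bit_indices b" "{..<4::nat} \<times> {1..U}"] by (auto simp: bit_indices_def)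
  let ?D = "draw_all (replicate r (pmf_of_set (bit_indices b)))"
  have I: "finite (bit_indices b)" "bit_indices b \<noteq> {}" by (auto simp: bit_indices_def)
  have D: "is \<in> lists (bit_indices b) \<and> length is = r" if "is \<in> set_pmf ?D" for "is"
  proof -
    have "list_all2 (\<lambda>i p. i \<in> set_pmf p) is (replicate r (pmf_of_set (bit_indices b)))"
      using that by (simp add: set_draw_all)
    note all2 = this
    have len: "length is = r" using list_all2_lengthD[OF all2] by simp
    have nth: "is ! j \<in> bit_indices b" if "j < r" for j
      using list_all2_nthD[OF all2, of j] len that by (simp add: set_pmf_of_set[OF I(2,1)])
    have "set is \<subseteq> bit_indices b"
    proof
      fix i assume "i \<in> set is"
      then obtain j where "j < r" "i = is ! j" using len by (auto simp: in_set_conv_nth)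
      then show "i \<in> bit_indices b" using nth by simp
    qed
    then show ?thesis using len by (auto simp: in_lists_conv_set)
  qed
  define h where "h g x = hash_value (the_inv_into (lists (bit_indices b)) (enc_hash e) g) (X x)" for g x
  define G where "G = map_pmf (enc_hash e) ?D"
  have h_enc: "h (enc_hash e is) = (\<lambda>x. hash_value is (X x))" if "is \<in> set_pmf ?D" for "is"
    using the_inv_into_f_f[OF enc_hash_inj[OF e(2)], of "is"] D[OF that] by (intro ext) (simp add: h_def)
  have hG: "map_pmf (\<lambda>g. F (h g)) G = map_pmf (\<lambda>is. F (\<lambda>x. hash_value is (X x))) ?D" for F :: "(nat \<Rightarrow> nat) \<Rightarrow> 'z"
    unfolding G_def pmf.map_comp
    by (intro map_pmf_cong refl) (simp add: h_enc)
  have joint: "map_pmf (\<lambda>g. (h g x, h g y)) G = pair_pmf (pmf_of_set {..<2 ^ r}) (pmf_of_set {..<2 ^ r})"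
    if "x \<in> {0..U}" "y \<in> {0..U}" "x \<noteq> y" for x y
  proof -
    have "X x \<subseteq> {..<b}" "X y \<subseteq> {..<b}" using X(1) that by blast+
    moreover have "X x \<noteq> X y" using X(2) that by (auto simp: inj_on_eq_iff)
    ultimately show ?thesis using hG[of "\<lambda>f. (f x, f y)"] hash_value_joint by simp
  qed
  have "pairwise_independent_hashing U (2 ^ r) G h"
    unfolding pairwise_independent_hashing_def
  proof (intro conjI ballI impI)
    fix x assume x: "x \<in> {1..U}"
    have "map_pmf (\<lambda>g. h g x) G = map_pmf fst (map_pmf (\<lambda>g. (h g x, h g 0)) G)"
      by (simp add: pmf.map_comp o_def)
    also have "\<dots> = pmf_of_set {..<2 ^ r}" using x by (subst joint) (auto simp: map_fst_pair_pmf)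
    finally show "map_pmf (\<lambda>g. h g x) G = pmf_of_set {..<2 ^ r}" .
  next
    fix x y assume "x \<in> {1..U}" "y \<in> {1..U}" "x \<noteq> y"
    then show "prob_space.indep_var (measure_pmf G) (count_space UNIV) (\<lambda>g. h g x) (count_space UNIV) (\<lambda>g. h g y)"
      by (intro indep_var_of_joint[OF joint]) auto
  qed
  moreover have "length g \<le> 2 * r \<and> (\<forall>v\<in>set g. (\<exists>c<4. v = CounterWord c) \<or> (\<exists>u\<in>{1..U}. v = ElemWord u))"
    if "g \<in> set_pmf G" for g
  proof -
    from that obtain "is" where g: "g = enc_hash e is" and "is": "is \<in> set_pmf ?D" by (auto simp: G_def)
    have "length g = 2 * length is" unfolding g by (induction "is") (auto simp: enc_hash_def)
    moreover have "(\<exists>c<4. v = CounterWord c) \<or> (\<exists>u\<in>{1..U}. v = ElemWord u)" if "v \<in> set g" for v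
    proof -
      from that obtain i where "i \<in> set is" "v = CounterWord (fst (e i)) \<or> v = ElemWord (snd (e i))"
        by (auto simp: g enc_hash_def)
      moreover from this D[OF "is"] have "e i \<in> {..<4} \<times> {1..U}" using e(1) by auto
      ultimately show ?thesis by (auto simp: mem_Times_iff)
    qed
    ultimately show ?thesis using D[OF "is"] by simp
  qed
  ultimately show ?thesis by blast
qed

section \<open>Choice of the parameters\<close>

lemma ex_power_of_2:
  fixes x :: real
  assumes "1 \<le> x"
  shows "\<exists>n. x \<le> 2 ^ n \<and> 2 ^ n \<le> 2 * x"
proof -
  obtain m where m: "x < 2 ^ m" using real_arch_pow[of 2 x] by auto
  define n where "n = (LEAST n. x \<le> 2 ^ n)"
  have n: "x \<le> 2 ^ n" unfolding n_def by (rule LeastI[of _ m]) (use m in simp)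
  have "2 ^ n \<le> 2 * x"
  proof (cases n)
    case 0
    then show ?thesis using assms by simp
  next
    case (Suc k)
    then have "\<not> x \<le> 2 ^ k" using not_less_Least[of k "\<lambda>n. x \<le> 2 ^ n"] by (simp add: n_def)
    then show ?thesis using Suc by simp
  qed
  then show ?thesis using n by blast
qed

lemma two_ln2: "(1::real) \<le> 2 * ln 2"
proof -
  have "exp (1 / 2 :: real) \<le> 1 + 1 / 2 + (1 / 2)\<^sup>2" by (rule exp_le_quadratic) simp
  then have "exp (1 / 2 :: real) \<le> 2" by (simp add: power2_eq_square)
  then have "1 / 2 \<le> ln (2::real)" by (subst ln_ge_iff) auto
  then show ?thesis by simp
qed

lemma exponent_le:
  fixes y :: real
  assumes "2 ^ n \<le> y"
  shows "real n \<le> 2 * ln y"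
proof -
  have "real n * ln 2 = ln (2 ^ n)" by (simp add: ln_realpow)
  also have "\<dots> \<le> ln y" using assms by (subst ln_le_cancel_iff) (auto intro: less_le_trans[of 0 "2 ^ n"])
  finally have "2 * (real n * ln 2) \<le> 2 * ln y" by simp
  moreover have "real n * 1 \<le> real n * (2 * ln 2)" using two_ln2 by (intro mult_left_mono) auto
  ultimately show ?thesis by simp
qed

lemma (in expiration_counter) approximate_word_counter:
  assumes "0 \<le> e" "2 \<le> e * 2 ^ J" "2 * exp (- (2 ^ ell / 12)) \<le> \<gamma>"
  shows "approximate_counter e \<gamma> word_counter"
  unfolding approximate_counter_def
proof (intro allI impI)
  fix ls t assume "valid_lifetimes ls \<and> inserted_by t ls"
  then have "1 - \<gamma> \<le> measure_pmf.prob (run word_counter ls)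
      {w. \<bar>estimate word_counter t w - real (active_count t ls)\<bar> \<le> 2 * length ls / 2 ^ J}"
    using word_counter_accurate[of t ls] assms(3) by linarith
  also have "\<dots> \<le> measure_pmf.prob (run word_counter ls)
      {w. \<bar>estimate word_counter t w - real (active_count t ls)\<bar> \<le> e * real (length ls)}"
  proof (intro measure_pmf.finite_measure_mono Collect_mono impI)
    have "2 * real (length ls) \<le> (e * 2 ^ J) * real (length ls)" using assms(2) by (intro mult_right_mono) auto
    then have "2 * length ls / 2 ^ J \<le> e * real (length ls)" by (simp add: pos_divide_le_eq ac_simps)
    then show "\<bar>estimate word_counter t w - real (active_count t ls)\<bar> \<le> e * real (length ls)"
      if "\<bar>estimate word_counter t w - real (active_count t ls)\<bar> \<le> 2 * length ls / 2 ^ J" for w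
      using that by linarith
  qed simp
  finally show "1 - \<gamma> \<le> measure_pmf.prob (run word_counter ls)
      {w. \<bar>estimate word_counter t w - real (active_count t ls)\<bar> \<le> e * real (length ls)}" .
qed

lemma approximate_counter_mono:
  assumes "approximate_counter e \<gamma> K" "e \<le> e'" "\<gamma> \<le> \<gamma>'"
  shows "approximate_counter e' \<gamma>' K"
  unfolding approximate_counter_def
proof (intro allI impI)
  fix ls t assume "valid_lifetimes ls \<and> inserted_by t ls"
  then have "1 - \<gamma> \<le> measure_pmf.prob (run K ls) {s. \<bar>estimate K t s - real (active_count t ls)\<bar> \<le> e * real (length ls)}"
    using assms(1) by (simp add: approximate_counter_def)
  also have "\<dots> \<le> measure_pmf.prob (run K ls) {s. \<bar>estimate K t s - real (active_count t ls)\<bar> \<le> e' * real (length ls)}"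
    using mult_right_mono[OF assms(2), of "real (length ls)" for ls]
    by (intro measure_pmf.finite_measure_mono Collect_mono impI) (auto intro: order_trans)
  finally show "1 - \<gamma>' \<le> measure_pmf.prob (run K ls) {s. \<bar>estimate K t s - real (active_count t ls)\<bar> \<le> e' * real (length ls)}"
    using assms(3) by simp
qed

text \<open>The hash function of a row takes at most \<open>2 * r <= 2 * 2 ^ r\<close> words. This
  is two per cell, which turns 160 into 162.\<close>

lemma (in expiration_counter) count_min_words:
  assumes H: "pairwise_independent_hashing U (2 ^ r) G h"
    and G: "\<And>g. g \<in> set_pmf G \<Longrightarrow> length g \<le> 2 * r \<and> (\<forall>v\<in>set g. (\<exists>c<4. v = CounterWord c) \<or> (\<exists>u\<in>{1..U}. v = ElemWord u))"
    and xs: "fst ` set xs \<subseteq> {1..U}"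
    and st: "st \<in> set_pmf (run (count_min d (2 ^ r) G h word_counter) xs)"
  shows "length (cm_words st) \<le> d * (2 ^ r * (162 * (ell + 1) * 2 ^ J))"
    and "v \<in> set (cm_words st) \<Longrightarrow> storable 2 U xs v"
proof -
  let ?w = "2 ^ r :: nat"
  have hl: "h g (fst x) < ?w" if "g \<in> set_pmf G" "x \<in> set xs" for g x
    using hash_less[OF H _ _ that(1)] xs that(2) by auto
  have "run (count_min d ?w G h word_counter) xs = draw_all (replicate d (row ?w G h word_counter xs))"
    by (rule run_count_min) (rule hl)
  then have "st \<in> set_pmf (draw_all (replicate d (row ?w G h word_counter xs)))" using st by simp
  then have all2: "list_all2 (\<lambda>y p. y \<in> set_pmf p) st (replicate d (row ?w G h word_counter xs))"
    by (simp add: set_draw_all)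
  then have lst: "length st = d" by (auto dest: list_all2_lengthD)
  have rows: "y \<in> set_pmf (row ?w G h word_counter xs)" if y: "y \<in> set st" for y
  proof -
    obtain j where "j < length st" "y = st ! j" using y by (auto simp: in_set_conv_nth)
    then show ?thesis using list_all2_nthD[OF all2, of j] lst by simp
  qed
  have parts: "g \<in> set_pmf G \<and> length cells = ?w \<and>
      (\<forall>c\<in>set cells. \<exists>i. \<exists>\<sigma>\<in>set_pmf (counting (map snd (cell_lifetimes (h g) i xs))). c = enc_state \<sigma>)"
    if y: "(g, cells) \<in> set st" for g cells
  proof -
    have "g \<in> set_pmf G" and "cells \<in> set_pmf (draw_all (map (\<lambda>c. run word_counter (cell_lifetimes (h g) c xs)) [0..<?w]))"
      using rows[OF y] by (auto simp: row_def)
    then have c2: "list_all2 (\<lambda>y p. y \<in> set_pmf p) cells (map (\<lambda>c. run word_counter (cell_lifetimes (h g) c xs)) [0..<?w])"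
      by (simp add: set_draw_all)
    have lc: "length cells = ?w" using list_all2_lengthD[OF c2] by simp
    have "\<exists>i. \<exists>\<sigma>\<in>set_pmf (counting (map snd (cell_lifetimes (h g) i xs))). c = enc_state \<sigma>" if c: "c \<in> set cells" for c
    proof -
      obtain j where j: "j < length cells" "c = cells ! j" using c by (auto simp: in_set_conv_nth)
      then have "c \<in> set_pmf (run word_counter (cell_lifetimes (h g) j xs))"
        using list_all2_nthD[OF c2 j(1)] lc by simp
      then show ?thesis by (auto simp: run_word_counter)
    qed
    then show ?thesis using \<open>g \<in> set_pmf G\<close> lc by blast
  qed
  have cell_length: "length (enc_state \<sigma>) \<le> 160 * (ell + 1) * 2 ^ J" if "\<sigma> \<in> set_pmf (counting es)" for \<sigma> es
    using counting_support[OF that] length_enc_state by blast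
  have row_length: "length ((\<lambda>(g, cells). g @ concat cells) y) \<le> ?w * (162 * (ell + 1) * 2 ^ J)" if "y \<in> set st" for y
  proof -
    obtain g cells where y: "y = (g, cells)" by (cases y)
    note P = parts[of g cells, OF that[unfolded y]]
    have "length (concat cells) = (\<Sum>c\<leftarrow>cells. length c)" by (simp add: length_concat)
    also have "\<dots> \<le> (\<Sum>c\<leftarrow>cells. 160 * (ell + 1) * 2 ^ J)"
    proof (rule sum_list_mono)
      fix c assume "c \<in> set cells"
      then obtain i \<sigma> where "\<sigma> \<in> set_pmf (counting (map snd (cell_lifetimes (h g) i xs)))" "c = enc_state \<sigma>"
        using P by blast
      then show "length c \<le> 160 * (ell + 1) * 2 ^ J" using cell_length by simp
    qed
    also have "\<dots> = ?w * (160 * (ell + 1) * 2 ^ J)" using P by (simp add: sum_list_triv)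
    finally have "length (concat cells) \<le> ?w * (160 * (ell + 1) * 2 ^ J)" .
    moreover have "length g \<le> 2 * ?w" using G[of g] P less_exp[of r] by linarith
    moreover have "?w * 2 \<le> ?w * (2 * ((ell + 1) * 2 ^ J))"
    proof (rule mult_le_mono2)
      have "0 < (ell + 1) * (2 ^ J :: nat)" by simp
      then show "2 \<le> 2 * ((ell + 1) * 2 ^ J)" by linarith
    qed
    ultimately have "length (g @ concat cells) \<le> ?w * (2 * ((ell + 1) * 2 ^ J)) + ?w * (160 * (ell + 1) * 2 ^ J)"
      unfolding length_append by linarith
    also have "\<dots> = ?w * (162 * (ell + 1) * 2 ^ J)" by (simp add: algebra_simps)
    finally show ?thesis by (simp add: y)
  qed
  have "length (cm_words st) = (\<Sum>y\<leftarrow>st. length ((\<lambda>(g, cells). g @ concat cells) y))"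
    by (simp add: cm_words_def length_concat o_def)
  also have "\<dots> \<le> (\<Sum>y\<leftarrow>st. ?w * (162 * (ell + 1) * 2 ^ J))" by (intro sum_list_mono row_length)
  also have "\<dots> = d * (?w * (162 * (ell + 1) * 2 ^ J))" by (simp add: sum_list_triv lst)
  finally show "length (cm_words st) \<le> d * (?w * (162 * (ell + 1) * 2 ^ J))" .
  assume "v \<in> set (cm_words st)"
  then obtain g cells where gc: "(g, cells) \<in> set st" and v: "v \<in> set g \<or> (\<exists>c\<in>set cells. v \<in> set c)"
    by (auto simp: cm_words_def)
  note P = parts[OF gc]
  from v show "storable 2 U xs v"
  proof
    assume "v \<in> set g"
    then consider c where "c < 4" "v = CounterWord c" | u where "u \<in> {1..U}" "v = ElemWord u" using G P by blast
    then show ?thesis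
    proof cases
      case 1
      \<comment> \<open>The exponent 2 of the counter bound is due to the empty stream: there the
        base is 2, while seeds may use the counter 3.\<close>
      have "2 ^ 2 \<le> (length xs + 2) ^ 2" by (intro power_mono) auto
      then show ?thesis using 1 by simp
    qed simp
  next
    assume "\<exists>c\<in>set cells. v \<in> set c"
    then obtain c where c: "c \<in> set cells" "v \<in> set c" by blast
    then obtain i \<sigma> where "\<sigma> \<in> set_pmf (counting (map snd (cell_lifetimes (h g) i xs)))" "c = enc_state \<sigma>"
      using P by blast
    then have \<sigma>: "\<sigma> \<in> set_pmf (counting (map snd (cell_lifetimes (h g) i xs)))" "v \<in> set (enc_state \<sigma>)"
      using c by simp_all
    show ?thesis
    proof (rule storable_enc_state[OF \<sigma>(1) _ _ \<sigma>(2)])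
      show "length (map snd (cell_lifetimes (h g) i xs)) \<le> length xs" by (simp add: length_cell_lifetimes)
      show "\<exists>x s. (x, s, e) \<in> set xs" if "e \<in> set (map snd (cell_lifetimes (h g) i xs))" for e
        using that by (auto simp: cell_lifetimes_def) blast
    qed
  qed
qed

theorem theorem5p5:
  "\<exists>(C::real) (k::nat). \<forall>(\<epsilon>::real) (\<delta>::real) (U::nat).
     0 < \<epsilon> \<and> \<epsilon> < 1 \<and> 0 < \<delta> \<and> \<delta> < 1 \<longrightarrow>
     (\<exists>A. expiration_count_min U \<epsilon> \<delta> A \<and>
        (\<forall>xs. general_expiration_stream U xs \<longrightarrow>
           (\<forall>st\<in>set_pmf (run A xs).
              real (length (cm_words st)) \<le> C * word_bound \<epsilon> \<delta> \<and>
              (\<forall>v\<in>set (cm_words st). storable k U xs v)) \<and>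
           (\<forall>t q. inserted_by t (map snd xs) \<and> q \<in> {1..U} \<longrightarrow>
              measure_pmf.prob (run A xs)
                {st. \<bar>estimate A (t, q) st - real (frequency t xs q)\<bar> \<le> \<epsilon> * real (length xs)}
              \<ge> 1 - \<delta>)))"
proof (rule exI[of _ 2612736], rule exI[of _ 2], intro allI impI)
  fix \<epsilon> \<delta> :: real and U :: nat
  assume "0 < \<epsilon> \<and> \<epsilon> < 1 \<and> 0 < \<delta> \<and> \<delta> < 1"
  then have \<epsilon>: "0 < \<epsilon>" "\<epsilon> < 1" and \<delta>: "0 < \<delta>" "\<delta> < 1" by auto
  define L where "L = max 1 (ln (1 / \<delta>))"
  define LL where "LL = max 1 (ln (ln (1 / \<delta>)))"
  have L1: "1 \<le> L" "1 \<le> LL" "ln (1 / \<delta>) \<le> L" by (auto simp: L_def LL_def)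
  \<comment> \<open>\<open>r\<close> meets the requirement \<open>8 <= \<epsilon> * w\<close> of the
    collision bound, \<open>J\<close> brings the counter error \<open>2 * n / 2 ^ J\<close> down to
    \<open>\<epsilon> / 2 * n\<close>, and \<open>d\<close> brings \<open>(1 / 2) ^ d\<close> down
    to \<open>\<delta> / 2\<close>.\<close>
  obtain r where r: "8 / \<epsilon> \<le> 2 ^ r" "2 ^ r \<le> 2 * (8 / \<epsilon>)" using ex_power_of_2[of "8 / \<epsilon>"] \<epsilon> by auto
  obtain J where J: "4 / \<epsilon> \<le> 2 ^ J" "2 ^ J \<le> 2 * (4 / \<epsilon>)" using ex_power_of_2[of "4 / \<epsilon>"] \<epsilon> by auto
  obtain d where d: "2 / \<delta> \<le> 2 ^ d" "2 ^ d \<le> 2 * (2 / \<delta>)" using ex_power_of_2[of "2 / \<delta>"] \<delta> by auto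
  have d0: "0 < d"
  proof (rule ccontr)
    assume "\<not> 0 < d"
    then have "2 / \<delta> \<le> 1" using d(1) by simp
    then show False using \<delta> by (simp add: pos_divide_le_eq)
  qed
  have ln4: "ln (4::real) \<le> 2"
    using ln_le_minus_one[of "2::real"] ln_realpow[of "2::real" 2] by simp
  have dL: "real d \<le> 6 * L"
  proof -
    have "real d \<le> 2 * ln (4 / \<delta>)" using exponent_le[OF d(2)] by simp
    also have "ln (4 / \<delta>) = ln 4 + ln (1 / \<delta>)" using \<delta> by (simp add: ln_div)
    also have "2 * (ln 4 + ln (1 / \<delta>)) \<le> 2 * (2 + L)" using ln4 L1 by simp
    also have "\<dots> \<le> 6 * L" using L1 by simp
    finally show ?thesis .
  qed
  \<comment> \<open>The union bound over the rows then costs \<open>\<delta> / 4\<close>, next to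
    \<open>\<delta> / 2\<close> for overestimation.\<close>
  define \<gamma> where "\<gamma> = \<delta> / (4 * d)"
  have \<gamma>0: "0 < \<gamma>" using \<delta> d0 by (simp add: \<gamma>_def)
  have d\<gamma>: "d * \<gamma> = \<delta> / 4" using d0 by (simp add: \<gamma>_def)
  have "1 * \<gamma> \<le> d * \<gamma>" using d0 \<gamma>0 by (intro mult_right_mono) auto
  then have \<gamma>\<delta>: "\<gamma> \<le> \<delta> / 4" using d\<gamma> by simp
  \<comment> \<open>The counter fails with probability at most \<open>\<gamma>\<close> once
    \<open>2 ^ ell / 12\<close> reaches \<open>M\<close>. Since \<open>M\<close> is at most a
    constant multiple of \<open>L\<close>, \<open>ell\<close> is at most one of
    \<open>LL\<close>.\<close>
  define M where "M = ln (2 / \<gamma>)"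
  have M: "1 \<le> M" "M \<le> 12 * L"
  proof -
    have "exp 1 \<le> (8::real)" using exp_le by simp
    also have "8 \<le> 2 / \<gamma>"
    proof -
      have "8 * \<gamma> \<le> 2" using \<gamma>\<delta> \<delta> by simp
      then show ?thesis using \<gamma>0 by (simp add: pos_le_divide_eq)
    qed
    finally show "1 \<le> M" unfolding M_def using \<gamma>0 by (subst ln_ge_iff) auto
    have "M = ln (8 * (real d * (1 / \<delta>)))" by (simp add: M_def \<gamma>_def)
    also have "\<dots> = ln 8 + (ln d + ln (1 / \<delta>))" using d0 \<delta> by (simp add: ln_mult ln_div)
    also have "\<dots> \<le> 5 + (6 * L + L)"
    proof -
      have "ln (8::real) = 3 * ln 2" using ln_realpow[of "2::real" 3] by simp
      then have "ln (8::real) \<le> 5" using ln_le_minus_one[of "2::real"] by simp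
      moreover have "ln (real d) \<le> 6 * L" using ln_le_minus_one[of "real d"] d0 dL by simp
      ultimately show ?thesis using L1 by simp
    qed
    also have "\<dots> \<le> 12 * L" using L1 by simp
    finally show "M \<le> 12 * L" .
  qed
  obtain ell where ell: "12 * M \<le> 2 ^ ell" "2 ^ ell \<le> 2 * (12 * M)" using ex_power_of_2[of "12 * M"] M by auto
  have ellLL: "real (ell + 1) \<le> 21 * LL"
  proof -
    have "ln L \<le> LL" using L1 by (auto simp: L_def LL_def max_def)
    \<comment> \<open>Here \<open>2 * 12 * 12 = 288\<close> is rounded up to a power of two.\<close>
    have "2 ^ ell \<le> 2 ^ 9 * L" using ell(2) M(2) L1 by simp
    then have "real ell \<le> 2 * ln (2 ^ 9 * L)" by (rule exponent_le)
    also have "ln (2 ^ 9 * L) = 9 * ln 2 + ln L" using L1 ln_realpow[of "2::real" 9] by (simp add: ln_mult)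
    also have "2 * (9 * ln 2 + ln L) \<le> 2 * (9 + LL)"
      using \<open>ln L \<le> LL\<close> ln_le_minus_one[of "2::real"] by simp
    also have "\<dots> \<le> 20 * LL" using L1 by simp
    finally show ?thesis using L1 by simp
  qed
  interpret ec: expiration_counter J ell .
  have exp_bound: "2 * exp (- (2 ^ ell / 12)) \<le> \<gamma>"
  proof -
    have "exp (- (2 ^ ell / 12)) \<le> exp (- M)" using ell(1) by simp
    also have "exp (- M) = \<gamma> / 2" using \<gamma>0 by (simp add: M_def exp_minus)
    finally show ?thesis by simp
  qed
  have K: "approximate_counter (\<epsilon> / 2) \<gamma> ec.word_counter"
    using exp_bound J(1) \<epsilon> by (intro ec.approximate_word_counter) (simp_all add: pos_divide_le_eq mult.commute)
  obtain G h where H: "pairwise_independent_hashing U (2 ^ r) G h"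
    and G: "\<forall>g\<in>set_pmf G. length g \<le> 2 * r \<and> (\<forall>v\<in>set g. (\<exists>c<4. v = CounterWord c) \<or> (\<exists>u\<in>{1..U}. v = ElemWord u))"
    using ex_pairwise_independent_hashing[of U r] by blast
  define A where "A = count_min d (2 ^ r) G h ec.word_counter"
  have "approximate_counter \<epsilon> \<delta> ec.word_counter"
    using \<epsilon> \<gamma>\<delta> \<delta> by (intro approximate_counter_mono[OF K]) auto
  then have cm: "expiration_count_min U \<epsilon> \<delta> A"
    unfolding expiration_count_min_def A_def using d0 H by (intro exI conjI) auto
  have space: "real (d * (2 ^ r * (162 * (ell + 1) * 2 ^ J))) \<le> 2612736 * word_bound \<epsilon> \<delta>"
  proof -
    have "real (d * (2 ^ r * (162 * (ell + 1) * 2 ^ J))) = real d * (2 ^ r * (162 * real (ell + 1) * 2 ^ J))" by simp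
    \<comment> \<open>The constant is \<open>6 * 16 * 162 * 21 * 8\<close>, with one factor each for
      rows, cells per row, the word count of a cell, \<open>ell + 1\<close> and
      \<open>2 ^ J\<close>.\<close>
    also have "\<dots> \<le> (6 * L) * (2 * (8 / \<epsilon>) * (162 * (21 * LL) * (2 * (4 / \<epsilon>))))"
      using dL ellLL r(2) J(2) \<epsilon> L1 by (intro mult_mono mult_nonneg_nonneg) auto
    also have "\<dots> = 2612736 * word_bound \<epsilon> \<delta>"
      using \<epsilon> by (simp add: word_bound_def L_def LL_def power2_eq_square)
    finally show ?thesis .
  qed
  show "\<exists>A. expiration_count_min U \<epsilon> \<delta> A \<and>
        (\<forall>xs. general_expiration_stream U xs \<longrightarrow>
           (\<forall>st\<in>set_pmf (run A xs).
              real (length (cm_words st)) \<le> 2612736 * word_bound \<epsilon> \<delta> \<and>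
              (\<forall>v\<in>set (cm_words st). storable 2 U xs v)) \<and>
           (\<forall>t q. inserted_by t (map snd xs) \<and> q \<in> {1..U} \<longrightarrow>
              measure_pmf.prob (run A xs)
                {st. \<bar>estimate A (t, q) st - real (frequency t xs q)\<bar> \<le> \<epsilon> * real (length xs)}
              \<ge> 1 - \<delta>))"
  proof (intro exI[of _ A] conjI allI impI ballI cm)
    fix xs st assume xs: "general_expiration_stream U xs" and st: "st \<in> set_pmf (run A xs)"
    have dom: "fst ` set xs \<subseteq> {1..U}" using xs by (simp add: general_expiration_stream_def)
    note W = ec.count_min_words[OF H _ dom st[unfolded A_def]]
    have "length (cm_words st) \<le> d * (2 ^ r * (162 * (ell + 1) * 2 ^ J))" by (rule W(1)) (use G in blast)
    then have "real (length (cm_words st)) \<le> real (d * (2 ^ r * (162 * (ell + 1) * 2 ^ J)))" by (simp only: of_nat_le_iff)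
    then show "real (length (cm_words st)) \<le> 2612736 * word_bound \<epsilon> \<delta>" using space by (rule order_trans)
    show "storable 2 U xs v" if "v \<in> set (cm_words st)" for v
      by (rule W(2)[OF _ that]) (use G in blast)
  next
    fix xs t q assume xs: "general_expiration_stream U xs" and tq: "inserted_by t (map snd xs) \<and> q \<in> {1..U}"
    have "8 \<le> \<epsilon> * real (2 ^ r)" using r(1) \<epsilon> by (simp add: pos_divide_le_eq mult.commute)
    moreover have "\<gamma> \<le> 1 / 4" using \<gamma>\<delta> \<delta> by simp
    ultimately have "1 - (d * \<gamma> + (1 / 2) ^ d) \<le> measure_pmf.prob (run A xs)
        {st. \<bar>estimate A (t, q) st - real (frequency t xs q)\<bar> \<le> \<epsilon> * real (length xs)}"
      unfolding A_def using tq by (intro count_min_accurate[OF \<epsilon>(1) d0 _ H K _ xs]) auto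
    moreover have "(1 / 2 :: real) ^ d \<le> \<delta> / 2"
    proof -
      have "2 \<le> \<delta> * 2 ^ d" using d(1) \<delta> by (simp add: pos_divide_le_eq mult.commute)
      then show ?thesis by (simp add: power_one_over divide_simps)
    qed
    ultimately show "1 - \<delta> \<le> measure_pmf.prob (run A xs)
        {st. \<bar>estimate A (t, q) st - real (frequency t xs q)\<bar> \<le> \<epsilon> * real (length xs)}"
      using d\<gamma> \<delta> by simp
  qed
qed

end
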